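(* Let $k$ be a field of characteristic zero, let $E\in\mathrm{GL}_m(k)$ and $t\in k$. Then the algebra $\mathcal A_{E^{-1},t}$ has a right $\mathcal B(E)$-comodule algebra structure defined by $$\alpha(x_i)=\sum_{k=1}^m x_k\otimes a_{ki}.$$ Let moreover $F\in\mathrm{GL}_n(k)$ be such that $\mathrm{tr}(E^{-1}E^t)=\mathrm{tr}(F^{-1}F^t)$, with $m,n\ge2$, and consider the monoidal equivalence $\Theta:\mathrm{Comod}(\mathcal B(E))\to\mathrm{Comod}(\mathcal B(F))$, $V\mapsto V\square_{\mathcal B(E)}\mathcal B(E,F)$, induced by the $\mathcal B(E)$-$\mathcal B(F)$-bi-Galois object $\mathcal B(E,F)$. Then there is an isomorphism of right $\mathcal B(F)$-comodule algebras $\Theta(\mathcal A_{E^{-1},t})\cong\mathcal A_{F^{-1},t}$.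
   Context: For $M=(\alpha_{ij})\in M_m(k)$ and $t\in k$, $\mathcal A_{M,t}$ is the $k$-algebra presented by generators $x_1,\ldots,x_m$ and the single relation $\sum_{i,j=1}^m\alpha_{ij}x_ix_j=t$. For $E\in\mathrm{GL}_m(k)$ and $F\in\mathrm{GL}_n(k)$, $\mathcal B(E,F)$ is the $k$-algebra presented by generators $a_{ij}$, $1\le i\le m$, $1\le j\le n$, with relations $F^{-1}a^tEa=I_n$ and $aF^{-1}a^tE=I_m$, where $a=(a_{ij})$ and the superscript $t$ on a matrix denotes transpose. $\mathcal B(E)=\mathcal B(E,E)$ is a Hopf algebra with $\Delta(a_{ij})=\sum_k a_{ik}\otimes a_{kj}$, $\varepsilon(a_{ij})=\delta_{ij}$, $S(a)=E^{-1}a^tE$. $\mathcal B(E,F)$ is a $\mathcal B(E)$-$\mathcal B(F)$-bicomodule algebra with both coactions given on generators by $a_{ij}\mapsto\sum_k a_{ik}\otimes a_{kj}$; when $\mathrm{tr}(E^{-1}E^t)=\mathrm{tr}(F^{-1}F^t)$ with $m,n\ge 2$ it is bi-Galois and $\Theta$ is a monoidal equivalence. Here $V\square_CW=\ker(\alpha_V\otimes1_W-1_V\otimes\alpha_W)\subset V\otimes W$ is the cotensor product, with right coaction on $V\square_{\mathcal B(E)}\mathcal B(E,F)$ induced by that of $\mathcal B(E,F)$; the monoidal constraints of $\Theta$ are $(\sum_i v_i\otimes a_i)\otimes(\sum_jw_j\otimes b_j)\mapsto\sum_{i,j}v_i\otimes w_j\otimes a_ib_j$. For a comodule algebra $B$,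 $\Theta(B)$ is the subalgebra $B\square_{\mathcal B(E)}\mathcal B(E,F)$ of $B\otimes\mathcal B(E,F)$. *)

theory Defs
  imports "HOL-Library.Poly_Mapping" "HOL-Analysis.Determinants" "HOL-Algebra.QuotRing" "HOL-Algebra.Module"
begin

section \<open>Algebras over a field\<close>

text \<open>
  Vector spaces and (associative, unital, not necessarily commutative) algebras over the field
  \<open>'k\<close> are records of type \<open>('k, 'a) module\<close>.  For a plain vector space the fields
  \<open>mult\<close> and \<open>one\<close> are present but carry no meaning.
\<close>

definition scalar_algebra :: "('k::field, 'k) module" where
  "scalar_algebra = \<lparr>carrier = UNIV, mult = (*), one = 1, zero = 0, add = (+), smult = (*)\<rparr>"

locale k_vector_space = Module.module scalar_algebra V
  for V :: "('k::field, 'v, 'x) module_scheme"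

text \<open>The library locale \<open>algebra\<close> is restricted to commutative algebras.\<close>

locale k_algebra = k_vector_space A + A: ring A
  for A :: "('k::field, 'a, 'x) module_scheme" +
  assumes smult_mult_left: "\<lbrakk>x \<in> carrier A; y \<in> carrier A\<rbrakk> \<Longrightarrow>
      (c \<odot>\<^bsub>A\<^esub> x) \<otimes>\<^bsub>A\<^esub> y = c \<odot>\<^bsub>A\<^esub> (x \<otimes>\<^bsub>A\<^esub> y)"
    and smult_mult_right: "\<lbrakk>x \<in> carrier A; y \<in> carrier A\<rbrakk> \<Longrightarrow>
      x \<otimes>\<^bsub>A\<^esub> (c \<odot>\<^bsub>A\<^esub> y) = c \<odot>\<^bsub>A\<^esub> (x \<otimes>\<^bsub>A\<^esub> y)"

definition linear_hom ::
  "('k, 'v, 'x) module_scheme \<Rightarrow> ('k, 'w, 'y) module_scheme \<Rightarrow> ('v \<Rightarrow> 'w) set" where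
  "linear_hom V W = {f \<in> carrier V \<rightarrow> carrier W.
     (\<forall>x\<in>carrier V. \<forall>y\<in>carrier V. f (x \<oplus>\<^bsub>V\<^esub> y) = f x \<oplus>\<^bsub>W\<^esub> f y) \<and>
     (\<forall>c. \<forall>x\<in>carrier V. f (c \<odot>\<^bsub>V\<^esub> x) = c \<odot>\<^bsub>W\<^esub> f x)}"

definition algebra_hom ::
  "('k, 'a, 'x) module_scheme \<Rightarrow> ('k, 'b, 'y) module_scheme \<Rightarrow> ('a \<Rightarrow> 'b) set" where
  "algebra_hom A B = ring_hom A B \<inter> linear_hom A B"

definition quotient_algebra :: "('k, 'a, 'x) module_scheme \<Rightarrow> 'a set \<Rightarrow> ('k, 'a set) module" where
  "quotient_algebra A I =
     ring.extend (A Quot I) (module.fields (\<lambda>c X. \<Union>x\<in>X. I +>\<^bsub>A\<^esub> (c \<odot>\<^bsub>A\<^esub> x)))"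

section \<open>Algebras presented by generators and relations\<close>

text \<open>
  The free monoid, written additively because the convolution product of
  \<^typ>\<open>'w \<Rightarrow>\<^sub>0 'k\<close> is formed with respect to \<open>+\<close> on \<open>'w\<close>.
  Hence \<open>'x free_monoid \<Rightarrow>\<^sub>0 'k\<close> is the free algebra on the set of generators \<open>'x\<close>.
\<close>

datatype 'x free_monoid = Monomial (letters: "'x list")

instantiation free_monoid :: (type) monoid_add
begin

definition zero_free_monoid :: "'x free_monoid" where
  "zero_free_monoid = Monomial []"

definition plus_free_monoid :: "'x free_monoid \<Rightarrow> 'x free_monoid \<Rightarrow> 'x free_monoid" where
  "plus_free_monoid v w = Monomial (letters v @ letters w)"

instance
  by standard (simp_all add: zero_free_monoid_def plus_free_monoid_def)

end

type_synonym ('x, 'k) free_alg = "'x free_monoid \<Rightarrow>\<^sub>0 'k"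

definition free_const :: "'k::field \<Rightarrow> ('x, 'k) free_alg" where
  "free_const c = Poly_Mapping.single 0 c"

definition free_gen :: "'x \<Rightarrow> ('x, 'k::field) free_alg" where
  "free_gen x = Poly_Mapping.single (Monomial [x]) 1"

definition free_algebra :: "('k::field, ('x, 'k) free_alg) module" where
  "free_algebra = \<lparr>carrier = UNIV, mult = (*), one = 1, zero = 0, add = (+),
     smult = (\<lambda>c. Poly_Mapping.map ((*) c))\<rparr>"

definition free_eval ::
  "('k::field, 'a, 'y) module_scheme \<Rightarrow> ('x \<Rightarrow> 'a) \<Rightarrow> ('x, 'k) free_alg \<Rightarrow> 'a" where
  "free_eval A \<phi> p = (\<Oplus>\<^bsub>A\<^esub>w\<in>Poly_Mapping.keys p.
     Poly_Mapping.lookup p w \<odot>\<^bsub>A\<^esub> foldr (\<lambda>x y. \<phi> x \<otimes>\<^bsub>A\<^esub> y) (letters w) \<one>\<^bsub>A\<^esub>)"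

text \<open>The algebra with generators \<open>'x\<close> and relations \<open>r = 0\<close> for \<open>r \<in> Rel\<close>.\<close>

definition presented_algebra ::
  "('x, 'k::field) free_alg set \<Rightarrow> ('k, ('x, 'k) free_alg set) module" where
  "presented_algebra Rel = quotient_algebra free_algebra (Idl\<^bsub>free_algebra\<^esub> Rel)"

definition presented_gen ::
  "('x, 'k::field) free_alg set \<Rightarrow> 'x \<Rightarrow> ('x, 'k) free_alg set" where
  "presented_gen Rel x = Idl\<^bsub>free_algebra\<^esub> Rel +>\<^bsub>free_algebra\<^esub> free_gen x"

text \<open>
  The algebra homomorphism from a presented algebra to \<open>A\<close> with prescribed values \<open>\<phi>\<close> on the
  generators; meaningful if the values satisfy the defining relations.
\<close>

definition presented_lift ::
  "('k::field, 'a, 'y) module_scheme \<Rightarrow> ('x \<Rightarrow> 'a) \<Rightarrow> ('x, 'k) free_alg set \<Rightarrow> 'a" where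
  "presented_lift A \<phi> X = the_elem (free_eval A \<phi> ` X)"

section \<open>Tensor products\<close>

text \<open>
  The free vector space on \<open>carrier V \<times> carrier W\<close>, with the product extending
  \<open>(v, w) (v', w') = (v v', w w')\<close> bilinearly.  The tensor product is its quotient by the bilinearity
  relations.  The product on the tensor product is meaningful if both factors are algebras.
\<close>

type_synonym ('v, 'w, 'k) tensor = "('v \<times> 'w \<Rightarrow>\<^sub>0 'k) set"

definition free_tensor ::
  "('k::field, 'v, 'x) module_scheme \<Rightarrow> ('k, 'w, 'y) module_scheme \<Rightarrow> ('k, 'v \<times> 'w \<Rightarrow>\<^sub>0 'k) module" where
  "free_tensor V W =
     \<lparr>carrier = {u. Poly_Mapping.keys u \<subseteq> carrier V \<times> carrier W},
      mult = (\<lambda>u u'. \<Sum>p\<in>Poly_Mapping.keys u. \<Sum>q\<in>Poly_Mapping.keys u'.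
        Poly_Mapping.single (fst p \<otimes>\<^bsub>V\<^esub> fst q, snd p \<otimes>\<^bsub>W\<^esub> snd q)
          (Poly_Mapping.lookup u p * Poly_Mapping.lookup u' q)),
      one = Poly_Mapping.single (\<one>\<^bsub>V\<^esub>, \<one>\<^bsub>W\<^esub>) 1,
      zero = 0,
      add = (+),
      smult = (\<lambda>c. Poly_Mapping.map ((*) c))\<rparr>"

inductive_set bilinear_relators ::
  "('k::field, 'v, 'x) module_scheme \<Rightarrow> ('k, 'w, 'y) module_scheme \<Rightarrow> ('v \<times> 'w \<Rightarrow>\<^sub>0 'k) set"
  for V :: "('k::field, 'v, 'x) module_scheme" and W :: "('k, 'w, 'y) module_scheme" where
  add_left: "\<lbrakk>v \<in> carrier V; v' \<in> carrier V; w \<in> carrier W\<rbrakk> \<Longrightarrow>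
    Poly_Mapping.single (v \<oplus>\<^bsub>V\<^esub> v', w) 1 - Poly_Mapping.single (v, w) 1 - Poly_Mapping.single (v', w) 1
      \<in> bilinear_relators V W"
| add_right: "\<lbrakk>v \<in> carrier V; w \<in> carrier W; w' \<in> carrier W\<rbrakk> \<Longrightarrow>
    Poly_Mapping.single (v, w \<oplus>\<^bsub>W\<^esub> w') 1 - Poly_Mapping.single (v, w) 1 - Poly_Mapping.single (v, w') 1
      \<in> bilinear_relators V W"
| smult_left: "\<lbrakk>v \<in> carrier V; w \<in> carrier W\<rbrakk> \<Longrightarrow>
    Poly_Mapping.single (c \<odot>\<^bsub>V\<^esub> v, w) 1 - Poly_Mapping.single (v, w) c \<in> bilinear_relators V W"
| smult_right: "\<lbrakk>v \<in> carrier V; w \<in> carrier W\<rbrakk> \<Longrightarrow>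
    Poly_Mapping.single (v, c \<odot>\<^bsub>W\<^esub> w) 1 - Poly_Mapping.single (v, w) c \<in> bilinear_relators V W"

definition bilinear_relations ::
  "('k::field, 'v, 'x) module_scheme \<Rightarrow> ('k, 'w, 'y) module_scheme \<Rightarrow> ('v \<times> 'w \<Rightarrow>\<^sub>0 'k) set" where
  "bilinear_relations V W =
     Modules.module.span (\<lambda>c. Poly_Mapping.map ((*) c)) (bilinear_relators V W)"

definition tensor ::
  "('k::field, 'v, 'x) module_scheme \<Rightarrow> ('k, 'w, 'y) module_scheme \<Rightarrow> ('k, ('v, 'w, 'k) tensor) module" where
  "tensor V W = quotient_algebra (free_tensor V W) (bilinear_relations V W)"

definition pure_tensor ::
  "('k::field, 'v, 'x) module_scheme \<Rightarrow> ('k, 'w, 'y) module_scheme \<Rightarrow> 'v \<Rightarrow> 'w \<Rightarrow> ('v, 'w, 'k) tensor" where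
  "pure_tensor V W v w = bilinear_relations V W +>\<^bsub>free_tensor V W\<^esub> Poly_Mapping.single (v, w) 1"

text \<open>The linear map \<open>v \<otimes> w \<mapsto> f v w\<close> into \<open>U\<close> induced by a bilinear map \<open>f\<close>.\<close>

definition tensor_lift ::
  "('k::field, 'u, 'x) module_scheme \<Rightarrow> ('v \<Rightarrow> 'w \<Rightarrow> 'u) \<Rightarrow> ('v, 'w, 'k) tensor \<Rightarrow> 'u" where
  "tensor_lift U f X = the_elem
     ((\<lambda>u. \<Oplus>\<^bsub>U\<^esub>p\<in>Poly_Mapping.keys u. Poly_Mapping.lookup u p \<odot>\<^bsub>U\<^esub> f (fst p) (snd p)) ` X)"

text \<open>\<open>tensor_map V' W' f g\<close> is \<open>f \<otimes> g : V \<otimes> W \<rightarrow> V' \<otimes> W'\<close>.\<close>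

definition tensor_map ::
  "('k::field, 'v2, 'x) module_scheme \<Rightarrow> ('k, 'w2, 'y) module_scheme \<Rightarrow> ('v \<Rightarrow> 'v2) \<Rightarrow> ('w \<Rightarrow> 'w2)
    \<Rightarrow> ('v, 'w, 'k) tensor \<Rightarrow> ('v2, 'w2, 'k) tensor" where
  "tensor_map V' W' f g = tensor_lift (tensor V' W') (\<lambda>v w. pure_tensor V' W' (f v) (g w))"

text \<open>The canonical isomorphism \<open>(U \<otimes> V) \<otimes> W \<cong> U \<otimes> (V \<otimes> W)\<close>.\<close>

definition tensor_assoc ::
  "('k::field, 'u, 'x) module_scheme \<Rightarrow> ('k, 'v, 'y) module_scheme \<Rightarrow> ('k, 'w, 'z) module_scheme
    \<Rightarrow> (('u, 'v, 'k) tensor, 'w, 'k) tensor \<Rightarrow> ('u, ('v, 'w, 'k) tensor, 'k) tensor" where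
  "tensor_assoc U V W =
     tensor_lift (tensor U (tensor V W)) (\<lambda>X w.
       tensor_lift (tensor U (tensor V W)) (\<lambda>u v.
         pure_tensor U (tensor V W) u (pure_tensor V W v w)) X)"

section \<open>Bialgebras, comodules and comodule algebras\<close>

record (overloaded) ('k::field, 'c) coalgebra = "('k, 'c) module" +
  comult :: "'c \<Rightarrow> ('c, 'c, 'k) tensor"
  counit :: "'c \<Rightarrow> 'k"

locale k_coalgebra = k_vector_space C
  for C :: "('k::field, 'c, 'x) coalgebra_scheme" +
  assumes comult_linear: "comult C \<in> linear_hom C (tensor C C)"
    and counit_linear: "counit C \<in> linear_hom C scalar_algebra"
    and coassoc: "c \<in> carrier C \<Longrightarrow>
      tensor_assoc C C C (tensor_map (tensor C C) C (comult C) id (comult C c))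
        = tensor_map C (tensor C C) id (comult C) (comult C c)"
    and counit_left: "c \<in> carrier C \<Longrightarrow>
      tensor_lift C (\<lambda>a b. counit C a \<odot>\<^bsub>C\<^esub> b) (comult C c) = c"
    and counit_right: "c \<in> carrier C \<Longrightarrow>
      tensor_lift C (\<lambda>a b. counit C b \<odot>\<^bsub>C\<^esub> a) (comult C c) = c"

locale k_bialgebra = k_coalgebra H + k_algebra H
  for H :: "('k::field, 'h, 'x) coalgebra_scheme" +
  assumes comult_hom: "comult H \<in> algebra_hom H (tensor H H)"
    and counit_hom: "counit H \<in> algebra_hom H scalar_algebra"

record (overloaded) ('k::field, 'v, 'c) comodule = "('k, 'v) module" +
  coact :: "'v \<Rightarrow> ('v, 'c, 'k) tensor"

locale right_comodule = C: k_coalgebra C + k_vector_space V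
  for C :: "('k::field, 'c, 'x) coalgebra_scheme" and V :: "('k, 'v, 'c, 'y) comodule_scheme" +
  assumes coact_linear: "coact V \<in> linear_hom V (tensor V C)"
    and coact_coassoc: "v \<in> carrier V \<Longrightarrow>
      tensor_assoc V C C (tensor_map (tensor V C) C (coact V) id (coact V v))
        = tensor_map V (tensor C C) id (comult C) (coact V v)"
    and coact_counit: "v \<in> carrier V \<Longrightarrow>
      tensor_lift V (\<lambda>v c. counit C c \<odot>\<^bsub>V\<^esub> v) (coact V v) = v"

locale right_comodule_algebra = H: k_bialgebra H + right_comodule H A + k_algebra A
  for H :: "('k::field, 'h, 'x) coalgebra_scheme" and A :: "('k, 'a, 'h, 'y) comodule_scheme" +
  assumes coact_hom: "coact A \<in> algebra_hom A (tensor A H)"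

definition comodule_algebra_iso ::
  "('k::field, 'h, 'x) coalgebra_scheme \<Rightarrow> ('k, 'a, 'h, 'y) comodule_scheme
    \<Rightarrow> ('k, 'b, 'h, 'z) comodule_scheme \<Rightarrow> ('a \<Rightarrow> 'b) set" where
  "comodule_algebra_iso H A B =
     {f \<in> algebra_hom A B. bij_betw f (carrier A) (carrier B) \<and>
        (\<forall>x\<in>carrier A. coact B (f x) = tensor_map B H f id (coact A x))}"

definition comodule_algebra_isomorphic ::
  "('k::field, 'h, 'x) coalgebra_scheme \<Rightarrow> ('k, 'a, 'h, 'y) comodule_scheme
    \<Rightarrow> ('k, 'b, 'h, 'z) comodule_scheme \<Rightarrow> bool" where
  "comodule_algebra_isomorphic H A B \<longleftrightarrow>
     right_comodule_algebra H A \<and> right_comodule_algebra H B \<and> comodule_algebra_iso H A B \<noteq> {}"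

section \<open>Cotensor products\<close>

text \<open>A \<open>C\<close>-\<open>D\<close>-bicomodule carries a left \<open>C\<close>-coaction and a right \<open>D\<close>-coaction.\<close>

record (overloaded) ('k::field, 'w, 'c, 'd) bicomodule = "('k, 'w) module" +
  left_coact :: "'w \<Rightarrow> ('c, 'w, 'k) tensor"
  right_coact :: "'w \<Rightarrow> ('w, 'd, 'k) tensor"

text \<open>
  The cotensor product \<open>V \<box>\<^sub>C W\<close>; its product is the one inherited from \<open>V \<otimes> W\<close>, which is
  meaningful if \<open>V\<close> and \<open>W\<close> are comodule algebras.
\<close>

definition cotensor ::
  "('k::field, 'c, 'x) coalgebra_scheme \<Rightarrow> ('k, 'v, 'c, 'y) comodule_scheme
    \<Rightarrow> ('k, 'w, 'c, 'd, 'z) bicomodule_scheme \<Rightarrow> ('k, ('v, 'w, 'k) tensor) module" where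
  "cotensor C V W = (tensor V W)\<lparr>carrier :=
     {u \<in> carrier (tensor V W).
        tensor_assoc V C W (tensor_map (tensor V C) W (coact V) id u)
          = tensor_map V (tensor C W) id (left_coact W) u}\<rparr>"

text \<open>
  The right \<open>D\<close>-coaction on \<open>V \<box>\<^sub>C W\<close> is the corestriction of
  \<open>1 \<otimes> \<rho> : V \<otimes> W \<rightarrow> V \<otimes> (W \<otimes> D) \<cong> (V \<otimes> W) \<otimes> D\<close>, with \<open>\<rho>\<close> the right coaction of \<open>W\<close>, along the
  injection \<open>(V \<box>\<^sub>C W) \<otimes> D \<rightarrow> (V \<otimes> W) \<otimes> D\<close>, which is \<open>tensor_map (tensor V W) D id id\<close>.
\<close>

definition cotensor_comodule ::
  "('k::field, 'c, 'x) coalgebra_scheme \<Rightarrow> ('k, 'd, 'u) coalgebra_scheme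
    \<Rightarrow> ('k, 'v, 'c, 'y) comodule_scheme \<Rightarrow> ('k, 'w, 'c, 'd, 'z) bicomodule_scheme
    \<Rightarrow> ('k, ('v, 'w, 'k) tensor, 'd) comodule" where
  "cotensor_comodule C D V W = module.extend (cotensor C V W) (comodule.fields (\<lambda>u.
     the_inv_into (carrier (tensor (cotensor C V W) D))
       (\<lambda>y. tensor_assoc V W D (tensor_map (tensor V W) D id id y))
       (tensor_map V (tensor W D) id (right_coact W) u)))"

section \<open>The algebras \<open>\<A>\<^bsub>M,t\<^esub>\<close> and \<open>\<B>(E,F)\<close>\<close>

definition quadratic_rels :: "'k::field^'m^'m \<Rightarrow> 'k \<Rightarrow> ('m, 'k) free_alg set" where
  "quadratic_rels M t =
     {(\<Sum>i\<in>UNIV. \<Sum>j\<in>UNIV. free_const (M $ i $ j) * free_gen i * free_gen j) - free_const t}"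

definition quadratic_algebra :: "'k::field^'m^'m \<Rightarrow> 'k \<Rightarrow> ('k, ('m, 'k) free_alg set) module" where
  "quadratic_algebra M t = presented_algebra (quadratic_rels M t)"

definition quadratic_gen :: "'k::field^'m^'m \<Rightarrow> 'k \<Rightarrow> 'm \<Rightarrow> ('m, 'k) free_alg set" where
  "quadratic_gen M t = presented_gen (quadratic_rels M t)"

definition gen_matrix :: "('m \<times> 'n, 'k::field) free_alg^'n^'m" where
  "gen_matrix = (\<chi> i j. free_gen (i, j))"

definition bilin_rels ::
  "'k::field^'m^'m \<Rightarrow> 'k^'n^'n \<Rightarrow> ('m \<times> 'n, 'k) free_alg set" where
  "bilin_rels E F =
     (let a = gen_matrix;
          E' = map_matrix free_const E;
          F' = map_matrix free_const (matrix_inv F);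
          R = F' ** transpose a ** E' ** a - mat 1;
          S = a ** F' ** transpose a ** E' - mat 1
      in {R $ i $ j | i j. True} \<union> {S $ i $ j | i j. True})"

definition bilin_algebra ::
  "'k::field^'m^'m \<Rightarrow> 'k^'n^'n \<Rightarrow> ('k, ('m \<times> 'n, 'k) free_alg set) module" where
  "bilin_algebra E F = presented_algebra (bilin_rels E F)"

definition bilin_gen ::
  "'k::field^'m^'m \<Rightarrow> 'k^'n^'n \<Rightarrow> 'm \<Rightarrow> 'n \<Rightarrow> ('m \<times> 'n, 'k) free_alg set" where
  "bilin_gen E F i j = presented_gen (bilin_rels E F) (i, j)"

text \<open>
  The algebra map \<open>\<B>(E,G) \<rightarrow> \<B>(E,F) \<otimes> \<B>(F,G)\<close> with \<open>a\<^sub>i\<^sub>j \<mapsto> \<Sum>\<^sub>k a\<^sub>i\<^sub>k \<otimes> a\<^sub>k\<^sub>j\<close>.  Its special cases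
  \<open>(E,E,E)\<close>, \<open>(E,E,F)\<close> and \<open>(E,F,F)\<close> are the comultiplication of \<open>\<B>(E)\<close> and the left and right
  coactions on \<open>\<B>(E,F)\<close>.
\<close>

definition bilin_delta ::
  "'k::field^'m^'m \<Rightarrow> 'k^'n^'n \<Rightarrow> 'k^'p^'p \<Rightarrow> ('m \<times> 'p, 'k) free_alg set
    \<Rightarrow> (('m \<times> 'n, 'k) free_alg set, ('n \<times> 'p, 'k) free_alg set, 'k) tensor" where
  "bilin_delta E F G = presented_lift (tensor (bilin_algebra E F) (bilin_algebra F G))
     (\<lambda>(i, j). \<Oplus>\<^bsub>tensor (bilin_algebra E F) (bilin_algebra F G)\<^esub>k\<in>UNIV.
        pure_tensor (bilin_algebra E F) (bilin_algebra F G) (bilin_gen E F i k) (bilin_gen F G k j))"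

definition bilin_bialgebra ::
  "'k::field^'m^'m \<Rightarrow> ('k, ('m \<times> 'm, 'k) free_alg set) coalgebra" where
  "bilin_bialgebra E = module.extend (bilin_algebra E E)
     (coalgebra.fields (bilin_delta E E E)
       (presented_lift scalar_algebra (\<lambda>(i, j). if i = j then 1 else 0)))"

definition bilin_bicomodule ::
  "'k::field^'m^'m \<Rightarrow> 'k^'n^'n
    \<Rightarrow> ('k, ('m \<times> 'n, 'k) free_alg set, ('m \<times> 'm, 'k) free_alg set, ('n \<times> 'n, 'k) free_alg set) bicomodule"
  where
  "bilin_bicomodule E F = module.extend (bilin_algebra E F)
     (bicomodule.fields (bilin_delta E E F) (bilin_delta E F F))"

text \<open>The algebra \<open>\<A>\<^bsub>E\<^sup>-\<^sup>1,t\<^esub>\<close> with the coaction \<open>x\<^sub>i \<mapsto> \<Sum>\<^sub>k x\<^sub>k \<otimes> a\<^sub>k\<^sub>i\<close> of \<open>\<B>(E)\<close>.\<close>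

definition quadratic_comodule ::
  "'k::field^'m^'m \<Rightarrow> 'k \<Rightarrow> ('k, ('m, 'k) free_alg set, ('m \<times> 'm, 'k) free_alg set) comodule" where
  "quadratic_comodule E t =
     (let A = quadratic_algebra (matrix_inv E) t; H = bilin_bialgebra E
      in module.extend A (comodule.fields (presented_lift (tensor A H)
           (\<lambda>i. \<Oplus>\<^bsub>tensor A H\<^esub>k\<in>UNIV.
              pure_tensor A H (quadratic_gen (matrix_inv E) t k) (bilin_gen E E k i)))))"

text \<open>
  \<open>\<Theta>(V) = V \<box>\<^bsub>\<B>(E)\<^esub> \<B>(E,F)\<close> on objects; on a comodule algebra it is the comodule algebra with the
  subalgebra structure.
\<close>

definition Theta ::
  "'k::field^'m^'m \<Rightarrow> 'k^'n^'n \<Rightarrow> ('k, 'v, ('m \<times> 'm, 'k) free_alg set, 'y) comodule_scheme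
    \<Rightarrow> ('k, ('v, ('m \<times> 'n, 'k) free_alg set, 'k) tensor, ('n \<times> 'n, 'k) free_alg set) comodule" where
  "Theta E F V =
     cotensor_comodule (bilin_bialgebra E) (bilin_bialgebra F) V (bilin_bicomodule E F)"

end

theory Submission
  imports Defs "HOL-Computational_Algebra.Polynomial" "HOL-Algebra.Algebraic_Closure_Type"
begin

text \<open>
  The identity \<open>a F\<^sup>-\<^sup>1 a\<^sup>t = E\<^sup>-\<^sup>1\<close> in \<open>\<B>(E,F)\<close> says that the elements \<open>\<Sum>\<^sub>k x\<^sub>k \<otimes> a\<^sub>k\<^sub>i\<close> of
  \<open>\<A>\<^bsub>E\<^sup>-\<^sup>1,t\<^esub> \<otimes> \<B>(E,F)\<close> satisfy the relation of \<open>\<A>\<^bsub>F\<^sup>-\<^sup>1,t\<^esub>\<close>.  Hence there is an algebra map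
  \<open>f : \<A>\<^bsub>F\<^sup>-\<^sup>1,t\<^esub> \<rightarrow> \<A>\<^bsub>E\<^sup>-\<^sup>1,t\<^esub> \<otimes> \<B>(E,F)\<close> with \<open>f x\<^sub>i = \<Sum>\<^sub>k x\<^sub>k \<otimes> a\<^sub>k\<^sub>i\<close> (\<open>quad_delta\<close>).  For \<open>E = F\<close> it is the
  coaction.  The maps \<open>f\<close> and the maps \<open>\<B>(E,G) \<rightarrow> \<B>(E,F) \<otimes> \<B>(F,G)\<close> are jointly coassociative, because
  algebra maps out of a presented algebra are determined by the generators.  This gives the comodule
  algebra structure, and it also shows that \<open>f\<close> takes values in the cotensor product
  \<open>\<Theta>(\<A>\<^bsub>E\<^sup>-\<^sup>1,t\<^esub>)\<close> and is colinear.

  That \<open>f\<close> is bijective onto the cotensor product is seen from an explicit inverse.  Let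
  \<open>S : \<B>(F,E) \<rightarrow> \<B>(E,F)\<^sup>o\<^sup>p\<close> be the antipode \<open>a \<mapsto> F\<^sup>-\<^sup>1 a\<^sup>t E\<close>, and \<open>l\<close> a linear form on \<open>\<B>(E,F)\<close> with
  \<open>l 1 = 1\<close>.  Put \<open>g (x \<otimes> b) = \<Sum> l (S x\<^sub>1 b) x\<^sub>0\<close>, where \<open>\<Sum> x\<^sub>0 \<otimes> x\<^sub>1\<close> is the image of \<open>x\<close> in
  \<open>\<A>\<^bsub>F\<^sup>-\<^sup>1,t\<^esub> \<otimes> \<B>(F,E)\<close>.  From \<open>S(a) a = 1\<close> one gets \<open>g (f x\<^sub>j u) = x\<^sub>j g u\<close> (\<open>pairing_mult\<close>), so
  \<open>g \<circ> f = id\<close> by induction on words.  By coassociativity \<open>f \<circ> g = (id \<otimes> ell) \<circ> (\<rho> \<otimes> id)\<close>, where \<open>\<rho>\<close> is the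
  coaction and \<open>ell : \<B>(E) \<otimes> \<B>(E,F) \<rightarrow> \<B>(E,F)\<close> is made from \<open>S\<close> and \<open>l\<close> in the same way; on the
  cotensor product \<open>\<rho> \<otimes> id\<close> agrees with \<open>id \<otimes> \<Delta>\<close>, and \<open>ell \<circ> \<Delta> = id\<close> by the same induction
  (\<open>f_g_eq\<close>, \<open>f_g\<close>).  The linear retraction \<open>f \<circ> g\<close> onto the cotensor product also survives tensoring with
  \<open>\<B>(F)\<close>, so the coaction of \<open>\<Theta>(\<A>\<^bsub>E\<^sup>-\<^sup>1,t\<^esub>)\<close> is well defined as a corestriction, and the whole structure is
  transported along \<open>f\<close> (\<open>comodule_algebra_transport\<close>).

  A linear form \<open>l\<close> exists as soon as \<open>\<B>(E,F) \<noteq> 0\<close>, and this is where the traces enter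
  (\<open>bilin_nontrivial\<close>).  Nonvanishing is symmetric in \<open>E\<close> and \<open>F\<close> by the antipode, transitive by the
  comultiplication, and may be tested over an extension field.  So it suffices to find, over an
  algebraically closed field, a nonzero representation of \<open>\<B>(E,G)\<close> for the 2 by 2 form
  \<open>G = (0 1; \<beta> 0)\<close>, where \<open>\<beta> + \<beta>\<^sup>-\<^sup>1\<close> is the common trace.  With \<open>u\<close>, \<open>v\<close> the columns of the generic matrix
  and \<open>E(u,v) = \<Sum> E\<^sub>i\<^sub>j u\<^sub>i v\<^sub>j\<close>, the relations are
  \<open>E(u,u) = E(v,v) = 0\<close>, \<open>E(u,v) = 1\<close>, \<open>E(v,u) = \<beta>\<close> and \<open>\<beta>\<^sup>-\<^sup>1 u\<^sub>i v\<^sub>j + v\<^sub>i u\<^sub>j = (E\<^sup>-\<^sup>1)\<^sub>i\<^sub>j\<close>.  On a graded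
  space \<open>\<Oplus>\<^sub>d X\<^sub>d\<close> on which \<open>u\<close> lowers and \<open>v\<close> raises the degree they say that
  \<open>k\<^sup>m \<otimes> X\<^sub>d \<cong> X\<^sub>d\<^sub>+\<^sub>1 \<oplus> X\<^sub>d\<^sub>-\<^sub>1\<close> in a prescribed way.  Thus \<open>X\<^sub>d\<^sub>+\<^sub>1\<close> has to be the kernel of
  \<open>E(u,-) : k\<^sup>m \<otimes> X\<^sub>d \<rightarrow> X\<^sub>d\<^sub>-\<^sub>1\<close>, and two adjacent spaces determine all others, upwards and downwards (locale
  \<open>ladder\<close>).  The two adjacent spaces only have to carry operators with \<open>E(u,v) = 1\<close> and
  \<open>E(v,u) = \<beta>\<close>, and these can be found on the space of polynomials (\<open>starting_operators\<close>).
\<close>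

no_notation Polynomials.var ("X\<index>")
no_notation fps_nth (infixl "$" 75)
hide_const (open) Polynomial.smult

abbreviation "keys \<equiv> Poly_Mapping.keys"
abbreviation "lookup \<equiv> Poly_Mapping.lookup"
abbreviation "single \<equiv> Poly_Mapping.single"
abbreviation "pm_scale (c::'k::field) \<equiv> Poly_Mapping.map ((*) c)"

section \<open>Vector spaces and linear maps on records\<close>

lemma scalar_algebra_simps [simp]:
  "carrier scalar_algebra = UNIV" "x \<otimes>\<^bsub>scalar_algebra\<^esub> y = x * y" "\<one>\<^bsub>scalar_algebra\<^esub> = 1"
  "\<zero>\<^bsub>scalar_algebra\<^esub> = 0" "x \<oplus>\<^bsub>scalar_algebra\<^esub> y = x + y" "c \<odot>\<^bsub>scalar_algebra\<^esub> x = c * x"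
  by (simp_all add: scalar_algebra_def)

lemma cring_scalar_algebra: "cring (scalar_algebra :: ('k::field, 'k) module)"
proof (rule cringI)
  show "abelian_group (scalar_algebra :: ('k, 'k) module)"
    by (rule abelian_groupI) (auto simp: algebra_simps intro: exI[of _ "- _"])
  show "comm_monoid (scalar_algebra :: ('k, 'k) module)"
    by (rule comm_monoidI) (auto simp: algebra_simps)
qed (auto simp: algebra_simps)

text \<open>
  Negatives come for free from \<open>(-1) x\<close>; this is what \<open>0 x = 0\<close> is assumed for.
\<close>

lemma k_vector_spaceI:
  fixes V :: "('k::field, 'v, 'x) module_scheme"
  assumes "\<And>x y. \<lbrakk>x \<in> carrier V; y \<in> carrier V\<rbrakk> \<Longrightarrow> x \<oplus>\<^bsub>V\<^esub> y \<in> carrier V"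
    and "\<zero>\<^bsub>V\<^esub> \<in> carrier V"
    and "\<And>x y z. \<lbrakk>x \<in> carrier V; y \<in> carrier V; z \<in> carrier V\<rbrakk>
      \<Longrightarrow> (x \<oplus>\<^bsub>V\<^esub> y) \<oplus>\<^bsub>V\<^esub> z = x \<oplus>\<^bsub>V\<^esub> (y \<oplus>\<^bsub>V\<^esub> z)"
    and "\<And>x y. \<lbrakk>x \<in> carrier V; y \<in> carrier V\<rbrakk> \<Longrightarrow> x \<oplus>\<^bsub>V\<^esub> y = y \<oplus>\<^bsub>V\<^esub> x"
    and "\<And>x. x \<in> carrier V \<Longrightarrow> \<zero>\<^bsub>V\<^esub> \<oplus>\<^bsub>V\<^esub> x = x"
    and cl: "\<And>c x. x \<in> carrier V \<Longrightarrow> c \<odot>\<^bsub>V\<^esub> x \<in> carrier V"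
    and ld: "\<And>c d x. x \<in> carrier V \<Longrightarrow> (c + d) \<odot>\<^bsub>V\<^esub> x = c \<odot>\<^bsub>V\<^esub> x \<oplus>\<^bsub>V\<^esub> d \<odot>\<^bsub>V\<^esub> x"
    and "\<And>c x y. \<lbrakk>x \<in> carrier V; y \<in> carrier V\<rbrakk>
      \<Longrightarrow> c \<odot>\<^bsub>V\<^esub> (x \<oplus>\<^bsub>V\<^esub> y) = c \<odot>\<^bsub>V\<^esub> x \<oplus>\<^bsub>V\<^esub> c \<odot>\<^bsub>V\<^esub> y"
    and "\<And>c d x. x \<in> carrier V \<Longrightarrow> (c * d) \<odot>\<^bsub>V\<^esub> x = c \<odot>\<^bsub>V\<^esub> (d \<odot>\<^bsub>V\<^esub> x)"
    and one: "\<And>x. x \<in> carrier V \<Longrightarrow> 1 \<odot>\<^bsub>V\<^esub> x = x"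
    and zero: "\<And>x. x \<in> carrier V \<Longrightarrow> 0 \<odot>\<^bsub>V\<^esub> x = \<zero>\<^bsub>V\<^esub>"
  shows "k_vector_space V"
  unfolding k_vector_space_def
proof (rule moduleI)
  show "abelian_group V"
  proof (rule abelian_groupI)
    fix x assume x: "x \<in> carrier V"
    have "(-1) \<odot>\<^bsub>V\<^esub> x \<oplus>\<^bsub>V\<^esub> x = \<zero>\<^bsub>V\<^esub>"
      using ld[OF x, of "-1" 1] one[OF x] zero[OF x] by simp
    then show "\<exists>y\<in>carrier V. y \<oplus>\<^bsub>V\<^esub> x = \<zero>\<^bsub>V\<^esub>" using cl[OF x] by blast
  qed (use assms in auto)
qed (use assms cring_scalar_algebra in auto)

lemma k_algebraI:
  fixes A :: "('k::field, 'v, 'x) module_scheme"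
  assumes "k_vector_space A"
    and "\<And>x y. \<lbrakk>x \<in> carrier A; y \<in> carrier A\<rbrakk> \<Longrightarrow> x \<otimes>\<^bsub>A\<^esub> y \<in> carrier A"
    and "\<one>\<^bsub>A\<^esub> \<in> carrier A"
    and "\<And>x y z. \<lbrakk>x \<in> carrier A; y \<in> carrier A; z \<in> carrier A\<rbrakk>
      \<Longrightarrow> (x \<otimes>\<^bsub>A\<^esub> y) \<otimes>\<^bsub>A\<^esub> z = x \<otimes>\<^bsub>A\<^esub> (y \<otimes>\<^bsub>A\<^esub> z)"
    and "\<And>x. x \<in> carrier A \<Longrightarrow> \<one>\<^bsub>A\<^esub> \<otimes>\<^bsub>A\<^esub> x = x"
    and "\<And>x. x \<in> carrier A \<Longrightarrow> x \<otimes>\<^bsub>A\<^esub> \<one>\<^bsub>A\<^esub> = x"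
    and "\<And>x y z. \<lbrakk>x \<in> carrier A; y \<in> carrier A; z \<in> carrier A\<rbrakk>
      \<Longrightarrow> (x \<oplus>\<^bsub>A\<^esub> y) \<otimes>\<^bsub>A\<^esub> z = x \<otimes>\<^bsub>A\<^esub> z \<oplus>\<^bsub>A\<^esub> y \<otimes>\<^bsub>A\<^esub> z"
    and "\<And>x y z. \<lbrakk>x \<in> carrier A; y \<in> carrier A; z \<in> carrier A\<rbrakk>
      \<Longrightarrow> z \<otimes>\<^bsub>A\<^esub> (x \<oplus>\<^bsub>A\<^esub> y) = z \<otimes>\<^bsub>A\<^esub> x \<oplus>\<^bsub>A\<^esub> z \<otimes>\<^bsub>A\<^esub> y"
    and "\<And>c x y. \<lbrakk>x \<in> carrier A; y \<in> carrier A\<rbrakk>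
      \<Longrightarrow> (c \<odot>\<^bsub>A\<^esub> x) \<otimes>\<^bsub>A\<^esub> y = c \<odot>\<^bsub>A\<^esub> (x \<otimes>\<^bsub>A\<^esub> y)"
    and "\<And>c x y. \<lbrakk>x \<in> carrier A; y \<in> carrier A\<rbrakk>
      \<Longrightarrow> x \<otimes>\<^bsub>A\<^esub> (c \<odot>\<^bsub>A\<^esub> y) = c \<odot>\<^bsub>A\<^esub> (x \<otimes>\<^bsub>A\<^esub> y)"
  shows "k_algebra A"
proof -
  interpret k_vector_space A by fact
  show ?thesis
    by (intro k_algebra.intro k_algebra_axioms.intro ringI monoidI M.abelian_group_axioms assms) auto
qed

context k_vector_space
begin

lemma smult_closed' [simp, intro]: "x \<in> carrier V \<Longrightarrow> c \<odot>\<^bsub>V\<^esub> x \<in> carrier V"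
  using smult_closed[of c x] by simp

lemma smult_add_left: "x \<in> carrier V \<Longrightarrow> (c + d) \<odot>\<^bsub>V\<^esub> x = c \<odot>\<^bsub>V\<^esub> x \<oplus>\<^bsub>V\<^esub> d \<odot>\<^bsub>V\<^esub> x"
  using smult_l_distr[of c d x] by simp

lemma smult_add_right: "\<lbrakk>x \<in> carrier V; y \<in> carrier V\<rbrakk>
    \<Longrightarrow> c \<odot>\<^bsub>V\<^esub> (x \<oplus>\<^bsub>V\<^esub> y) = c \<odot>\<^bsub>V\<^esub> x \<oplus>\<^bsub>V\<^esub> c \<odot>\<^bsub>V\<^esub> y"
  using smult_r_distr[of c x y] by simp

lemma smult_smult: "x \<in> carrier V \<Longrightarrow> c \<odot>\<^bsub>V\<^esub> (d \<odot>\<^bsub>V\<^esub> x) = (c * d) \<odot>\<^bsub>V\<^esub> x"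
  using smult_assoc1[of c d x] by simp

lemma smult_1 [simp]: "x \<in> carrier V \<Longrightarrow> 1 \<odot>\<^bsub>V\<^esub> x = x"
  using smult_one[of x] by simp

lemma smult_0 [simp]: "x \<in> carrier V \<Longrightarrow> 0 \<odot>\<^bsub>V\<^esub> x = \<zero>\<^bsub>V\<^esub>"
  using smult_l_null[of x] by simp

lemma smult_zero [simp]: "c \<odot>\<^bsub>V\<^esub> \<zero>\<^bsub>V\<^esub> = \<zero>\<^bsub>V\<^esub>"
  using smult_r_null[of c] by simp

lemma minus_eq_smult: "x \<in> carrier V \<Longrightarrow> \<ominus>\<^bsub>V\<^esub> x = (-1) \<odot>\<^bsub>V\<^esub> x"
  using smult_add_left[of x "-1" 1] by (intro M.minus_equality) auto

lemma smult_finsum: "\<lbrakk>finite I; f \<in> I \<rightarrow> carrier V\<rbrakk>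
    \<Longrightarrow> c \<odot>\<^bsub>V\<^esub> (\<Oplus>\<^bsub>V\<^esub>i\<in>I. f i) = (\<Oplus>\<^bsub>V\<^esub>i\<in>I. c \<odot>\<^bsub>V\<^esub> f i)"
  using finsum_smult_ldistr[of I c f] by simp

lemma subspaceI:
  assumes "I \<subseteq> carrier V" "\<zero>\<^bsub>V\<^esub> \<in> I" "\<And>x y. \<lbrakk>x \<in> I; y \<in> I\<rbrakk> \<Longrightarrow> x \<oplus>\<^bsub>V\<^esub> y \<in> I"
    and "\<And>c x. x \<in> I \<Longrightarrow> c \<odot>\<^bsub>V\<^esub> x \<in> I"
  shows "submodule I scalar_algebra V"
  using assms by (intro submoduleI) (auto simp: minus_eq_smult subset_iff)

lemma finsum_swap:
  assumes "finite I" "finite J" "\<And>i j. \<lbrakk>i \<in> I; j \<in> J\<rbrakk> \<Longrightarrow> f i j \<in> carrier V"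
  shows "(\<Oplus>\<^bsub>V\<^esub>i\<in>I. \<Oplus>\<^bsub>V\<^esub>j\<in>J. f i j) = (\<Oplus>\<^bsub>V\<^esub>j\<in>J. \<Oplus>\<^bsub>V\<^esub>i\<in>I. f i j)"
  using assms(1,3)
proof (induction I)
  case (insert a F)
  have "(\<Oplus>\<^bsub>V\<^esub>j\<in>J. \<Oplus>\<^bsub>V\<^esub>i\<in>insert a F. f i j)
      = (\<Oplus>\<^bsub>V\<^esub>j\<in>J. f a j \<oplus>\<^bsub>V\<^esub> (\<Oplus>\<^bsub>V\<^esub>i\<in>F. f i j))"
    using insert by (intro M.finsum_cong') (auto simp: Pi_def)
  with insert show ?case using assms(2)
    by (simp add: Pi_def M.finsum_addf M.finsum_closed)
qed (simp add: assms)

end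

lemma k_vector_space_subspace:
  assumes "k_vector_space V" "submodule I scalar_algebra V"
  shows "k_vector_space (V\<lparr>carrier := I\<rparr>)"
  using submodule.submodule_is_module[OF assms(2)] assms(1) by (simp add: k_vector_space_def)

lemma k_vector_space_scalar_algebra: "k_vector_space (scalar_algebra :: ('k::field, 'k) module)"
  by (rule k_vector_spaceI) (auto simp: algebra_simps)

lemma k_algebra_scalar_algebra: "k_algebra (scalar_algebra :: ('k::field, 'k) module)"
  by (rule k_algebraI[OF k_vector_space_scalar_algebra]) (auto simp: algebra_simps)

lemma k_algebra_vs [intro]: "k_algebra A \<Longrightarrow> k_vector_space A"
  by (simp add: k_algebra_def)

lemma k_algebra_ring [intro]: "k_algebra A \<Longrightarrow> ring A"
  by (simp add: k_algebra_def)

lemma linear_homI: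
  assumes "\<And>x. x \<in> carrier V \<Longrightarrow> f x \<in> carrier W"
    and "\<And>x y. \<lbrakk>x \<in> carrier V; y \<in> carrier V\<rbrakk> \<Longrightarrow> f (x \<oplus>\<^bsub>V\<^esub> y) = f x \<oplus>\<^bsub>W\<^esub> f y"
    and "\<And>c x. x \<in> carrier V \<Longrightarrow> f (c \<odot>\<^bsub>V\<^esub> x) = c \<odot>\<^bsub>W\<^esub> f x"
  shows "f \<in> linear_hom V W"
  using assms by (auto simp: linear_hom_def)

lemma linear_hom_closed: "\<lbrakk>f \<in> linear_hom V W; x \<in> carrier V\<rbrakk> \<Longrightarrow> f x \<in> carrier W"
  by (auto simp: linear_hom_def)

lemma linear_hom_add: "\<lbrakk>f \<in> linear_hom V W; x \<in> carrier V; y \<in> carrier V\<rbrakk>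
    \<Longrightarrow> f (x \<oplus>\<^bsub>V\<^esub> y) = f x \<oplus>\<^bsub>W\<^esub> f y"
  by (auto simp: linear_hom_def)

lemma linear_hom_smult: "\<lbrakk>f \<in> linear_hom V W; x \<in> carrier V\<rbrakk> \<Longrightarrow> f (c \<odot>\<^bsub>V\<^esub> x) = c \<odot>\<^bsub>W\<^esub> f x"
  by (auto simp: linear_hom_def)

lemma linear_hom_cong: "\<lbrakk>f \<in> linear_hom V W; \<And>x. x \<in> carrier V \<Longrightarrow> f x = g x; k_vector_space V\<rbrakk>
    \<Longrightarrow> g \<in> linear_hom V W"
  by (rule linear_homI)
    (auto dest: linear_hom_closed linear_hom_add linear_hom_smult
      simp: abelian_monoid.a_closed abelian_group.axioms module.axioms k_vector_space_def
      module.smult_closed dest!: spec)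

lemma linear_hom_zero:
  assumes "f \<in> linear_hom V W" "k_vector_space V" "k_vector_space W"
  shows "f \<zero>\<^bsub>V\<^esub> = \<zero>\<^bsub>W\<^esub>"
proof -
  interpret V: k_vector_space V by fact
  interpret W: k_vector_space W by fact
  have "f (0 \<odot>\<^bsub>V\<^esub> \<zero>\<^bsub>V\<^esub>) = 0 \<odot>\<^bsub>W\<^esub> f \<zero>\<^bsub>V\<^esub>"
    by (rule linear_hom_smult[OF assms(1)]) simp
  then show ?thesis using linear_hom_closed[OF assms(1), of "\<zero>\<^bsub>V\<^esub>"] by simp
qed

lemma linear_hom_diff:
  assumes "f \<in> linear_hom V W" "k_vector_space V" "k_vector_space W" "x \<in> carrier V" "y \<in> carrier V"
  shows "f (x \<ominus>\<^bsub>V\<^esub> y) = f x \<ominus>\<^bsub>W\<^esub> f y"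
proof -
  interpret V: k_vector_space V by fact
  interpret W: k_vector_space W by fact
  show ?thesis using assms
    by (simp add: a_minus_def V.minus_eq_smult W.minus_eq_smult linear_hom_closed linear_hom_add
        linear_hom_smult)
qed

lemma linear_hom_finsum:
  assumes "f \<in> linear_hom V W" "k_vector_space V" "k_vector_space W"
    and "finite I" "\<And>i. i \<in> I \<Longrightarrow> g i \<in> carrier V"
  shows "f (\<Oplus>\<^bsub>V\<^esub>i\<in>I. g i) = (\<Oplus>\<^bsub>W\<^esub>i\<in>I. f (g i))"
  using assms(4,5)
proof (induction I)
  interpret V: k_vector_space V by fact
  interpret W: k_vector_space W by fact
  case empty
  then show ?case using linear_hom_zero[OF assms(1-3)] by simp
next
  interpret V: k_vector_space V by fact
  interpret W: k_vector_space W by fact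
  case (insert i I)
  then show ?case using linear_hom_closed[OF assms(1)] linear_hom_add[OF assms(1)]
    by (simp add: Pi_def V.M.finsum_closed)
qed

lemma linear_hom_compose:
  "\<lbrakk>f \<in> linear_hom U V; g \<in> linear_hom V W\<rbrakk> \<Longrightarrow> (\<lambda>x. g (f x)) \<in> linear_hom U W"
  by (auto simp: linear_hom_def Pi_def)

lemma linear_hom_id: "id \<in> linear_hom V V"
  by (auto simp: linear_hom_def)

lemma linear_hom_const_zero: "k_vector_space W \<Longrightarrow> (\<lambda>_. \<zero>\<^bsub>W\<^esub>) \<in> linear_hom V W"
proof -
  assume "k_vector_space W"
  then interpret W: k_vector_space W .
  show ?thesis by (rule linear_homI) auto
qed

lemma algebra_homD:
  assumes "f \<in> algebra_hom A B"
  shows "f \<in> linear_hom A B" "f \<in> ring_hom A B"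
    "\<And>x. x \<in> carrier A \<Longrightarrow> f x \<in> carrier B"
    "\<And>x y. \<lbrakk>x \<in> carrier A; y \<in> carrier A\<rbrakk> \<Longrightarrow> f (x \<otimes>\<^bsub>A\<^esub> y) = f x \<otimes>\<^bsub>B\<^esub> f y"
    "f \<one>\<^bsub>A\<^esub> = \<one>\<^bsub>B\<^esub>"
  using assms by (auto simp: algebra_hom_def ring_hom_def)

lemma algebra_homI:
  assumes "f \<in> linear_hom A B"
    "\<And>x y. \<lbrakk>x \<in> carrier A; y \<in> carrier A\<rbrakk> \<Longrightarrow> f (x \<otimes>\<^bsub>A\<^esub> y) = f x \<otimes>\<^bsub>B\<^esub> f y"
    "f \<one>\<^bsub>A\<^esub> = \<one>\<^bsub>B\<^esub>"
  shows "f \<in> algebra_hom A B"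
  using assms by (auto simp: algebra_hom_def ring_hom_def linear_hom_def)

lemma algebra_hom_compose:
  "\<lbrakk>f \<in> algebra_hom A B; g \<in> algebra_hom B C\<rbrakk> \<Longrightarrow> (\<lambda>x. g (f x)) \<in> algebra_hom A C"
  by (rule algebra_homI)
    (auto simp: algebra_homD(3-5) intro: linear_hom_compose algebra_homD(1))

lemma algebra_hom_id: "id \<in> algebra_hom A A"
  by (rule algebra_homI) (auto simp: linear_hom_id)

section \<open>Linear extension from a basis\<close>

text \<open>
  Presented algebras and tensor products are both quotients of spaces of finitely supported functions,
  and both \<open>free_eval\<close> and \<open>tensor_lift\<close> are induced by linear extensions of this form.
\<close>

definition lin_ext ::
  "('k::field, 'u, 'x) module_scheme \<Rightarrow> ('s \<Rightarrow> 'u) \<Rightarrow> ('s \<Rightarrow>\<^sub>0 'k) \<Rightarrow> 'u" where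
  "lin_ext U f u = (\<Oplus>\<^bsub>U\<^esub>s\<in>keys u. lookup u s \<odot>\<^bsub>U\<^esub> f s)"

lemma lookup_scale [simp]: "lookup (pm_scale (c::'k::field) u) s = c * lookup u s"
  by (simp add: Poly_Mapping.map.rep_eq when_def)

lemma keys_scale: "keys (pm_scale (c::'k::field) u) \<subseteq> keys u"
  by (auto simp: in_keys_iff)

interpretation pm: vector_space "\<lambda>c::'k::field. pm_scale c :: ('s \<Rightarrow>\<^sub>0 'k) \<Rightarrow> ('s \<Rightarrow>\<^sub>0 'k)"
  by unfold_locales (auto intro!: poly_mapping_eqI simp: lookup_add algebra_simps)

text \<open>
  The restriction on the keys is preserved so that the rule also applies to \<open>free_tensor V W\<close>, whose
  carrier is cut out by it.
\<close>

lemma poly_mapping_restricted_induct [consumes 1, case_names zero single add]: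
  fixes u :: "'s \<Rightarrow>\<^sub>0 'k::field"
  assumes "keys u \<subseteq> S" "P 0"
    and "\<And>s c. s \<in> S \<Longrightarrow> P (single s c)"
    and "\<And>u v. \<lbrakk>keys u \<subseteq> S; keys v \<subseteq> S; P u; P v\<rbrakk> \<Longrightarrow> P (u + v)"
  shows "P u"
  using assms(1)
proof (induction u rule: update_induct)
  case const
  then show ?case by (simp add: assms(2))
next
  case (update f a b)
  have eq: "Poly_Mapping.update a b f = f + single a b"
    using update(1) by (intro poly_mapping_eqI)
      (auto simp: lookup_update lookup_add lookup_single in_keys_iff when_def)
  have k: "keys (Poly_Mapping.update a b f) = insert a (keys f)"
    using update(2) by (auto simp: keys_update)
  show ?case unfolding eq
    using update k by (intro assms(4)) (auto intro: assms(3))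
qed

context k_vector_space
begin

lemma eq_if_diff_zero:
  assumes "x \<in> carrier V" "y \<in> carrier V" "x \<ominus>\<^bsub>V\<^esub> y = \<zero>\<^bsub>V\<^esub>"
  shows "x = y"
proof -
  have "x = (x \<ominus>\<^bsub>V\<^esub> y) \<oplus>\<^bsub>V\<^esub> y" using assms(1,2) by (simp add: a_minus_def M.a_assoc M.l_neg)
  then show ?thesis using assms by simp
qed

lemma lin_ext_superset:
  assumes "finite T" "keys u \<subseteq> T" "\<And>s. s \<in> T \<Longrightarrow> f s \<in> carrier V"
  shows "lin_ext V f u = (\<Oplus>\<^bsub>V\<^esub>s\<in>T. lookup u s \<odot>\<^bsub>V\<^esub> f s)"
  unfolding lin_ext_def
  by (rule M.add.finprod_mono_neutral_cong_left) (use assms in \<open>auto simp: in_keys_iff\<close>)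

lemma lin_ext_closed:
  assumes "keys u \<subseteq> S" "\<And>s. s \<in> S \<Longrightarrow> f s \<in> carrier V"
  shows "lin_ext V f u \<in> carrier V"
  unfolding lin_ext_def using assms by (intro M.finsum_closed) auto

lemma lin_ext_zero [simp]: "lin_ext V f 0 = \<zero>\<^bsub>V\<^esub>"
  by (simp add: lin_ext_def)

lemma lin_ext_add:
  assumes "keys u \<subseteq> S" "keys v \<subseteq> S" "\<And>s. s \<in> S \<Longrightarrow> f s \<in> carrier V"
  shows "lin_ext V f (u + v) = lin_ext V f u \<oplus>\<^bsub>V\<^esub> lin_ext V f v"
proof -
  let ?T = "keys u \<union> keys v"
  have f: "f s \<in> carrier V" if "s \<in> ?T" for s using that assms by auto
  have "lin_ext V f (u + v) = (\<Oplus>\<^bsub>V\<^esub>s\<in>?T. lookup (u + v) s \<odot>\<^bsub>V\<^esub> f s)"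
    using keys_add[of u v] f by (intro lin_ext_superset) auto
  also have "\<dots> = (\<Oplus>\<^bsub>V\<^esub>s\<in>?T. lookup u s \<odot>\<^bsub>V\<^esub> f s \<oplus>\<^bsub>V\<^esub> lookup v s \<odot>\<^bsub>V\<^esub> f s)"
    using f by (intro M.finsum_cong') (auto simp: lookup_add smult_add_left)
  also have "\<dots> = (\<Oplus>\<^bsub>V\<^esub>s\<in>?T. lookup u s \<odot>\<^bsub>V\<^esub> f s) \<oplus>\<^bsub>V\<^esub> (\<Oplus>\<^bsub>V\<^esub>s\<in>?T. lookup v s \<odot>\<^bsub>V\<^esub> f s)"
    using f by (intro M.finsum_addf) auto
  also have "\<dots> = lin_ext V f u \<oplus>\<^bsub>V\<^esub> lin_ext V f v"
    using f lin_ext_superset[of ?T u f] lin_ext_superset[of ?T v f] by simp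
  finally show ?thesis .
qed

lemma lin_ext_scale:
  assumes "keys u \<subseteq> S" "\<And>s. s \<in> S \<Longrightarrow> f s \<in> carrier V"
  shows "lin_ext V f (pm_scale c u) = c \<odot>\<^bsub>V\<^esub> lin_ext V f u"
proof -
  have f: "f s \<in> carrier V" if "s \<in> keys u" for s using that assms by auto
  have "lin_ext V f (pm_scale c u)
      = (\<Oplus>\<^bsub>V\<^esub>s\<in>keys u. (c * lookup u s) \<odot>\<^bsub>V\<^esub> f s)"
    using f keys_scale[of c u] by (simp add: lin_ext_superset[of "keys u"])
  also have "\<dots> = (\<Oplus>\<^bsub>V\<^esub>s\<in>keys u. c \<odot>\<^bsub>V\<^esub> (lookup u s \<odot>\<^bsub>V\<^esub> f s))"
    using f by (intro M.finsum_cong') (auto simp: smult_smult)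
  also have "\<dots> = c \<odot>\<^bsub>V\<^esub> lin_ext V f u"
    unfolding lin_ext_def using f by (intro smult_finsum[symmetric]) auto
  finally show ?thesis .
qed

lemma lin_ext_single:
  assumes "f s \<in> carrier V"
  shows "lin_ext V f (single s c) = c \<odot>\<^bsub>V\<^esub> f s"
  using lin_ext_superset[of "{s}" "single s c" f] assms by simp

end

lemma pm_scale_minus_one: "pm_scale (-1::'k::field) u = - u"
  by (intro poly_mapping_eqI) simp

section \<open>Quotients\<close>

text \<open>
  A quotient vector space.  Multiplication is treated separately below, because the tensor
  product of two vector spaces without products is also needed.
\<close>

locale k_quotient = k_vector_space A for A :: "('k::field, 'a, 'x) module_scheme" +
  fixes I
  assumes sub: "submodule I scalar_algebra A"
begin

abbreviation "cls x \<equiv> I +>\<^bsub>A\<^esub> x"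

sublocale abelian_subgroup I A
  using sub by (intro abelian_subgroupI3 additive_subgroup.intro M.abelian_group_axioms)
    (auto simp: submodule_def)

lemma cls_eq_iff: "\<lbrakk>x \<in> carrier A; y \<in> carrier A\<rbrakk> \<Longrightarrow> cls x = cls y \<longleftrightarrow> x \<ominus>\<^bsub>A\<^esub> y \<in> I"
  using a_rcos_module[of y x] a_repr_independence'[of x y] a_rcos_self[of x]
  by (auto simp: a_minus_def)

lemma mem_cls: "\<lbrakk>y \<in> cls x; x \<in> carrier A\<rbrakk> \<Longrightarrow> y \<in> carrier A \<and> cls y = cls x"
  using a_repr_independence' a_elemrcos_carrier by blast

lemma cls_self: "x \<in> carrier A \<Longrightarrow> x \<in> cls x"
  by (rule a_rcos_self)

lemma quotient_carrier: "carrier (quotient_algebra A I) = cls ` carrier A"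
  by (auto simp: quotient_algebra_def ring.defs FactRing_simps)

lemma quotient_zero: "\<zero>\<^bsub>quotient_algebra A I\<^esub> = cls \<zero>\<^bsub>A\<^esub>"
  by (simp add: quotient_algebra_def ring.defs FactRing_def)
    (metis a_coset_add_zero a_subset)

lemma quotient_one: "\<one>\<^bsub>quotient_algebra A I\<^esub> = cls \<one>\<^bsub>A\<^esub>"
  by (simp add: quotient_algebra_def ring.defs FactRing_def)

lemma quotient_add: "\<lbrakk>x \<in> carrier A; y \<in> carrier A\<rbrakk>
    \<Longrightarrow> cls x \<oplus>\<^bsub>quotient_algebra A I\<^esub> cls y = cls (x \<oplus>\<^bsub>A\<^esub> y)"
  by (simp add: quotient_algebra_def ring.defs FactRing_def a_rcos_sum)

lemma quotient_smult: 
  assumes "x \<in> carrier A"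
  shows "c \<odot>\<^bsub>quotient_algebra A I\<^esub> cls x = cls (c \<odot>\<^bsub>A\<^esub> x)"
proof -
  have "cls (c \<odot>\<^bsub>A\<^esub> y) = cls (c \<odot>\<^bsub>A\<^esub> x)" if "y \<in> cls x" for y
  proof -
    have y: "y \<in> carrier A" "y \<ominus>\<^bsub>A\<^esub> x \<in> I"
      using mem_cls[OF that assms] cls_eq_iff assms by auto
    have "c \<odot>\<^bsub>A\<^esub> y \<ominus>\<^bsub>A\<^esub> c \<odot>\<^bsub>A\<^esub> x = c \<odot>\<^bsub>A\<^esub> (y \<ominus>\<^bsub>A\<^esub> x)"
      using y assms by (simp add: a_minus_def minus_eq_smult smult_add_right smult_smult mult.commute)
    also have "\<dots> \<in> I" using submoduleE(4)[OF sub, of c] y by simp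
    finally show ?thesis using y assms cls_eq_iff by auto
  qed
  then have "(\<Union>y\<in>cls x. cls (c \<odot>\<^bsub>A\<^esub> y)) = cls (c \<odot>\<^bsub>A\<^esub> x)"
    using cls_self[OF assms] by (intro SUP_eq_const) blast+
  then show ?thesis by (simp add: quotient_algebra_def ring.defs module.defs)
qed

lemma quotient_vector_space: "k_vector_space (quotient_algebra A I)"
  by (rule k_vector_spaceI)
    (auto simp: quotient_carrier quotient_add quotient_smult quotient_zero M.a_ac
      smult_add_left smult_add_right smult_smult)

lemma cls_linear: "cls \<in> linear_hom A (quotient_algebra A I)"
  by (rule linear_homI) (auto simp: quotient_carrier quotient_add quotient_smult)

lemma lift_cls:
  assumes "f \<in> linear_hom A U" "k_vector_space U" "\<And>x. x \<in> I \<Longrightarrow> f x = \<zero>\<^bsub>U\<^esub>" "x \<in> carrier A"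
  shows "the_elem (f ` cls x) = f x"
proof -
  interpret U: k_vector_space U by fact
  have "f y = f x" if "y \<in> cls x" for y
  proof -
    have y: "y \<in> carrier A" "y \<ominus>\<^bsub>A\<^esub> x \<in> I"
      using mem_cls[OF that assms(4)] cls_eq_iff assms by auto
    then have "f y \<ominus>\<^bsub>U\<^esub> f x = \<zero>\<^bsub>U\<^esub>"
      using assms linear_hom_diff[OF assms(1) k_vector_space_axioms assms(2), of y x] by simp
    then show ?thesis
      using linear_hom_closed[OF assms(1)] y assms(4) U.eq_if_diff_zero by blast
  qed
  then have "f ` cls x = {f x}" using cls_self[OF assms(4)] by blast
  then show ?thesis by simp
qed

lemma lift_linear:
  assumes "f \<in> linear_hom A U" "k_vector_space U" "\<And>x. x \<in> I \<Longrightarrow> f x = \<zero>\<^bsub>U\<^esub>"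
  shows "(\<lambda>X. the_elem (f ` X)) \<in> linear_hom (quotient_algebra A I) U"
proof -
  interpret U: k_vector_space U by fact
  show ?thesis
    using linear_hom_closed[OF assms(1)]
    by (intro linear_homI) (auto simp: quotient_carrier quotient_add quotient_smult lift_cls[OF assms]
        linear_hom_add[OF assms(1)] linear_hom_smult[OF assms(1)])
qed

end

locale k_quotient_algebra = k_algebra A + ideal I A
  for A :: "('k::field, 'a, 'x) module_scheme" and I
begin

lemma ideal_submodule: "submodule I scalar_algebra A"
proof (rule subspaceI)
  fix c x assume x: "x \<in> I"
  then have "c \<odot>\<^bsub>A\<^esub> x = (c \<odot>\<^bsub>A\<^esub> \<one>\<^bsub>A\<^esub>) \<otimes>\<^bsub>A\<^esub> x"
    by (simp add: smult_mult_left a_Hcarr)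
  also have "\<dots> \<in> I" using x by (simp add: I_l_closed)
  finally show "c \<odot>\<^bsub>A\<^esub> x \<in> I" .
qed (simp_all add: a_subset additive_subgroup.zero_closed[OF additive_subgroup_axioms]
    additive_subgroup.a_closed[OF additive_subgroup_axioms])

sublocale k_quotient A I
  by (intro k_quotient.intro k_vector_space_axioms k_quotient_axioms.intro ideal_submodule)

lemma quotient_mult: "\<lbrakk>x \<in> carrier A; y \<in> carrier A\<rbrakk>
    \<Longrightarrow> cls x \<otimes>\<^bsub>quotient_algebra A I\<^esub> cls y = cls (x \<otimes>\<^bsub>A\<^esub> y)"
  by (simp add: quotient_algebra_def ring.defs FactRing_def rcoset_mult_add)

lemma quotient_k_algebra: "k_algebra (quotient_algebra A I)"
  by (rule k_algebraI)
    (auto simp: quotient_carrier quotient_mult quotient_one quotient_vector_space A.m_assoc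
      quotient_add quotient_smult A.l_distr A.r_distr smult_mult_left smult_mult_right)

lemma cls_algebra_hom: "cls \<in> algebra_hom A (quotient_algebra A I)"
  by (rule algebra_homI) (auto simp: cls_linear quotient_mult quotient_one)

lemma lift_algebra_hom:
  assumes "f \<in> algebra_hom A U" "k_algebra U" "\<And>x. x \<in> I \<Longrightarrow> f x = \<zero>\<^bsub>U\<^esub>"
  shows "(\<lambda>X. the_elem (f ` X)) \<in> algebra_hom (quotient_algebra A I) U"
proof -
  interpret U: k_algebra U by fact
  have l: "f \<in> linear_hom A U" by (rule algebra_homD(1)[OF assms(1)])
  have lc: "the_elem (f ` cls x) = f x" if "x \<in> carrier A" for x
    by (rule lift_cls[OF l U.k_vector_space_axioms]) (use assms(3) that in auto)
  show ?thesis
  proof (rule algebra_homI)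
    show "(\<lambda>X. the_elem (f ` X)) \<in> linear_hom (quotient_algebra A I) U"
      by (rule lift_linear[OF l U.k_vector_space_axioms]) (rule assms(3))
  next
    fix X Y assume "X \<in> carrier (quotient_algebra A I)" "Y \<in> carrier (quotient_algebra A I)"
    then obtain x y where "X = cls x" "Y = cls y" "x \<in> carrier A" "y \<in> carrier A"
      unfolding quotient_carrier by blast
    then show "the_elem (f ` (X \<otimes>\<^bsub>quotient_algebra A I\<^esub> Y)) = the_elem (f ` X) \<otimes>\<^bsub>U\<^esub> the_elem (f ` Y)"
      by (simp add: quotient_mult lc algebra_homD(4)[OF assms(1)])
  next
    show "the_elem (f ` \<one>\<^bsub>quotient_algebra A I\<^esub>) = \<one>\<^bsub>U\<^esub>"
      by (simp add: quotient_one lc algebra_homD(5)[OF assms(1)])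
  qed
qed

end

section \<open>Presented algebras\<close>

lemma free_algebra_simps [simp]:
  "carrier free_algebra = UNIV" "x \<otimes>\<^bsub>free_algebra\<^esub> y = x * y" "\<one>\<^bsub>free_algebra\<^esub> = 1"
  "\<zero>\<^bsub>free_algebra\<^esub> = 0" "x \<oplus>\<^bsub>free_algebra\<^esub> y = x + y"
  "c \<odot>\<^bsub>free_algebra\<^esub> x = pm_scale c x"
  by (simp_all add: free_algebra_def)

lemma free_const_commute: "free_const c * p = p * free_const c"
proof -
  have "keys p \<subseteq> UNIV" by simp
  then show ?thesis
    by (induction p rule: poly_mapping_restricted_induct)
      (auto simp: free_const_def mult_single algebra_simps)
qed

lemma scale_eq_free_const: "pm_scale c p = free_const c * p"
  by (simp add: free_const_def mult_map_scale_conv_mult)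

lemma k_algebra_free_algebra: "k_algebra (free_algebra :: ('k::field, ('x, 'k) free_alg) module)"
proof (rule k_algebraI)
  show "k_vector_space (free_algebra :: ('k, ('x, 'k) free_alg) module)"
    by (rule k_vector_spaceI)
      (auto simp: algebra_simps pm.scale_right_distrib pm.scale_left_distrib)
next
  fix c and x y :: "('x, 'k) free_alg"
  have "x * (free_const c * y) = free_const c * (x * y)"
    by (metis free_const_commute mult.assoc)
  then show "x \<otimes>\<^bsub>free_algebra\<^esub> (c \<odot>\<^bsub>free_algebra\<^esub> y) = c \<odot>\<^bsub>free_algebra\<^esub> (x \<otimes>\<^bsub>free_algebra\<^esub> y)"
    by (simp add: scale_eq_free_const)
qed (auto simp: algebra_simps scale_eq_free_const)

definition word_eval :: "('k::field, 'a, 'y) module_scheme \<Rightarrow> ('x \<Rightarrow> 'a) \<Rightarrow> 'x free_monoid \<Rightarrow> 'a" where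
  "word_eval A \<phi> w = foldr (\<lambda>x y. \<phi> x \<otimes>\<^bsub>A\<^esub> y) (letters w) \<one>\<^bsub>A\<^esub>"

lemma free_eval_lin_ext: "free_eval A \<phi> = lin_ext A (word_eval A \<phi>)"
  by (simp add: fun_eq_iff free_eval_def lin_ext_def word_eval_def)

context k_algebra
begin

lemma word_eval_closed: "(\<And>x. \<phi> x \<in> carrier A) \<Longrightarrow> word_eval A \<phi> w \<in> carrier A"
proof (induction w)
  case (Monomial xs)
  then show ?case by (induction xs) (auto simp: word_eval_def)
qed

lemma word_eval_add: 
  assumes "\<And>x. \<phi> x \<in> carrier A"
  shows "word_eval A \<phi> (v + w) = word_eval A \<phi> v \<otimes>\<^bsub>A\<^esub> word_eval A \<phi> w"
proof (cases v)
  case (Monomial xs)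
  have cl: "word_eval A \<phi> (Monomial ys) \<in> carrier A" for ys
    using word_eval_closed assms by blast
  have "word_eval A \<phi> (Monomial xs + w) = word_eval A \<phi> (Monomial xs) \<otimes>\<^bsub>A\<^esub> word_eval A \<phi> w"
  proof (induction xs)
    case Nil
    then show ?case using word_eval_closed[of \<phi> w] assms
      by (simp add: word_eval_def plus_free_monoid_def)
  next
    case (Cons x xs)
    then show ?case using word_eval_closed[of \<phi> w] assms cl[of xs]
      by (simp add: word_eval_def plus_free_monoid_def A.m_assoc)
  qed
  then show ?thesis using Monomial by simp
qed

lemma free_eval_algebra_hom:
  assumes \<phi>: "\<And>x. \<phi> x \<in> carrier A"
  shows "free_eval A \<phi> \<in> algebra_hom free_algebra A"
proof (rule algebra_homI)
  note we = word_eval_closed[of \<phi>, OF \<phi>]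
  show lin: "free_eval A \<phi> \<in> linear_hom free_algebra A"
    unfolding free_eval_lin_ext
    by (rule linear_homI)
      (auto intro!: lin_ext_closed[where S=UNIV] lin_ext_add[where S=UNIV] lin_ext_scale[where S=UNIV] we)
  have single: "free_eval A \<phi> (single w c) = c \<odot>\<^bsub>A\<^esub> word_eval A \<phi> w" for w c
    unfolding free_eval_lin_ext by (rule lin_ext_single) (rule we)
  have cl: "free_eval A \<phi> p \<in> carrier A" for p
    using linear_hom_closed[OF lin] by simp
  have add: "free_eval A \<phi> (p + q) = free_eval A \<phi> p \<oplus>\<^bsub>A\<^esub> free_eval A \<phi> q" for p q
    using linear_hom_add[OF lin] by simp
  have z: "free_eval A \<phi> 0 = \<zero>\<^bsub>A\<^esub>"
    by (simp add: free_eval_lin_ext)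
  have s: "free_eval A \<phi> (single v c * q)
      = free_eval A \<phi> (single v c) \<otimes>\<^bsub>A\<^esub> free_eval A \<phi> q" for v c q
  proof -
    have "keys q \<subseteq> UNIV" by simp
    then show ?thesis
      by (induction q rule: poly_mapping_restricted_induct)
        (simp_all add: z cl single we word_eval_add \<phi> mult_single distrib_left add A.r_distr
          smult_mult_left smult_mult_right smult_smult mult.commute)
  qed
  have "free_eval A \<phi> (p * q) = free_eval A \<phi> p \<otimes>\<^bsub>A\<^esub> free_eval A \<phi> q" for p q
  proof -
    have "keys p \<subseteq> UNIV" by simp
    then show ?thesis
      by (induction p rule: poly_mapping_restricted_induct)
        (simp_all add: z cl s distrib_right add A.l_distr)
  qed
  then show "free_eval A \<phi> (x \<otimes>\<^bsub>free_algebra\<^esub> y) = free_eval A \<phi> x \<otimes>\<^bsub>A\<^esub> free_eval A \<phi> y" for x y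
    by simp
  show "free_eval A \<phi> \<one>\<^bsub>free_algebra\<^esub> = \<one>\<^bsub>A\<^esub>"
    using single[of 0 1] by (simp add: word_eval_def zero_free_monoid_def[symmetric])
      (simp add: zero_free_monoid_def)
qed

lemma free_eval_simps:
  assumes \<phi>: "\<And>x. \<phi> x \<in> carrier A"
  shows "free_eval A \<phi> p \<in> carrier A"
    "free_eval A \<phi> (p + q) = free_eval A \<phi> p \<oplus>\<^bsub>A\<^esub> free_eval A \<phi> q"
    "free_eval A \<phi> (p - q) = free_eval A \<phi> p \<ominus>\<^bsub>A\<^esub> free_eval A \<phi> q"
    "free_eval A \<phi> (p * q) = free_eval A \<phi> p \<otimes>\<^bsub>A\<^esub> free_eval A \<phi> q"
    "free_eval A \<phi> 0 = \<zero>\<^bsub>A\<^esub>"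
    "free_eval A \<phi> 1 = \<one>\<^bsub>A\<^esub>"
    "free_eval A \<phi> (free_gen x) = \<phi> x"
    "free_eval A \<phi> (free_const c) = c \<odot>\<^bsub>A\<^esub> \<one>\<^bsub>A\<^esub>"
    "finite I \<Longrightarrow> free_eval A \<phi> (\<Sum>i\<in>I. g i) = (\<Oplus>\<^bsub>A\<^esub>i\<in>I. free_eval A \<phi> (g i))"
proof -
  note h = free_eval_algebra_hom[of \<phi>, OF \<phi>] and we = word_eval_closed[of \<phi>, OF \<phi>]
  interpret F: k_algebra "free_algebra :: ('k, ('b, 'k) free_alg) module" by (rule k_algebra_free_algebra)
  note l = algebra_homD(1)[OF h]
  show cl: "free_eval A \<phi> p \<in> carrier A" for p using linear_hom_closed[OF l] by simp
  show add: "free_eval A \<phi> (p + q) = free_eval A \<phi> p \<oplus>\<^bsub>A\<^esub> free_eval A \<phi> q" for p q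
    using linear_hom_add[OF l] by simp
  show "free_eval A \<phi> (p * q) = free_eval A \<phi> p \<otimes>\<^bsub>A\<^esub> free_eval A \<phi> q"
    using algebra_homD(4)[OF h] by simp
  show z: "free_eval A \<phi> 0 = \<zero>\<^bsub>A\<^esub>" by (simp add: free_eval_lin_ext)
  show "free_eval A \<phi> 1 = \<one>\<^bsub>A\<^esub>" using algebra_homD(5)[OF h] by simp
  have "p - q = p + pm_scale (-1) q" by (simp add: pm_scale_minus_one)
  also have "free_eval A \<phi> \<dots> = free_eval A \<phi> p \<oplus>\<^bsub>A\<^esub> (-1) \<odot>\<^bsub>A\<^esub> free_eval A \<phi> q"
    using add linear_hom_smult[OF l, of q "-1"] by (simp del: pm.scale_minus_left)
  finally show "free_eval A \<phi> (p - q) = free_eval A \<phi> p \<ominus>\<^bsub>A\<^esub> free_eval A \<phi> q"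
    by (simp add: a_minus_def minus_eq_smult cl)
  show "free_eval A \<phi> (free_gen x) = \<phi> x"
    unfolding free_gen_def free_eval_lin_ext using \<phi>[of x]
    by (subst lin_ext_single) (auto simp: we, simp add: word_eval_def)
  show "free_eval A \<phi> (free_const c) = c \<odot>\<^bsub>A\<^esub> \<one>\<^bsub>A\<^esub>"
    unfolding free_const_def free_eval_lin_ext
    by (subst lin_ext_single) (auto simp: we, simp add: word_eval_def zero_free_monoid_def)
  show "free_eval A \<phi> (\<Sum>i\<in>I. g i) = (\<Oplus>\<^bsub>A\<^esub>i\<in>I. free_eval A \<phi> (g i))" if "finite I"
    using that by (induction I) (simp_all add: z add cl Pi_def)
qed

text \<open>
  Since the kernel of an evaluation is an ideal, it contains the ideal generated by all relations that
  the values satisfy.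
\<close>

lemma eval_kernel_ideal:
  assumes \<phi>: "\<And>x. \<phi> x \<in> carrier A"
  shows "ideal {p. free_eval A \<phi> p = \<zero>\<^bsub>A\<^esub>} free_algebra"
proof -
  interpret F: k_algebra "free_algebra :: ('k, ('b, 'k) free_alg) module" by (rule k_algebra_free_algebra)
  note s = free_eval_simps[of \<phi>, OF \<phi>]
  show ?thesis
  proof (rule idealI)
    have "free_eval A \<phi> (- p) = \<ominus>\<^bsub>A\<^esub> free_eval A \<phi> p" for p
      using s(3)[of 0 p] s(1)[of p] by (simp add: s(5) a_minus_def)
    moreover have "\<ominus>\<^bsub>free_algebra\<^esub> p = - p" for p :: "('b, 'k) free_alg"
      by (simp add: F.minus_eq_smult pm_scale_minus_one)
    ultimately have "submodule {p. free_eval A \<phi> p = \<zero>\<^bsub>A\<^esub>} scalar_algebra free_algebra"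
      using linear_hom_smult[OF algebra_homD(1)[OF free_eval_algebra_hom[of \<phi>, OF \<phi>]]]
      by (intro F.subspaceI) (auto simp: s)
    then show "subgroup {p. free_eval A \<phi> p = \<zero>\<^bsub>A\<^esub>} (add_monoid free_algebra)"
      by (simp add: submodule_def)
  qed (use k_algebra_ring[OF k_algebra_free_algebra] in \<open>auto simp: s\<close>)
qed

end

lemma presented_quotient: "k_quotient_algebra free_algebra (Idl\<^bsub>free_algebra\<^esub> Rel)"
proof -
  show ?thesis
    by (intro k_quotient_algebra.intro k_algebra_free_algebra ring.genideal_ideal
        k_algebra_ring[OF k_algebra_free_algebra]) simp
qed

lemma k_algebra_presented: "k_algebra (presented_algebra Rel)"
  unfolding presented_algebra_def by (rule k_quotient_algebra.quotient_k_algebra[OF presented_quotient])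

lemma presented_gen_closed: "presented_gen Rel x \<in> carrier (presented_algebra Rel)"
proof -
  interpret k_quotient_algebra free_algebra "Idl\<^bsub>free_algebra\<^esub> Rel" by (rule presented_quotient)
  show ?thesis by (auto simp: presented_algebra_def presented_gen_def quotient_carrier)
qed

lemma presented_lift_props:
  assumes A: "k_algebra A" and \<phi>: "\<And>x. \<phi> x \<in> carrier A"
    and rel: "\<And>r. r \<in> Rel \<Longrightarrow> free_eval A \<phi> r = \<zero>\<^bsub>A\<^esub>"
  shows presented_lift_algebra_hom: "presented_lift A \<phi> \<in> algebra_hom (presented_algebra Rel) A"
    and presented_lift_gen: "presented_lift A \<phi> (presented_gen Rel x) = \<phi> x"
proof -
  interpret A: k_algebra A by fact
  interpret k_quotient_algebra free_algebra "Idl\<^bsub>free_algebra\<^esub> Rel" by (rule presented_quotient)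
  have "Idl\<^bsub>free_algebra\<^esub> Rel \<subseteq> {p. free_eval A \<phi> p = \<zero>\<^bsub>A\<^esub>}"
    using rel by (intro ring.genideal_minimal k_algebra_ring[OF k_algebra_free_algebra] A.eval_kernel_ideal[of \<phi>] \<phi>) auto
  then have I: "free_eval A \<phi> p = \<zero>\<^bsub>A\<^esub>" if "p \<in> Idl\<^bsub>free_algebra\<^esub> Rel" for p
    using that by auto
  have h: "free_eval A \<phi> \<in> algebra_hom free_algebra A" by (rule A.free_eval_algebra_hom[of \<phi>, OF \<phi>])
  show "presented_lift A \<phi> \<in> algebra_hom (presented_algebra Rel) A"
    using lift_algebra_hom[OF h assms(1)] I
    by (simp add: presented_lift_def[abs_def] presented_algebra_def)
  have "presented_lift A \<phi> (presented_gen Rel x) = free_eval A \<phi> (free_gen x)"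
    unfolding presented_lift_def presented_gen_def
    by (rule lift_cls[OF algebra_homD(1)[OF h]]) (auto simp: I A.k_vector_space_axioms)
  then show "presented_lift A \<phi> (presented_gen Rel x) = \<phi> x"
    by (simp add: A.free_eval_simps[of \<phi>, OF \<phi>])
qed

text \<open>
  Words span, and every word arises from 1 by left multiplication with generators.
\<close>

lemma presented_induct [consumes 1, case_names one gen add smult]:
  fixes Rel :: "('x, 'k::field) free_alg set"
  assumes X: "X \<in> carrier (presented_algebra Rel)"
    and one: "P \<one>\<^bsub>presented_algebra Rel\<^esub>"
    and gen: "\<And>x Y. \<lbrakk>Y \<in> carrier (presented_algebra Rel); P Y\<rbrakk>
      \<Longrightarrow> P (presented_gen Rel x \<otimes>\<^bsub>presented_algebra Rel\<^esub> Y)"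
    and add: "\<And>Y Z. \<lbrakk>Y \<in> carrier (presented_algebra Rel); Z \<in> carrier (presented_algebra Rel); P Y; P Z\<rbrakk>
      \<Longrightarrow> P (Y \<oplus>\<^bsub>presented_algebra Rel\<^esub> Z)"
    and smult: "\<And>c Y. \<lbrakk>Y \<in> carrier (presented_algebra Rel); P Y\<rbrakk> \<Longrightarrow> P (c \<odot>\<^bsub>presented_algebra Rel\<^esub> Y)"
  shows "P X"
proof -
  interpret k_quotient_algebra free_algebra "Idl\<^bsub>free_algebra\<^esub> Rel" by (rule presented_quotient)
  interpret Q: k_algebra "presented_algebra Rel" by (rule k_algebra_presented)
  have cl: "cls p \<in> carrier (presented_algebra Rel)" for p
    by (simp add: presented_algebra_def quotient_carrier)
  have word: "P (cls (single (Monomial xs) 1))" for xs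
  proof (induction xs)
    case Nil
    have "single (Monomial []) 1 = (1 :: ('x, 'k) free_alg)"
      by (metis single_one zero_free_monoid_def)
    then show ?case using one by (simp add: presented_algebra_def quotient_one)
  next
    case (Cons x xs)
    have "single (Monomial (x # xs)) 1
        = free_gen x * (single (Monomial xs) 1 :: ('x, 'k) free_alg)"
      by (simp add: free_gen_def mult_single plus_free_monoid_def)
    then have "cls (single (Monomial (x # xs)) 1)
        = presented_gen Rel x \<otimes>\<^bsub>presented_algebra Rel\<^esub> cls (single (Monomial xs) 1)"
      by (simp add: presented_gen_def presented_algebra_def quotient_mult)
    then show ?case using gen[OF cl Cons] by simp
  qed
  have single: "P (cls (single w c))" for w c
  proof -
    obtain xs where w: "w = Monomial xs" by (cases w)
    have "cls (single w c) = c \<odot>\<^bsub>presented_algebra Rel\<^esub> cls (single w 1)"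
      by (simp add: presented_algebra_def quotient_smult)
    then show ?thesis using smult[OF cl word] w by simp
  qed
  obtain p where p: "X = cls p" using X by (auto simp: presented_algebra_def quotient_carrier)
  have "keys p \<subseteq> UNIV" by simp
  then have "P (cls p)"
  proof (induction p rule: poly_mapping_restricted_induct)
    case zero
    then show ?case using single[of 0 0] by simp
  next
    case (add u v)
    then show ?case using assms(4)[OF cl[of u] cl[of v]]
      by (simp add: presented_algebra_def quotient_add)
  qed (rule single)
  then show ?thesis using p by simp
qed

lemma algebra_hom_eqI:
  assumes f: "f \<in> algebra_hom (presented_algebra Rel) B" and g: "g \<in> algebra_hom (presented_algebra Rel) B"
    and gen: "\<And>x. f (presented_gen Rel x) = g (presented_gen Rel x)"
    and X: "X \<in> carrier (presented_algebra Rel)"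
  shows "f X = g X"
  using X
  by (induction X rule: presented_induct)
    (simp_all add: algebra_homD(4,5)[OF f] algebra_homD(4,5)[OF g] gen presented_gen_closed
      linear_hom_add[OF algebra_homD(1)[OF f]] linear_hom_add[OF algebra_homD(1)[OF g]]
      linear_hom_smult[OF algebra_homD(1)[OF f]] linear_hom_smult[OF algebra_homD(1)[OF g]])

section \<open>Tensor products of vector spaces\<close>

definition bilinear_hom where
  "bilinear_hom V W U = {f. (\<forall>v\<in>carrier V. f v \<in> linear_hom W U) \<and>
     (\<forall>w\<in>carrier W. (\<lambda>v. f v w) \<in> linear_hom V U)}"

lemma bilinear_homI:
  assumes "\<And>v. v \<in> carrier V \<Longrightarrow> f v \<in> linear_hom W U"
    and "\<And>w. w \<in> carrier W \<Longrightarrow> (\<lambda>v. f v w) \<in> linear_hom V U"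
  shows "f \<in> bilinear_hom V W U"
  using assms by (simp add: bilinear_hom_def)

lemma bilinear_homD:
  assumes "f \<in> bilinear_hom V W U"
  shows "v \<in> carrier V \<Longrightarrow> f v \<in> linear_hom W U"
    and "w \<in> carrier W \<Longrightarrow> (\<lambda>v. f v w) \<in> linear_hom V U"
    and "\<lbrakk>v \<in> carrier V; w \<in> carrier W\<rbrakk> \<Longrightarrow> f v w \<in> carrier U"
  using assms linear_hom_closed[of "f v" W U w] by (simp_all add: bilinear_hom_def)

lemma free_tensor_simps [simp]:
  "carrier (free_tensor V W) = {u. keys u \<subseteq> carrier V \<times> carrier W}"
  "\<zero>\<^bsub>free_tensor V W\<^esub> = 0" "x \<oplus>\<^bsub>free_tensor V W\<^esub> y = x + y"
  "c \<odot>\<^bsub>free_tensor V W\<^esub> x = pm_scale c x"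
  "\<one>\<^bsub>free_tensor V W\<^esub> = single (\<one>\<^bsub>V\<^esub>, \<one>\<^bsub>W\<^esub>) 1"
  by (simp_all add: free_tensor_def)

lemma k_vector_space_free_tensor: "k_vector_space (free_tensor V W)"
proof (rule k_vector_spaceI)
  fix c x y assume "x \<in> carrier (free_tensor V W)" 
  then show "c \<odot>\<^bsub>free_tensor V W\<^esub> x \<in> carrier (free_tensor V W)"
    using keys_scale[of c x] by auto
next
  fix x y assume "x \<in> carrier (free_tensor V W)" "y \<in> carrier (free_tensor V W)"
  then show "x \<oplus>\<^bsub>free_tensor V W\<^esub> y \<in> carrier (free_tensor V W)"
    using keys_add[of x y] by auto
qed (auto simp: algebra_simps pm.scale_right_distrib pm.scale_left_distrib)

locale k_tensor = V: k_vector_space V + W: k_vector_space W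
  for V :: "('k::field, 'v, 'x) module_scheme" and W :: "('k, 'w, 'y) module_scheme"
begin

lemma relators_carrier: "bilinear_relators V W \<subseteq> carrier (free_tensor V W)"
proof
  interpret F: k_vector_space "free_tensor V W" by (rule k_vector_space_free_tensor)
  have m: "x - y \<in> carrier (free_tensor V W)"
    if "x \<in> carrier (free_tensor V W)" "y \<in> carrier (free_tensor V W)" for x y
    using F.M.minus_closed[OF that] that F.minus_eq_smult[of y]
    by (simp add: a_minus_def pm_scale_minus_one)
  have s: "single (v, w) c \<in> carrier (free_tensor V W)"
    if "v \<in> carrier V" "w \<in> carrier W" for v w c
    using that by auto
  fix u assume "u \<in> bilinear_relators V W"
  then show "u \<in> carrier (free_tensor V W)"
    by induction (intro m s; simp)+
qed

lemma relations_sub: "submodule (bilinear_relations V W) scalar_algebra (free_tensor V W)"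
proof -
  interpret F: k_vector_space "free_tensor V W" by (rule k_vector_space_free_tensor)
  have "pm.subspace (carrier (free_tensor V W))"
    using F.M.a_closed F.smult_closed' by (auto simp: pm.subspace_def)
  then have "pm.span (bilinear_relators V W) \<subseteq> carrier (free_tensor V W)"
    by (intro pm.span_minimal relators_carrier)
  then show ?thesis
    unfolding bilinear_relations_def
    by (intro F.subspaceI) (simp_all add: pm.span_zero pm.span_add pm.span_scale del: free_tensor_simps(1))
qed

sublocale Q: k_quotient "free_tensor V W" "bilinear_relations V W"
  by (intro k_quotient.intro k_vector_space_free_tensor k_quotient_axioms.intro relations_sub)

abbreviation ten (infixr "\<otimes>\<^sub>t" 70) where "v \<otimes>\<^sub>t w \<equiv> pure_tensor V W v w"

lemma k_vector_space_tensor: "k_vector_space (tensor V W)"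
  unfolding tensor_def by (rule Q.quotient_vector_space)

lemma pure_closed [simp, intro]: "\<lbrakk>v \<in> carrier V; w \<in> carrier W\<rbrakk> \<Longrightarrow> v \<otimes>\<^sub>t w \<in> carrier (tensor V W)"
  by (auto simp: tensor_def pure_tensor_def Q.quotient_carrier)

lemma lin_ext_linear:
  assumes "k_vector_space U" "f \<in> bilinear_hom V W U"
  shows "lin_ext U (\<lambda>p. f (fst p) (snd p)) \<in> linear_hom (free_tensor V W) U"
proof -
  interpret U: k_vector_space U by fact
  have cl: "f (fst p) (snd p) \<in> carrier U" if "p \<in> carrier V \<times> carrier W" for p
    using that bilinear_homD(3)[OF assms(2)] by auto
  show ?thesis
    by (rule linear_homI)
      (auto intro!: U.lin_ext_closed[where S="carrier V \<times> carrier W"]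
        U.lin_ext_add[where S="carrier V \<times> carrier W"]
        U.lin_ext_scale[where S="carrier V \<times> carrier W"] cl)
qed

text \<open>
  Each bilinearity relator is mapped to zero, and the kernel is a subspace.
\<close>

lemma lin_ext_relations:
  assumes "k_vector_space U" "f \<in> bilinear_hom V W U" "u \<in> bilinear_relations V W"
  shows "lin_ext U (\<lambda>p. f (fst p) (snd p)) u = \<zero>\<^bsub>U\<^esub>"
proof -
  interpret U: k_vector_space U by fact
  let ?L = "lin_ext U (\<lambda>p. f (fst p) (snd p))"
  note l = lin_ext_linear[OF assms(1,2)]
  note f = bilinear_homD[OF assms(2)]
  have s: "?L (single (v, w) c) = c \<odot>\<^bsub>U\<^esub> f v w" if "v \<in> carrier V" "w \<in> carrier W" for v w c
    using f that by (subst U.lin_ext_single) auto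
  have c: "single (v, w) c \<in> carrier (free_tensor V W)"
    if "v \<in> carrier V" "w \<in> carrier W" for v w c
    using that by auto
  have m: "x - y \<in> carrier (free_tensor V W) \<and> ?L (x - y) = ?L x \<ominus>\<^bsub>U\<^esub> ?L y"
    if "x \<in> carrier (free_tensor V W)" "y \<in> carrier (free_tensor V W)" for x y
  proof -
    have "x \<ominus>\<^bsub>free_tensor V W\<^esub> y = x - y"
      using Q.minus_eq_smult[of y] that by (simp add: a_minus_def pm_scale_minus_one)
    then show ?thesis
      using linear_hom_diff[OF l k_vector_space_free_tensor assms(1) that] Q.M.minus_closed[OF that] by simp
  qed
  have "u \<in> carrier (free_tensor V W) \<and> ?L u = \<zero>\<^bsub>U\<^esub>" if "u \<in> bilinear_relators V W" for u
    using that
  proof induction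
    case (add_left v v' w)
    then show ?case
      using linear_hom_add[OF f(2)[of w], of v v'] f(3)[of v w] f(3)[of v' w]
      by (simp add: m s c U.M.minus_eq U.M.minus_add U.M.r_neg U.M.a_ac del: free_tensor_simps(1))
  next
    case (add_right v w w')
    then show ?case
      using linear_hom_add[OF f(1)[of v], of w w'] f(3)[of v w] f(3)[of v w']
      by (simp add: m s c U.M.minus_eq U.M.minus_add U.M.r_neg U.M.a_ac del: free_tensor_simps(1))
  next
    case (smult_left v w c')
    then show ?case
      using linear_hom_smult[OF f(2)[of w], of v c'] f(3)[of v w]
      by (simp add: m s c U.M.minus_eq U.M.r_neg del: free_tensor_simps(1))
  next
    case (smult_right v w c')
    then show ?case
      using linear_hom_smult[OF f(1)[of v], of w c'] f(3)[of v w]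
      by (simp add: m s c U.M.minus_eq U.M.r_neg del: free_tensor_simps(1))
  qed
  then have R: "bilinear_relators V W \<subseteq> {u \<in> carrier (free_tensor V W). ?L u = \<zero>\<^bsub>U\<^esub>}" by auto
  have "pm.subspace {u \<in> carrier (free_tensor V W). ?L u = \<zero>\<^bsub>U\<^esub>}"
    unfolding pm.subspace_def
    using Q.M.a_closed Q.smult_closed' linear_hom_add[OF l] linear_hom_smult[OF l]
    by (auto simp del: free_tensor_simps(1)) (simp_all)
  then have "bilinear_relations V W \<subseteq> {u \<in> carrier (free_tensor V W). ?L u = \<zero>\<^bsub>U\<^esub>}"
    unfolding bilinear_relations_def using R by (intro pm.span_minimal) auto
  then show ?thesis using assms(3) by auto
qed

lemma tensor_lift_linear:
  assumes "k_vector_space U" "f \<in> bilinear_hom V W U"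
  shows "tensor_lift U f \<in> linear_hom (tensor V W) U"
proof -
  have "tensor_lift U f = (\<lambda>X. the_elem (lin_ext U (\<lambda>p. f (fst p) (snd p)) ` X))"
    by (simp add: tensor_lift_def lin_ext_def fun_eq_iff)
  then show ?thesis
    unfolding tensor_def
    using Q.lift_linear[OF lin_ext_linear[OF assms] assms(1) lin_ext_relations[OF assms]] by simp
qed

lemma tensor_lift_pure:
  assumes "k_vector_space U" "f \<in> bilinear_hom V W U" "v \<in> carrier V" "w \<in> carrier W"
  shows "tensor_lift U f (v \<otimes>\<^sub>t w) = f v w"
proof -
  interpret U: k_vector_space U by fact
  have cl: "f v w \<in> carrier U" using bilinear_homD(3)[OF assms(2)] assms by auto
  have "tensor_lift U f (v \<otimes>\<^sub>t w) = the_elem (lin_ext U (\<lambda>p. f (fst p) (snd p)) ` (v \<otimes>\<^sub>t w))"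
    by (simp add: tensor_lift_def lin_ext_def fun_eq_iff)
  also have "\<dots> = lin_ext U (\<lambda>p. f (fst p) (snd p)) (single (v, w) 1)"
    unfolding pure_tensor_def
    by (rule Q.lift_cls[OF lin_ext_linear[OF assms(1,2)] assms(1) lin_ext_relations[OF assms(1,2)]])
      (use assms in auto)
  also have "\<dots> = f v w" using cl by (subst U.lin_ext_single) auto
  finally show ?thesis .
qed

lemma pure_bilinear: "pure_tensor V W \<in> bilinear_hom V W (tensor V W)"
proof -
  have rel: "u \<in> bilinear_relations V W" if "u \<in> bilinear_relators V W" for u
    using that by (simp add: bilinear_relations_def pm.span_base)
  have c: "single (v, w) c \<in> carrier (free_tensor V W)"
    if "v \<in> carrier V" "w \<in> carrier W" for v w c
    using that by auto
  have eq: "Q.cls x = Q.cls y" if "x \<in> carrier (free_tensor V W)" "y \<in> carrier (free_tensor V W)"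
    "x - y \<in> bilinear_relators V W" for x y
  proof -
    have "x \<ominus>\<^bsub>free_tensor V W\<^esub> y = x - y"
      using Q.minus_eq_smult[of y] that by (simp add: a_minus_def pm_scale_minus_one)
    then show ?thesis using rel[OF that(3)] Q.cls_eq_iff[OF that(1,2)] by simp
  qed
  have add: "Q.cls (single p 1) \<oplus>\<^bsub>tensor V W\<^esub> Q.cls (single q 1)
      = Q.cls (single p 1 + single q 1)"
    if "p \<in> carrier V \<times> carrier W" "q \<in> carrier V \<times> carrier W" for p q
    using Q.quotient_add[of "single p 1" "single q 1"] that
    by (auto simp: tensor_def)
  have sm: "c \<odot>\<^bsub>tensor V W\<^esub> Q.cls (single p 1) = Q.cls (single p c)"
    if "p \<in> carrier V \<times> carrier W" for p c
    using Q.quotient_smult[of "single p 1" c] that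
    by (auto simp: tensor_def)
  have pl: "single p 1 + single q 1 \<in> carrier (free_tensor V W)"
    if "p \<in> carrier V \<times> carrier W" "q \<in> carrier V \<times> carrier W" for p q
    using Q.M.a_closed[of "single p 1" "single q 1"] that by auto
  show ?thesis
  proof (rule bilinear_homI)
    fix v assume v: "v \<in> carrier V"
    show "pure_tensor V W v \<in> linear_hom W (tensor V W)"
    proof (rule linear_homI)
      fix w w' assume w: "w \<in> carrier W" "w' \<in> carrier W"
      show "v \<otimes>\<^sub>t (w \<oplus>\<^bsub>W\<^esub> w') = (v \<otimes>\<^sub>t w) \<oplus>\<^bsub>tensor V W\<^esub> (v \<otimes>\<^sub>t w')"
        using v w bilinear_relators.add_right[OF v w] unfolding pure_tensor_def
        by (subst add) ((intro eq c pl)?; simp add: diff_diff_eq del: free_tensor_simps(1))+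
    next
      fix w a assume w: "w \<in> carrier W"
      show "v \<otimes>\<^sub>t (a \<odot>\<^bsub>W\<^esub> w) = a \<odot>\<^bsub>tensor V W\<^esub> (v \<otimes>\<^sub>t w)"
        using v w bilinear_relators.smult_right[OF v w, of a] unfolding pure_tensor_def
        by (subst sm) ((intro eq c)?; simp del: free_tensor_simps(1))+
    qed (use v in auto)
  next
    fix w assume w: "w \<in> carrier W"
    show "(\<lambda>v. v \<otimes>\<^sub>t w) \<in> linear_hom V (tensor V W)"
    proof (rule linear_homI)
      fix v v' assume v: "v \<in> carrier V" "v' \<in> carrier V"
      show "(v \<oplus>\<^bsub>V\<^esub> v') \<otimes>\<^sub>t w = (v \<otimes>\<^sub>t w) \<oplus>\<^bsub>tensor V W\<^esub> (v' \<otimes>\<^sub>t w)"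
        using v w bilinear_relators.add_left[OF v w] unfolding pure_tensor_def
        by (subst add) ((intro eq c pl)?; simp add: diff_diff_eq del: free_tensor_simps(1))+
    next
      fix v a assume v: "v \<in> carrier V"
      show "(a \<odot>\<^bsub>V\<^esub> v) \<otimes>\<^sub>t w = a \<odot>\<^bsub>tensor V W\<^esub> (v \<otimes>\<^sub>t w)"
        using v w bilinear_relators.smult_left[OF v w, of a] unfolding pure_tensor_def
        by (subst sm) ((intro eq c)?; simp del: free_tensor_simps(1))+
    qed (use w in auto)
  qed
qed

text \<open>
  Scalar multiples are covered, since \<open>c (v \<otimes> w) = (c v) \<otimes> w\<close> is again pure.
\<close>

lemma tensor_induct [consumes 1, case_names pure add]:
  assumes X: "X \<in> carrier (tensor V W)"
    and pure: "\<And>v w. \<lbrakk>v \<in> carrier V; w \<in> carrier W\<rbrakk> \<Longrightarrow> P (v \<otimes>\<^sub>t w)"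
    and add: "\<And>X Y. \<lbrakk>X \<in> carrier (tensor V W); Y \<in> carrier (tensor V W); P X; P Y\<rbrakk>
      \<Longrightarrow> P (X \<oplus>\<^bsub>tensor V W\<^esub> Y)"
  shows "P X"
proof -
  interpret T: k_vector_space "tensor V W" by (rule k_vector_space_tensor)
  have cl: "Q.cls u \<in> carrier (tensor V W)" if "u \<in> carrier (free_tensor V W)" for u
    using that by (auto simp: tensor_def Q.quotient_carrier)
  have single: "P (Q.cls (single p c))" if "p \<in> carrier V \<times> carrier W" for p c
  proof -
    have "Q.cls (single p c) = c \<odot>\<^bsub>tensor V W\<^esub> (fst p \<otimes>\<^sub>t snd p)"
      using that Q.quotient_smult[of "single p 1" c]
      by (auto simp: tensor_def pure_tensor_def)
    also have "\<dots> = (c \<odot>\<^bsub>V\<^esub> fst p) \<otimes>\<^sub>t snd p"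
      using that linear_hom_smult[OF bilinear_homD(2)[OF pure_bilinear]] by auto
    finally show ?thesis using pure[of "c \<odot>\<^bsub>V\<^esub> fst p" "snd p"] that by auto
  qed
  obtain u where u: "X = Q.cls u" "keys u \<subseteq> carrier V \<times> carrier W"
    using X by (auto simp: tensor_def Q.quotient_carrier)
  from u(2) have "P (Q.cls u)"
  proof (induction u rule: poly_mapping_restricted_induct)
    case zero
    then show ?case using single[of "(\<zero>\<^bsub>V\<^esub>, \<zero>\<^bsub>W\<^esub>)" 0] by simp
  next
    case (add u v)
    then show ?case using assms(3)[of "Q.cls u" "Q.cls v"] cl
      by (simp add: tensor_def Q.quotient_add)
  qed (rule single)
  then show ?thesis using u by simp
qed

lemma linear_hom_tensor_eqI:
  assumes "f \<in> linear_hom (tensor V W) U" "g \<in> linear_hom (tensor V W) U"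
    and "\<And>v w. \<lbrakk>v \<in> carrier V; w \<in> carrier W\<rbrakk> \<Longrightarrow> f (v \<otimes>\<^sub>t w) = g (v \<otimes>\<^sub>t w)"
    and "X \<in> carrier (tensor V W)"
  shows "f X = g X"
  using assms(4)
  by (induction X rule: tensor_induct)
    (simp_all add: assms(3) linear_hom_add[OF assms(1)] linear_hom_add[OF assms(2)])

text \<open>
  For maps of three arguments, one of which enters the bilinear map that is lifted: the lift depends
  linearly on this parameter.
\<close>

lemma tensor_lift_param:
  assumes U: "k_vector_space U" and W': "k_vector_space Z"
    and f: "\<And>z. z \<in> carrier Z \<Longrightarrow> f z \<in> bilinear_hom V W U"
    and lin: "\<And>v w. \<lbrakk>v \<in> carrier V; w \<in> carrier W\<rbrakk> \<Longrightarrow> (\<lambda>z. f z v w) \<in> linear_hom Z U"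
    and X: "X \<in> carrier (tensor V W)"
  shows "(\<lambda>z. tensor_lift U (f z) X) \<in> linear_hom Z U"
  using X
proof (induction X rule: tensor_induct)
  case (pure v w)
  interpret Z: k_vector_space Z by fact
  show ?case
    by (rule linear_hom_cong[OF lin[OF pure]]) (use tensor_lift_pure[OF U f] pure W' in auto)
next
  case (add X Y)
  interpret U: k_vector_space U by fact
  interpret Z: k_vector_space Z by fact
  have eq: "tensor_lift U (f z) (X \<oplus>\<^bsub>tensor V W\<^esub> Y) = tensor_lift U (f z) X \<oplus>\<^bsub>U\<^esub> tensor_lift U (f z) Y"
    if "z \<in> carrier Z" for z
    using linear_hom_add[OF tensor_lift_linear[OF U f[OF that]]] add by simp
  note cl = linear_hom_closed[OF add.IH(1)] linear_hom_closed[OF add.IH(2)]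
  show ?case
    by (rule linear_homI)
      (simp_all add: eq cl linear_hom_add[OF add.IH(1)] linear_hom_add[OF add.IH(2)]
        linear_hom_smult[OF add.IH(1)] linear_hom_smult[OF add.IH(2)] U.smult_add_right U.M.a_ac)
qed

end

section \<open>Tensor products of algebras\<close>

locale k_tensor_algebra = A: k_algebra A + B: k_algebra B
  for A :: "('k::field, 'a, 'x) module_scheme" and B :: "('k, 'b, 'y) module_scheme"
begin

sublocale k_tensor A B
  by (intro k_tensor.intro A.k_vector_space_axioms B.k_vector_space_axioms)

abbreviation tenA (infixr "\<otimes>\<^sub>t" 70) where "a \<otimes>\<^sub>t b \<equiv> pure_tensor A B a b"

abbreviation "S \<equiv> carrier A \<times> carrier B"

abbreviation mul (infixl "\<star>" 70) where "u \<star> v \<equiv> u \<otimes>\<^bsub>free_tensor A B\<^esub> v"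

abbreviation pmul where "pmul p q \<equiv> (fst p \<otimes>\<^bsub>A\<^esub> fst q, snd p \<otimes>\<^bsub>B\<^esub> snd q)"

text \<open>
  The product is a sum over the supports.  Enlarging the index sets to fixed ones makes its
  bilinearity visible.
\<close>

lemma mul_superset:
  assumes "finite X" "finite Y" "keys u \<subseteq> X" "keys v \<subseteq> Y"
  shows "u \<star> v = (\<Sum>p\<in>X. \<Sum>q\<in>Y. single (pmul p q)
     (lookup u p * lookup v q))"
proof -
  have "u \<star> v = (\<Sum>p\<in>keys u. \<Sum>q\<in>keys v. single (pmul p q)
     (lookup u p * lookup v q))"
    by (simp add: free_tensor_def)
  also have "\<dots> = (\<Sum>p\<in>keys u. \<Sum>q\<in>Y. single (pmul p q)
     (lookup u p * lookup v q))"
    using assms by (intro sum.cong refl sum.mono_neutral_left) (auto simp: in_keys_iff)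
  also have "\<dots> = (\<Sum>p\<in>X. \<Sum>q\<in>Y. single (pmul p q)
     (lookup u p * lookup v q))"
    using assms by (intro sum.mono_neutral_left) (auto simp: in_keys_iff)
  finally show ?thesis .
qed

lemma mul_add_left: "(u + v) \<star> w = u \<star> w + v \<star> w"
proof -
  let ?X = "keys u \<union> keys v" and ?Y = "keys w"
  have "keys (u + v) \<subseteq> ?X" by (rule keys_add)
  then show ?thesis
    by (subst (1 2 3) mul_superset[of ?X ?Y])
      (auto simp: lookup_add single_add ring_distribs sum.distrib)
qed

lemma mul_add_right: "w \<star> (u + v) = w \<star> u + w \<star> v"
proof -
  let ?X = "keys u \<union> keys v" and ?Y = "keys w"
  have "keys (u + v) \<subseteq> ?X" by (rule keys_add)
  then show ?thesis
    by (subst (1 2 3) mul_superset[of ?Y ?X])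
      (auto simp: lookup_add single_add ring_distribs sum.distrib)
qed

lemma mul_single: "single p c \<star> single q d = single (pmul p q) (c * d)"
  by (subst mul_superset[of "{p}" "{q}"]) auto

lemma mul_zero [simp]: "0 \<star> u = 0" "u \<star> 0 = 0"
  by (simp_all add: free_tensor_def)

lemma mul_diff_left: "(u - v) \<star> w = u \<star> w - v \<star> w"
  using mul_add_left[of "u - v" v w] by (simp add: algebra_simps)

lemma mul_diff_right: "w \<star> (u - v) = w \<star> u - w \<star> v"
  using mul_add_right[of w "u - v" v] by (simp add: algebra_simps)

lemma pmul_closed: "\<lbrakk>p \<in> S; q \<in> S\<rbrakk> \<Longrightarrow> pmul p q \<in> S"
  by auto

lemma mul_closed: 
  assumes "keys u \<subseteq> S" "keys v \<subseteq> S"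
  shows "keys (u \<star> v) \<subseteq> S"
  using assms(1)
proof (induction u rule: poly_mapping_restricted_induct)
  case (single s c)
  show ?case using assms(2)
  proof (induction v rule: poly_mapping_restricted_induct)
    case (add u v)
    then show ?case using keys_add[of "single s c \<star> u" "single s c \<star> v"]
      by (auto simp: mul_add_right)
  qed (use single pmul_closed in \<open>auto simp: mul_single\<close>)
next
  case (add u u')
  then show ?case using keys_add[of "u \<star> v" "u' \<star> v"] by (auto simp: mul_add_left)
qed simp

lemma mul_assoc:
  assumes "keys u \<subseteq> S" "keys v \<subseteq> S" "keys w \<subseteq> S"
  shows "(u \<star> v) \<star> w = u \<star> (v \<star> w)"
  using assms(1)
proof (induction u rule: poly_mapping_restricted_induct)
  case (single s c)
  note s = single
  show ?case using assms(2)
  proof (induction v rule: poly_mapping_restricted_induct)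
    case (single t d)
    note t = single
    show ?case using assms(3)
    proof (induction w rule: poly_mapping_restricted_induct)
      case (single r e)
      then show ?case using s t by (auto simp: mul_single A.A.m_assoc B.A.m_assoc mult.assoc)
    qed (simp_all add: mul_add_right)
  qed (simp_all add: mul_add_right mul_add_left)
qed (simp_all add: mul_add_left)

lemma mul_scale_left: "(pm_scale c u) \<star> v = pm_scale c (u \<star> v)"
proof -
  have "keys u \<subseteq> UNIV" "keys v \<subseteq> UNIV" by auto
  then show ?thesis
  proof (induction u rule: poly_mapping_restricted_induct)
    case (single s d)
    show ?case using single(2)
      by (induction v rule: poly_mapping_restricted_induct)
        (simp_all add: mul_single mul_add_right pm.scale_right_distrib mult.assoc)
  qed (simp_all add: mul_add_left pm.scale_right_distrib)
qed

lemma mul_scale_right: "u \<star> (pm_scale c v) = pm_scale c (u \<star> v)"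
proof -
  have "keys u \<subseteq> UNIV" "keys v \<subseteq> UNIV" by auto
  then show ?thesis
  proof (induction u rule: poly_mapping_restricted_induct)
    case (single s d)
    show ?case using single(2)
      by (induction v rule: poly_mapping_restricted_induct)
        (simp_all add: mul_single mul_add_right pm.scale_right_distrib mult.left_commute)
  qed (simp_all add: mul_add_left pm.scale_right_distrib)
qed

lemma k_algebra_free_tensor: "k_algebra (free_tensor A B)"
proof (rule k_algebraI)
  fix x assume "x \<in> carrier (free_tensor A B)"
  then have x: "keys x \<subseteq> S" by simp
  show "\<one>\<^bsub>free_tensor A B\<^esub> \<star> x = x" using x
    by (induction x rule: poly_mapping_restricted_induct) (auto simp: mul_single mul_add_right)
  show "x \<star> \<one>\<^bsub>free_tensor A B\<^esub> = x" using x
    by (induction x rule: poly_mapping_restricted_induct) (auto simp: mul_single mul_add_left)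
next
  fix x y assume "x \<in> carrier (free_tensor A B)" "y \<in> carrier (free_tensor A B)"
  then show "x \<star> y \<in> carrier (free_tensor A B)" using mul_closed by simp
qed (simp_all add: k_vector_space_free_tensor mul_assoc mul_add_left mul_add_right mul_scale_left
    mul_scale_right)

text \<open>
  Multiplication with a basis element \<open>(p, q)\<close> turns a bilinearity relator into a relator of the same
  kind, with \<open>v\<close>, \<open>w\<close> replaced by \<open>p v\<close>, \<open>q w\<close>.
\<close>

lemma relations_ideal_left:
  assumes "u \<in> bilinear_relations A B" "keys x \<subseteq> S"
  shows "x \<star> u \<in> bilinear_relations A B"
  using assms(2)
proof (induction x rule: poly_mapping_restricted_induct)
  case zero
  then show ?case by (simp add: bilinear_relations_def pm.span_zero)
next
  case (add x y)
  then show ?case by (simp add: bilinear_relations_def mul_add_left pm.span_add)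
next
  case (single s c)
  obtain p q where s: "s = (p, q)" "p \<in> carrier A" "q \<in> carrier B" using single by (cases s) auto
  have rel: "pm_scale c r \<in> bilinear_relations A B" if "r \<in> bilinear_relators A B" for r
    using that by (simp add: bilinear_relations_def pm.span_scale pm.span_base)
  have base: "single s c \<star> r \<in> bilinear_relations A B" if "r \<in> bilinear_relators A B" for r
    using that
  proof induction
    case (add_left v v' w)
    then show ?case
      using rel[OF bilinear_relators.add_left[of "p \<otimes>\<^bsub>A\<^esub> v" A "p \<otimes>\<^bsub>A\<^esub> v'" "q \<otimes>\<^bsub>B\<^esub> w" B]] s
      by (simp add: mul_diff_right mul_single pm.scale_right_diff_distrib A.A.r_distr)
  next
    case (add_right v w w')
    then show ?case
      using rel[OF bilinear_relators.add_right[of "p \<otimes>\<^bsub>A\<^esub> v" A "q \<otimes>\<^bsub>B\<^esub> w" B "q \<otimes>\<^bsub>B\<^esub> w'"]] s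
      by (simp add: mul_diff_right mul_single pm.scale_right_diff_distrib B.A.r_distr)
  next
    case (smult_left v w d)
    then show ?case
      using rel[OF bilinear_relators.smult_left[of "p \<otimes>\<^bsub>A\<^esub> v" A "q \<otimes>\<^bsub>B\<^esub> w" B d]] s
      by (simp add: mul_diff_right mul_single pm.scale_right_diff_distrib A.smult_mult_right)
  next
    case (smult_right v w d)
    then show ?case
      using rel[OF bilinear_relators.smult_right[of "p \<otimes>\<^bsub>A\<^esub> v" A "q \<otimes>\<^bsub>B\<^esub> w" B d]] s
      by (simp add: mul_diff_right mul_single pm.scale_right_diff_distrib B.smult_mult_right)
  qed
  have "pm.subspace {u. single s c \<star> u \<in> bilinear_relations A B}"
    unfolding pm.subspace_def
    by (auto simp: bilinear_relations_def mul_add_right mul_scale_right intro: pm.span_add pm.span_scale pm.span_zero)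
  then have "bilinear_relations A B \<subseteq> {u. single s c \<star> u \<in> bilinear_relations A B}"
    by (subst bilinear_relations_def) (intro pm.span_minimal, use base in auto)
  then show ?case using assms(1) by auto
qed

lemma relations_ideal_right:
  assumes "u \<in> bilinear_relations A B" "keys x \<subseteq> S"
  shows "u \<star> x \<in> bilinear_relations A B"
  using assms(2)
proof (induction x rule: poly_mapping_restricted_induct)
  case zero
  then show ?case by (simp add: bilinear_relations_def pm.span_zero)
next
  case (add x y)
  then show ?case by (simp add: bilinear_relations_def mul_add_right pm.span_add)
next
  case (single s c)
  obtain p q where s: "s = (p, q)" "p \<in> carrier A" "q \<in> carrier B" using single by (cases s) auto
  have rel: "pm_scale c r \<in> bilinear_relations A B" if "r \<in> bilinear_relators A B" for r
    using that by (simp add: bilinear_relations_def pm.span_scale pm.span_base)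
  have base: "r \<star> single s c \<in> bilinear_relations A B" if "r \<in> bilinear_relators A B" for r
    using that
  proof induction
    case (add_left v v' w)
    then show ?case
      using rel[OF bilinear_relators.add_left[of "v \<otimes>\<^bsub>A\<^esub> p" A "v' \<otimes>\<^bsub>A\<^esub> p" "w \<otimes>\<^bsub>B\<^esub> q" B]] s
      by (simp add: mul_diff_left mul_single pm.scale_right_diff_distrib A.A.l_distr)
  next
    case (add_right v w w')
    then show ?case
      using rel[OF bilinear_relators.add_right[of "v \<otimes>\<^bsub>A\<^esub> p" A "w \<otimes>\<^bsub>B\<^esub> q" B "w' \<otimes>\<^bsub>B\<^esub> q"]] s
      by (simp add: mul_diff_left mul_single pm.scale_right_diff_distrib B.A.l_distr)
  next
    case (smult_left v w d)
    then show ?case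
      using rel[OF bilinear_relators.smult_left[of "v \<otimes>\<^bsub>A\<^esub> p" A "w \<otimes>\<^bsub>B\<^esub> q" B d]] s
      by (simp add: mul_diff_left mul_single pm.scale_right_diff_distrib A.smult_mult_left mult.commute)
  next
    case (smult_right v w d)
    then show ?case
      using rel[OF bilinear_relators.smult_right[of "v \<otimes>\<^bsub>A\<^esub> p" A "w \<otimes>\<^bsub>B\<^esub> q" B d]] s
      by (simp add: mul_diff_left mul_single pm.scale_right_diff_distrib B.smult_mult_left mult.commute)
  qed
  have "pm.subspace {u. u \<star> single s c \<in> bilinear_relations A B}"
    unfolding pm.subspace_def
    by (auto simp: bilinear_relations_def mul_add_left mul_scale_left intro: pm.span_add pm.span_scale pm.span_zero)
  then have "bilinear_relations A B \<subseteq> {u. u \<star> single s c \<in> bilinear_relations A B}"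
    by (subst bilinear_relations_def) (intro pm.span_minimal, use base in auto)
  then show ?case using assms(1) by auto
qed

lemma relations_ideal: "ideal (bilinear_relations A B) (free_tensor A B)"
proof (rule idealI)
  show "ring (free_tensor A B)" by (rule k_algebra_ring[OF k_algebra_free_tensor])
  show "subgroup (bilinear_relations A B) (add_monoid (free_tensor A B))"
    using relations_sub by (simp add: submodule_def)
qed (auto intro: relations_ideal_left relations_ideal_right)

sublocale QA: k_quotient_algebra "free_tensor A B" "bilinear_relations A B"
  by (intro k_quotient_algebra.intro k_algebra_free_tensor relations_ideal)

lemma k_algebra_tensor: "k_algebra (tensor A B)"
  unfolding tensor_def by (rule QA.quotient_k_algebra)

lemma pure_mult: 
  assumes "a \<in> carrier A" "b \<in> carrier B" "a' \<in> carrier A" "b' \<in> carrier B"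
  shows "(a \<otimes>\<^sub>t b) \<otimes>\<^bsub>tensor A B\<^esub> (a' \<otimes>\<^sub>t b') = (a \<otimes>\<^bsub>A\<^esub> a') \<otimes>\<^sub>t (b \<otimes>\<^bsub>B\<^esub> b')"
  using assms QA.quotient_mult[of "single (a, b) 1" "single (a', b') 1"]
  by (simp add: tensor_def pure_tensor_def mul_single)

lemma tensor_one: "\<one>\<^bsub>tensor A B\<^esub> = \<one>\<^bsub>A\<^esub> \<otimes>\<^sub>t \<one>\<^bsub>B\<^esub>"
  by (simp add: tensor_def pure_tensor_def Q.quotient_one)

text \<open>A linear map out of a tensor product of algebras is multiplicative as soon as it is so on
  pure tensors, because these span.\<close>

lemma tensor_algebra_homI:
  assumes C: "k_algebra C" and f: "f \<in> linear_hom (tensor A B) C"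
    and mult: "\<And>a b a' b'. \<lbrakk>a \<in> carrier A; b \<in> carrier B; a' \<in> carrier A; b' \<in> carrier B\<rbrakk>
      \<Longrightarrow> f ((a \<otimes>\<^bsub>A\<^esub> a') \<otimes>\<^sub>t (b \<otimes>\<^bsub>B\<^esub> b')) = f (a \<otimes>\<^sub>t b) \<otimes>\<^bsub>C\<^esub> f (a' \<otimes>\<^sub>t b')"
    and one: "f (\<one>\<^bsub>A\<^esub> \<otimes>\<^sub>t \<one>\<^bsub>B\<^esub>) = \<one>\<^bsub>C\<^esub>"
  shows "f \<in> algebra_hom (tensor A B) C"
proof (rule algebra_homI[OF f])
  interpret C: k_algebra C by fact
  interpret T: k_algebra "tensor A B" by (rule k_algebra_tensor)
  fix X Y assume X: "X \<in> carrier (tensor A B)" and Y: "Y \<in> carrier (tensor A B)"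
  note cl = linear_hom_closed[OF f]
  show "f (X \<otimes>\<^bsub>tensor A B\<^esub> Y) = f X \<otimes>\<^bsub>C\<^esub> f Y"
    using X
  proof (induction X rule: tensor_induct)
    case (pure a b)
    show ?case using Y
    proof (induction Y rule: tensor_induct)
      case (pure a' b')
      then show ?case using mult \<open>a \<in> _\<close> \<open>b \<in> _\<close> by (simp add: pure_mult)
    next
      case (add X Y)
      then show ?case using \<open>a \<in> _\<close> \<open>b \<in> _\<close>
        by (simp add: T.A.r_distr C.A.r_distr cl linear_hom_add[OF f])
    qed
  next
    case (add X X')
    then show ?case using Y by (simp add: T.A.l_distr C.A.l_distr cl linear_hom_add[OF f])
  qed
qed (simp add: tensor_one one)

end

section \<open>Maps between tensor products\<close>

lemma linear_hom_pureI:
  assumes "k_vector_space V" "k_vector_space W"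
  shows "f \<in> linear_hom U V \<Longrightarrow> w \<in> carrier W \<Longrightarrow> (\<lambda>u. pure_tensor V W (f u) w) \<in> linear_hom U (tensor V W)"
    and "v \<in> carrier V \<Longrightarrow> g \<in> linear_hom U W \<Longrightarrow> (\<lambda>u. pure_tensor V W v (g u)) \<in> linear_hom U (tensor V W)"
proof -
  interpret k_tensor V W by (intro k_tensor.intro assms)
  show "f \<in> linear_hom U V \<Longrightarrow> w \<in> carrier W \<Longrightarrow> (\<lambda>u. pure_tensor V W (f u) w) \<in> linear_hom U (tensor V W)"
    using linear_hom_compose[OF _ bilinear_homD(2)[OF pure_bilinear]] by blast
  show "v \<in> carrier V \<Longrightarrow> g \<in> linear_hom U W \<Longrightarrow> (\<lambda>u. pure_tensor V W v (g u)) \<in> linear_hom U (tensor V W)"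
    using linear_hom_compose[OF _ bilinear_homD(1)[OF pure_bilinear]] by blast
qed

context
  fixes V :: "('k::field, 'v, 'x1) module_scheme" and W :: "('k, 'w, 'x2) module_scheme"
    and V' :: "('k, 'v2, 'x3) module_scheme" and W' :: "('k, 'w2, 'x4) module_scheme" and f g
  assumes vs: "k_vector_space V" "k_vector_space W" "k_vector_space V'" "k_vector_space W'"
    and f: "f \<in> linear_hom V V'" and g: "g \<in> linear_hom W W'"
begin

lemma tensor_map_bilinear: "(\<lambda>v w. pure_tensor V' W' (f v) (g w)) \<in> bilinear_hom V W (tensor V' W')"
  using linear_hom_closed[OF f] linear_hom_closed[OF g] f g
  by (intro bilinear_homI linear_hom_pureI vs) auto

lemma tensor_map_linear: "tensor_map V' W' f g \<in> linear_hom (tensor V W) (tensor V' W')"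
  unfolding tensor_map_def
  by (intro k_tensor.tensor_lift_linear k_tensor.intro k_tensor.k_vector_space_tensor vs tensor_map_bilinear)

lemma tensor_map_pure: "\<lbrakk>v \<in> carrier V; w \<in> carrier W\<rbrakk>
    \<Longrightarrow> tensor_map V' W' f g (pure_tensor V W v w) = pure_tensor V' W' (f v) (g w)"
  unfolding tensor_map_def
  by (intro k_tensor.tensor_lift_pure k_tensor.intro k_tensor.k_vector_space_tensor vs tensor_map_bilinear)

end

lemma tensor_map_algebra_hom:
  assumes A: "k_algebra A" "k_algebra B" "k_algebra A'" "k_algebra B'"
    and f: "f \<in> algebra_hom A A'" and g: "g \<in> algebra_hom B B'"
  shows "tensor_map A' B' f g \<in> algebra_hom (tensor A B) (tensor A' B')"
proof -
  interpret T: k_tensor_algebra A B by (intro k_tensor_algebra.intro A)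
  interpret T': k_tensor_algebra A' B' by (intro k_tensor_algebra.intro A)
  note vs = T.A.k_vector_space_axioms T.B.k_vector_space_axioms
    T'.A.k_vector_space_axioms T'.B.k_vector_space_axioms algebra_homD(1)[OF f] algebra_homD(1)[OF g]
  note p = tensor_map_pure[OF vs]
  show ?thesis
    by (rule T.tensor_algebra_homI[OF T'.k_algebra_tensor tensor_map_linear[OF vs]])
      (simp_all add: p algebra_homD(3-5)[OF f] algebra_homD(3-5)[OF g] T'.pure_mult T'.tensor_one)
qed

context
  fixes U :: "('k::field, 'u, 'x0) module_scheme"
    and V :: "('k, 'v, 'x1) module_scheme" and W :: "('k, 'w, 'x2) module_scheme"
  assumes vs: "k_vector_space U" "k_vector_space V" "k_vector_space W"
begin

interpretation UV: k_tensor U V by (intro k_tensor.intro vs)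
interpretation VW: k_tensor V W by (intro k_tensor.intro vs)
interpretation L: k_tensor "tensor U V" W by (intro k_tensor.intro vs UV.k_vector_space_tensor)
interpretation R: k_tensor U "tensor V W" by (intro k_tensor.intro vs VW.k_vector_space_tensor)

lemma tensor_assoc_inner_bilinear: 
  "w \<in> carrier W \<Longrightarrow> (\<lambda>u v. pure_tensor U (tensor V W) u (pure_tensor V W v w)) \<in> bilinear_hom U V (tensor U (tensor V W))"
  by (intro bilinear_homI linear_hom_pureI(2) vs VW.k_vector_space_tensor bilinear_homD(2)[OF VW.pure_bilinear]
      bilinear_homD(2)[OF R.pure_bilinear]) auto

lemma tensor_assoc_bilinear:
  "(\<lambda>X w. tensor_lift (tensor U (tensor V W)) (\<lambda>u v.
     pure_tensor U (tensor V W) u (pure_tensor V W v w)) X)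
   \<in> bilinear_hom (tensor U V) W (tensor U (tensor V W))"
proof (rule bilinear_homI)
  fix X assume X: "X \<in> carrier (tensor U V)"
  show "(\<lambda>w. tensor_lift (tensor U (tensor V W)) (\<lambda>u v.
     pure_tensor U (tensor V W) u (pure_tensor V W v w)) X) \<in> linear_hom W (tensor U (tensor V W))"
    by (rule UV.tensor_lift_param[OF R.k_vector_space_tensor vs(3) tensor_assoc_inner_bilinear _ X])
     (auto intro!: linear_hom_pureI(2) vs VW.k_vector_space_tensor bilinear_homD(1)[OF VW.pure_bilinear])
qed (intro UV.tensor_lift_linear R.k_vector_space_tensor tensor_assoc_inner_bilinear)

lemma tensor_assoc_linear: "tensor_assoc U V W \<in> linear_hom (tensor (tensor U V) W) (tensor U (tensor V W))"
  unfolding tensor_assoc_def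
  by (rule L.tensor_lift_linear[OF R.k_vector_space_tensor tensor_assoc_bilinear])

lemma tensor_assoc_pure:
  "\<lbrakk>u \<in> carrier U; v \<in> carrier V; w \<in> carrier W\<rbrakk> \<Longrightarrow>
   tensor_assoc U V W (pure_tensor (tensor U V) W (pure_tensor U V u v) w)
     = pure_tensor U (tensor V W) u (pure_tensor V W v w)"
  unfolding tensor_assoc_def
  by (subst L.tensor_lift_pure[OF R.k_vector_space_tensor tensor_assoc_bilinear])
    (auto simp: UV.tensor_lift_pure[OF R.k_vector_space_tensor tensor_assoc_inner_bilinear])

lemma linear_hom_tensor3_eqI:
  assumes "f \<in> linear_hom (tensor (tensor U V) W) Z" "g \<in> linear_hom (tensor (tensor U V) W) Z"
    and "\<And>u v w. \<lbrakk>u \<in> carrier U; v \<in> carrier V; w \<in> carrier W\<rbrakk>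
      \<Longrightarrow> f (pure_tensor (tensor U V) W (pure_tensor U V u v) w)
        = g (pure_tensor (tensor U V) W (pure_tensor U V u v) w)"
    and "X \<in> carrier (tensor (tensor U V) W)"
  shows "f X = g X"
proof (rule L.linear_hom_tensor_eqI[OF assms(1,2) _ assms(4)])
  fix Y w assume Y: "Y \<in> carrier (tensor U V)" and w: "w \<in> carrier W"
  show "f (pure_tensor (tensor U V) W Y w) = g (pure_tensor (tensor U V) W Y w)"
    by (rule UV.linear_hom_tensor_eqI[OF _ _ _ Y,
          of "\<lambda>Y. f (pure_tensor (tensor U V) W Y w)" Z "\<lambda>Y. g (pure_tensor (tensor U V) W Y w)"])
      (auto intro: linear_hom_compose[OF bilinear_homD(2)[OF L.pure_bilinear w]] assms w)
qed

end

lemma tensor_assoc_algebra_hom: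
  assumes A: "k_algebra A" "k_algebra B" "k_algebra C"
  shows "tensor_assoc A B C \<in> algebra_hom (tensor (tensor A B) C) (tensor A (tensor B C))"
proof -
  interpret AB: k_tensor_algebra A B by (intro k_tensor_algebra.intro A)
  interpret BC: k_tensor_algebra B C by (intro k_tensor_algebra.intro A)
  interpret ABT: k_algebra "tensor A B" by (rule AB.k_algebra_tensor)
  interpret L: k_tensor_algebra "tensor A B" C by (intro k_tensor_algebra.intro A AB.k_algebra_tensor)
  interpret R: k_tensor_algebra A "tensor B C" by (intro k_tensor_algebra.intro A BC.k_algebra_tensor)
  interpret LT: k_algebra "tensor (tensor A B) C" by (rule L.k_algebra_tensor)
  interpret RT: k_algebra "tensor A (tensor B C)" by (rule R.k_algebra_tensor)
  note vs = AB.A.k_vector_space_axioms AB.B.k_vector_space_axioms BC.B.k_vector_space_axioms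
  note l = tensor_assoc_linear[OF vs] and p = tensor_assoc_pure[OF vs]
  let ?f = "tensor_assoc A B C"
  note cl = linear_hom_closed[OF l]
  have mult: "?f (pure_tensor (tensor A B) C (X \<otimes>\<^bsub>tensor A B\<^esub> Y) (c \<otimes>\<^bsub>C\<^esub> c'))
      = ?f (pure_tensor (tensor A B) C X c) \<otimes>\<^bsub>tensor A (tensor B C)\<^esub> ?f (pure_tensor (tensor A B) C Y c')"
    if X: "X \<in> carrier (tensor A B)" and Y: "Y \<in> carrier (tensor A B)"
      and c: "c \<in> carrier C" "c' \<in> carrier C" for X Y c c'
    using X
  proof (induction X rule: AB.tensor_induct)
    case (pure a b)
    show ?case using Y
    proof (induction Y rule: AB.tensor_induct)
      case (pure a' b')
      then show ?case using c \<open>a \<in> _\<close> \<open>b \<in> _\<close>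
        by (simp add: AB.pure_mult p R.pure_mult BC.pure_mult)
    next
      case (add Y Y')
      then show ?case using c \<open>a \<in> _\<close> \<open>b \<in> _\<close>
        by (simp add: ABT.A.r_distr linear_hom_add[OF bilinear_homD(2)[OF L.pure_bilinear]]
            linear_hom_add[OF l] cl RT.A.r_distr)
    qed
  next
    case (add X X')
    then show ?case using c Y
      by (simp add: ABT.A.l_distr linear_hom_add[OF bilinear_homD(2)[OF L.pure_bilinear]]
            linear_hom_add[OF l] cl RT.A.l_distr)
  qed
  show ?thesis
    by (rule L.tensor_algebra_homI[OF R.k_algebra_tensor l])
      (simp_all add: mult AB.tensor_one p R.tensor_one BC.tensor_one)
qed

section \<open>Matrices with entries in an algebra\<close>

text \<open>
  Matrix calculus in a noncommutative algebra given as a record: \<open>smat\<close> embeds the scalar matrices.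
  Transposition reverses a product only if the entries of the two factors commute with each other, in
  particular if one factor is scalar.
\<close>

definition mmul :: "('k::field, 'a, 'x) module_scheme \<Rightarrow> 'a^'n^'m \<Rightarrow> 'a^'p^'n \<Rightarrow> 'a^'p^'m" where
  "mmul A X Y = (\<chi> i j. \<Oplus>\<^bsub>A\<^esub>k\<in>UNIV. X $ i $ k \<otimes>\<^bsub>A\<^esub> Y $ k $ j)"

definition smat :: "('k::field, 'a, 'x) module_scheme \<Rightarrow> 'k^'n^'m \<Rightarrow> 'a^'n^'m" where
  "smat A M = (\<chi> i j. M $ i $ j \<odot>\<^bsub>A\<^esub> \<one>\<^bsub>A\<^esub>)"

definition mat_in :: "('k::field, 'a, 'x) module_scheme \<Rightarrow> 'a^'n^'m \<Rightarrow> bool" where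
  "mat_in A X \<longleftrightarrow> (\<forall>i j. X $ i $ j \<in> carrier A)"

lemma matrix_inv_inverse:
  assumes "invertible (M :: 'k::field^'n^'n)"
  shows "M ** matrix_inv M = mat 1" "matrix_inv M ** M = mat 1"
proof -
  from assms obtain N where "M ** N = mat 1 \<and> N ** M = mat 1" by (auto simp: invertible_def)
  then have "M ** matrix_inv M = mat 1 \<and> matrix_inv M ** M = mat 1"
    unfolding matrix_inv_def by (rule someI)
  then show "M ** matrix_inv M = mat 1" "matrix_inv M ** M = mat 1" by auto
qed

context k_algebra
begin

lemma mat_in_simps [simp]:
  "mat_in A (smat A M)"
  "mat_in A X \<Longrightarrow> mat_in A (transpose X)"
  "mat_in A X \<Longrightarrow> mat_in A Y \<Longrightarrow> mat_in A (mmul A X Y)"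
  by (auto simp: mat_in_def smat_def transpose_def mmul_def intro!: M.finsum_closed)

lemma mat_inD: "mat_in A X \<Longrightarrow> X $ i $ j \<in> carrier A"
  by (simp add: mat_in_def)

lemma mmul_assoc:
  assumes "mat_in A X" "mat_in A Y" "mat_in A Z"
  shows "mmul A (mmul A X Y) Z = mmul A X (mmul A Y Z)"
proof -
  note cl [simp] = mat_inD[OF assms(1)] mat_inD[OF assms(2)] mat_inD[OF assms(3)]
  have "(\<Oplus>\<^bsub>A\<^esub>k\<in>UNIV. (\<Oplus>\<^bsub>A\<^esub>l\<in>UNIV. X $ i $ l \<otimes>\<^bsub>A\<^esub> Y $ l $ k) \<otimes>\<^bsub>A\<^esub> Z $ k $ j)
      = (\<Oplus>\<^bsub>A\<^esub>l\<in>UNIV. X $ i $ l \<otimes>\<^bsub>A\<^esub> (\<Oplus>\<^bsub>A\<^esub>k\<in>UNIV. Y $ l $ k \<otimes>\<^bsub>A\<^esub> Z $ k $ j))" for i j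
  proof -
    have "(\<Oplus>\<^bsub>A\<^esub>k\<in>UNIV. (\<Oplus>\<^bsub>A\<^esub>l\<in>UNIV. X $ i $ l \<otimes>\<^bsub>A\<^esub> Y $ l $ k) \<otimes>\<^bsub>A\<^esub> Z $ k $ j)
        = (\<Oplus>\<^bsub>A\<^esub>k\<in>UNIV. \<Oplus>\<^bsub>A\<^esub>l\<in>UNIV. X $ i $ l \<otimes>\<^bsub>A\<^esub> (Y $ l $ k \<otimes>\<^bsub>A\<^esub> Z $ k $ j))"
      by (intro M.finsum_cong') (auto simp: A.finsum_ldistr A.m_assoc intro!: M.finsum_closed)
    also have "\<dots> = (\<Oplus>\<^bsub>A\<^esub>l\<in>UNIV. \<Oplus>\<^bsub>A\<^esub>k\<in>UNIV. X $ i $ l \<otimes>\<^bsub>A\<^esub> (Y $ l $ k \<otimes>\<^bsub>A\<^esub> Z $ k $ j))"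
      by (intro finsum_swap) auto
    also have "\<dots> = (\<Oplus>\<^bsub>A\<^esub>l\<in>UNIV. X $ i $ l \<otimes>\<^bsub>A\<^esub> (\<Oplus>\<^bsub>A\<^esub>k\<in>UNIV. Y $ l $ k \<otimes>\<^bsub>A\<^esub> Z $ k $ j))"
      by (intro M.finsum_cong') (auto simp: A.finsum_rdistr intro!: M.finsum_closed)
    finally show ?thesis .
  qed
  then show ?thesis by (simp add: mmul_def vec_eq_iff)
qed

lemma scalar_mult_left: "x \<in> carrier A \<Longrightarrow> (c \<odot>\<^bsub>A\<^esub> \<one>\<^bsub>A\<^esub>) \<otimes>\<^bsub>A\<^esub> x = c \<odot>\<^bsub>A\<^esub> x"
  by (simp add: smult_mult_left)

lemma scalar_mult_right: "x \<in> carrier A \<Longrightarrow> x \<otimes>\<^bsub>A\<^esub> (c \<odot>\<^bsub>A\<^esub> \<one>\<^bsub>A\<^esub>) = c \<odot>\<^bsub>A\<^esub> x"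
  by (simp add: smult_mult_right)

lemma sum_smult: "\<lbrakk>finite I; x \<in> carrier A\<rbrakk> \<Longrightarrow> (\<Oplus>\<^bsub>A\<^esub>i\<in>I. c i \<odot>\<^bsub>A\<^esub> x) = (\<Sum>i\<in>I. c i) \<odot>\<^bsub>A\<^esub> x"
  by (induction I rule: finite_induct) (simp_all add: smult_add_left Pi_def)

lemma finsum_delta: 
  assumes "\<And>k. f k \<in> carrier A"
  shows "(\<Oplus>\<^bsub>A\<^esub>k\<in>(UNIV::'i::finite set). (if i = k then 1 else 0) \<odot>\<^bsub>A\<^esub> f k) = f i"
proof -
  have "(\<Oplus>\<^bsub>A\<^esub>k\<in>(UNIV::'i set). (if i = k then 1 else 0) \<odot>\<^bsub>A\<^esub> f k)
      = (\<Oplus>\<^bsub>A\<^esub>k\<in>(UNIV::'i set). if i = k then f k else \<zero>\<^bsub>A\<^esub>)"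
    using assms by (intro M.finsum_cong') auto
  also have "\<dots> = f i" using assms by (intro M.add.finprod_singleton) auto
  finally show ?thesis .
qed

lemma mmul_smat: "mmul A (smat A M) (smat A N) = smat A (M ** N)"
  by (simp add: mmul_def smat_def vec_eq_iff matrix_matrix_mult_def scalar_mult_left smult_smult sum_smult)

lemma mmul_one_left: "mat_in A X \<Longrightarrow> mmul A (smat A (mat 1)) X = X"
  by (simp add: mmul_def smat_def vec_eq_iff mat_def scalar_mult_left mat_inD finsum_delta)

lemma mmul_one_right: 
  assumes "mat_in A X" shows "mmul A X (smat A (mat 1)) = X"
proof -
  have "(if k = j then (1::'k) else 0) = (if j = k then 1 else 0)" for j k :: 'b by auto
  then show ?thesis using assms
    by (simp add: mmul_def smat_def vec_eq_iff mat_def scalar_mult_right mat_inD finsum_delta)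
qed

lemma transpose_smat [simp]: "transpose (smat A M) = smat A (transpose M)"
  by (simp add: transpose_def smat_def vec_eq_iff)

lemma transpose_mmul_commuting:
  assumes "mat_in A X" "mat_in A Y"
    and "\<And>i k l j. X $ i $ k \<otimes>\<^bsub>A\<^esub> Y $ l $ j = Y $ l $ j \<otimes>\<^bsub>A\<^esub> X $ i $ k"
  shows "transpose (mmul A X Y) = mmul A (transpose Y) (transpose X)"
  by (simp add: transpose_def mmul_def vec_eq_iff assms(3))

lemma transpose_mmul_smat:
  assumes "mat_in A X"
  shows "transpose (mmul A X (smat A M)) = mmul A (smat A (transpose M)) (transpose X)"
    and "transpose (mmul A (smat A N) X) = mmul A (transpose X) (smat A (transpose N))"
proof -
  have "X $ i $ k \<otimes>\<^bsub>A\<^esub> smat A M $ l $ j = smat A M $ l $ j \<otimes>\<^bsub>A\<^esub> X $ i $ k" for M :: "'k^'q^'p" and i k l j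
    by (simp add: smat_def scalar_mult_left scalar_mult_right mat_inD[OF assms])
  note comm = this
  show "transpose (mmul A X (smat A M)) = mmul A (smat A (transpose M)) (transpose X)"
    using transpose_mmul_commuting[OF assms mat_in_simps(1)[of M] comm] by simp
  show "transpose (mmul A (smat A N) X) = mmul A (transpose X) (smat A (transpose N))"
    using transpose_mmul_commuting[OF mat_in_simps(1)[of N] assms comm[symmetric]] by simp
qed

end

lemma map_matrix_component [simp]: "map_matrix f X $ i $ j = f (X $ i $ j)"
  by (simp add: map_matrix_def)

lemma map_matrix_transpose: "map_matrix f (transpose X) = transpose (map_matrix f X)"
  by (simp add: map_matrix_def transpose_def vec_eq_iff)

lemma algebra_hom_matrix:
  assumes A: "k_algebra A" "k_algebra B" and h: "h \<in> algebra_hom A B"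
  shows "map_matrix h (smat A M) = smat B M"
    and "mat_in A X \<Longrightarrow> mat_in B (map_matrix h X)"
    and "\<lbrakk>mat_in A X; mat_in A Y\<rbrakk> \<Longrightarrow> map_matrix h (mmul A X Y) = mmul B (map_matrix h X) (map_matrix h Y)"
proof -
  interpret A: k_algebra A by fact
  interpret B: k_algebra B by fact
  note l = algebra_homD(1)[OF h]
  show "map_matrix h (smat A M) = smat B M"
    by (simp add: vec_eq_iff smat_def linear_hom_smult[OF l] algebra_homD(5)[OF h])
  show "mat_in A X \<Longrightarrow> mat_in B (map_matrix h X)"
    by (simp add: mat_in_def algebra_homD(3)[OF h])
  show "map_matrix h (mmul A X Y) = mmul B (map_matrix h X) (map_matrix h Y)"
    if "mat_in A X" "mat_in A Y"
    using A.mat_inD[OF that(1)] A.mat_inD[OF that(2)]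
    by (simp add: vec_eq_iff mmul_def linear_hom_finsum[OF l A.k_vector_space_axioms B.k_vector_space_axioms]
        algebra_homD(4)[OF h])
qed

text \<open>The defining relations of \<open>\<B>(E,F)\<close>, in an arbitrary algebra, in the equivalent form
  \<open>X\<^sup>t E X = F\<close> and \<open>X F\<^sup>-\<^sup>1 X\<^sup>t = E\<^sup>-\<^sup>1\<close>, which composes better.  Each relation has the shape
  ``\<open>X\<close> carries one bilinear form to another''.\<close>

definition form_map :: "('k::field, 'a, 'x) module_scheme \<Rightarrow> 'k^'n^'n \<Rightarrow> 'k^'m^'m \<Rightarrow> 'a^'n^'m \<Rightarrow> bool" where
  "form_map A P Q X \<longleftrightarrow> mmul A (mmul A X (smat A P)) (transpose X) = smat A Q"

definition bilin_point :: "('k::field, 'a, 'x) module_scheme \<Rightarrow> 'k^'m^'m \<Rightarrow> 'k^'n^'n \<Rightarrow> 'a^'n^'m \<Rightarrow> bool" where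
  "bilin_point A E F X \<longleftrightarrow> mat_in A X \<and> form_map A E F (transpose X)
     \<and> form_map A (matrix_inv F) (matrix_inv E) X"

context k_algebra
begin

text \<open>
  \<open>X Y R Y\<^sup>t X\<^sup>t = X P X\<^sup>t = Q\<close>, where \<open>(X Y)\<^sup>t = Y\<^sup>t X\<^sup>t\<close> by commutation of the entries.
\<close>

lemma form_map_comp:
  assumes "mat_in A X" "mat_in A Y" "form_map A P Q X" "form_map A R P Y"
    and comm: "\<And>i k l j. X $ i $ k \<otimes>\<^bsub>A\<^esub> Y $ l $ j = Y $ l $ j \<otimes>\<^bsub>A\<^esub> X $ i $ k"
  shows "form_map A R Q (mmul A X Y)"
proof -
  have "mmul A (mmul A (mmul A X Y) (smat A R)) (transpose (mmul A X Y))
      = mmul A (mmul A (mmul A X Y) (smat A R)) (mmul A (transpose Y) (transpose X))"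
    using transpose_mmul_commuting[OF assms(1,2) comm] by simp
  also have "\<dots> = mmul A (mmul A X (mmul A (mmul A Y (smat A R)) (transpose Y))) (transpose X)"
    by (simp add: mmul_assoc assms)
  also have "\<dots> = smat A Q" using assms by (simp add: form_map_def)
  finally show ?thesis by (simp add: form_map_def)
qed

lemma bilin_point_comp:
  assumes X: "bilin_point A E F X" and Y: "bilin_point A F G Y"
    and comm: "\<And>i k l j. X $ i $ k \<otimes>\<^bsub>A\<^esub> Y $ l $ j = Y $ l $ j \<otimes>\<^bsub>A\<^esub> X $ i $ k"
  shows "bilin_point A E G (mmul A X Y)"
proof -
  have cl: "mat_in A X" "mat_in A Y" using X Y by (auto simp: bilin_point_def)
  have "form_map A E G (mmul A (transpose Y) (transpose X))"
    using X Y cl by (intro form_map_comp[where P=F])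
      (simp_all add: bilin_point_def, simp add: transpose_def comm)
  then have "form_map A E G (transpose (mmul A X Y))"
    using transpose_mmul_commuting[OF cl comm] by simp
  moreover have "form_map A (matrix_inv G) (matrix_inv E) (mmul A X Y)"
    using X Y by (intro form_map_comp[where P="matrix_inv F"] comm) (auto simp: bilin_point_def)
  ultimately show ?thesis using cl by (simp add: bilin_point_def)
qed

lemma mat_eval_mult:
  assumes \<phi>: "\<And>x. \<phi> x \<in> carrier A"
  shows "map_matrix (free_eval A \<phi>) (M ** N)
    = mmul A (map_matrix (free_eval A \<phi>) M) (map_matrix (free_eval A \<phi>) N)"
  by (simp add: vec_eq_iff mmul_def matrix_matrix_mult_def free_eval_simps[of \<phi>, OF \<phi>])

lemma mat_eval_const:
  assumes \<phi>: "\<And>x. \<phi> x \<in> carrier A"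
  shows "map_matrix (free_eval A \<phi>) (map_matrix free_const M) = smat A M"
  by (simp add: vec_eq_iff smat_def free_eval_simps[of \<phi>, OF \<phi>])

lemma mat_eval_one:
  assumes \<phi>: "\<And>x. \<phi> x \<in> carrier A"
  shows "map_matrix (free_eval A \<phi>) (mat 1) = smat A (mat 1)"
  by (simp add: vec_eq_iff smat_def mat_def free_eval_simps[of \<phi>, OF \<phi>])

text \<open>
  The defining relations of \<open>\<B>(E,F)\<close> are \<open>F\<^sup>-\<^sup>1 (X\<^sup>t E X) = 1\<close> and \<open>(X F\<^sup>-\<^sup>1 X\<^sup>t) E = 1\<close>; the factors
  \<open>F\<^sup>-\<^sup>1\<close> and \<open>E\<close> are invertible.
\<close>

lemma bilin_rels_iff:
  fixes E :: "'k^'m^'m" and F :: "'k^'n^'n"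
  assumes E: "invertible E" and F: "invertible F" and X: "mat_in A X"
  shows "(\<forall>r\<in>bilin_rels E F. free_eval A (\<lambda>(i, j). X $ i $ j) r = \<zero>\<^bsub>A\<^esub>) \<longleftrightarrow> bilin_point A E F X"
proof -
  define \<phi> where "\<phi> = (\<lambda>(i, j). X $ i $ j)"
  have \<phi>: "\<phi> x \<in> carrier A" for x using mat_inD[OF X] by (auto simp: \<phi>_def split: prod.split)
  note s = free_eval_simps[of \<phi>, OF \<phi>]
  let ?ev = "map_matrix (free_eval A \<phi>)"
  have gen: "?ev gen_matrix = X"
    by (simp add: vec_eq_iff gen_matrix_def s) (simp add: \<phi>_def)
  let ?E = "smat A E" and ?F = "smat A F" and ?E' = "smat A (matrix_inv E)" and ?F' = "smat A (matrix_inv F)"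
  let ?I = "smat A (mat 1)"
  let ?R = "mmul A (mmul A (mmul A ?F' (transpose X)) ?E) X"
  let ?S = "mmul A (mmul A (mmul A X ?F') (transpose X)) ?E"
  have inv: "E ** matrix_inv E = mat 1" "matrix_inv E ** E = mat 1"
    "F ** matrix_inv F = mat 1" "matrix_inv F ** F = mat 1"
    using E F by (simp_all add: matrix_inv_inverse)
  have diff: "(\<forall>i j. free_eval A \<phi> ((M - N) $ i $ j) = \<zero>\<^bsub>A\<^esub>) \<longleftrightarrow> ?ev M = ?ev N" for M N :: "(_, 'k) free_alg^'q^'q"
  proof -
    have "free_eval A \<phi> (p - q) = \<zero>\<^bsub>A\<^esub> \<longleftrightarrow> free_eval A \<phi> p = free_eval A \<phi> q" for p q
      using eq_if_diff_zero[OF s(1) s(1), of p q] s(1)[of q] by (auto simp: s(3) a_minus_def M.r_neg)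
    then show ?thesis by (simp add: vec_eq_iff)
  qed
  have "(\<forall>r\<in>bilin_rels E F. free_eval A \<phi> r = \<zero>\<^bsub>A\<^esub>) \<longleftrightarrow> ?R = ?I \<and> ?S = ?I"
  proof -
    have ev1: "?ev (map_matrix free_const (matrix_inv F) ** transpose gen_matrix ** map_matrix free_const E ** gen_matrix) = ?R"
      by (simp add: mat_eval_mult[of \<phi>, OF \<phi>] mat_eval_const[of \<phi>, OF \<phi>] gen map_matrix_transpose)
    have ev2: "?ev (gen_matrix ** map_matrix free_const (matrix_inv F) ** transpose gen_matrix ** map_matrix free_const E) = ?S"
      by (simp add: mat_eval_mult[of \<phi>, OF \<phi>] mat_eval_const[of \<phi>, OF \<phi>] gen map_matrix_transpose)
    have ball: "(\<forall>r\<in>{M $ i $ j |i j. True}. P r) \<longleftrightarrow> (\<forall>i j. P (M $ i $ j))" for M :: "'z^'q^'q" and P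
      by auto
    show ?thesis
      unfolding bilin_rels_def Let_def ball_Un
      by (simp only: ball diff mat_eval_one[of \<phi>, OF \<phi>] ev1 ev2)
  qed
  also have "?R = ?I \<longleftrightarrow> form_map A E F (transpose X)"
  proof -
    have "?R = mmul A ?F' (mmul A (mmul A (transpose X) ?E) X)" using X by (simp add: mmul_assoc)
    moreover have "mmul A ?F (mmul A ?F' Z) = Z" if "mat_in A Z" for Z :: "'a^'n^'n"
      using that by (simp add: mmul_assoc[symmetric] mmul_smat inv mmul_one_left)
    moreover have "mmul A ?F ?I = ?F" "mmul A ?F' ?F = ?I" by (simp_all add: mmul_smat inv)
    ultimately show ?thesis using X unfolding form_map_def transpose_transpose
      by (metis mat_in_simps)
  qed
  also have "?S = ?I \<longleftrightarrow> form_map A (matrix_inv F) (matrix_inv E) X"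
  proof -
    have "mmul A (mmul A Z ?E) ?E' = Z" if "mat_in A Z" for Z :: "'a^'m^'m"
      using that by (simp add: mmul_assoc mmul_smat inv mmul_one_right)
    moreover have "mmul A ?I ?E' = ?E'" "mmul A ?E' ?E = ?I" by (simp_all add: mmul_smat inv)
    ultimately show ?thesis using X unfolding form_map_def
      by (metis mat_in_simps)
  qed
  finally show ?thesis using X by (simp add: bilin_point_def \<phi>_def)
qed

text \<open>
  The relation of the quadratic algebra is \<open>x M x\<^sup>t = t\<close> for the row vector \<open>x\<close>.  In this form it is
  covered by the lemmas on \<open>form_map\<close>.
\<close>

lemma quadratic_rels_iff:
  fixes M :: "'k^'m^'m"
  assumes x: "\<And>i. x i \<in> carrier A"
  shows "(\<forall>r\<in>quadratic_rels M t. free_eval A x r = \<zero>\<^bsub>A\<^esub>)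
    \<longleftrightarrow> form_map A M (\<chi> i j. t) ((\<chi> i j. x j) :: 'a^'m^1)"
proof -
  note s = free_eval_simps[of x, OF x]
  have "(\<Oplus>\<^bsub>A\<^esub>i\<in>UNIV. \<Oplus>\<^bsub>A\<^esub>j\<in>UNIV. (M $ i $ j \<odot>\<^bsub>A\<^esub> \<one>\<^bsub>A\<^esub>) \<otimes>\<^bsub>A\<^esub> x i \<otimes>\<^bsub>A\<^esub> x j)
     = (\<Oplus>\<^bsub>A\<^esub>j\<in>UNIV. \<Oplus>\<^bsub>A\<^esub>i\<in>UNIV. (M $ i $ j \<odot>\<^bsub>A\<^esub> \<one>\<^bsub>A\<^esub>) \<otimes>\<^bsub>A\<^esub> x i \<otimes>\<^bsub>A\<^esub> x j)"
    by (intro finsum_swap) (auto simp: x)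
  also have "\<dots> = (\<Oplus>\<^bsub>A\<^esub>j\<in>UNIV. (\<Oplus>\<^bsub>A\<^esub>i\<in>UNIV. x i \<otimes>\<^bsub>A\<^esub> (M $ i $ j \<odot>\<^bsub>A\<^esub> \<one>\<^bsub>A\<^esub>)) \<otimes>\<^bsub>A\<^esub> x j)"
    by (intro M.finsum_cong') (auto simp: x A.finsum_ldistr scalar_mult_left scalar_mult_right
        intro!: M.finsum_closed)
  finally have eq: "(\<Oplus>\<^bsub>A\<^esub>i\<in>UNIV. \<Oplus>\<^bsub>A\<^esub>j\<in>UNIV. (M $ i $ j \<odot>\<^bsub>A\<^esub> \<one>\<^bsub>A\<^esub>) \<otimes>\<^bsub>A\<^esub> x i \<otimes>\<^bsub>A\<^esub> x j)
     = (\<Oplus>\<^bsub>A\<^esub>j\<in>UNIV. (\<Oplus>\<^bsub>A\<^esub>i\<in>UNIV. x i \<otimes>\<^bsub>A\<^esub> (M $ i $ j \<odot>\<^bsub>A\<^esub> \<one>\<^bsub>A\<^esub>)) \<otimes>\<^bsub>A\<^esub> x j)" .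
  have c: "(\<Oplus>\<^bsub>A\<^esub>i\<in>UNIV. \<Oplus>\<^bsub>A\<^esub>j\<in>UNIV. (M $ i $ j \<odot>\<^bsub>A\<^esub> \<one>\<^bsub>A\<^esub>) \<otimes>\<^bsub>A\<^esub> x i \<otimes>\<^bsub>A\<^esub> x j) \<in> carrier A"
    by (auto intro!: M.finsum_closed x)
  have "(\<forall>r\<in>quadratic_rels M t. free_eval A x r = \<zero>\<^bsub>A\<^esub>) \<longleftrightarrow>
     (\<Oplus>\<^bsub>A\<^esub>i\<in>UNIV. \<Oplus>\<^bsub>A\<^esub>j\<in>UNIV. (M $ i $ j \<odot>\<^bsub>A\<^esub> \<one>\<^bsub>A\<^esub>) \<otimes>\<^bsub>A\<^esub> x i \<otimes>\<^bsub>A\<^esub> x j) \<ominus>\<^bsub>A\<^esub> t \<odot>\<^bsub>A\<^esub> \<one>\<^bsub>A\<^esub> = \<zero>\<^bsub>A\<^esub>"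
    by (simp add: quadratic_rels_def s)
  also have "\<dots> \<longleftrightarrow>
     (\<Oplus>\<^bsub>A\<^esub>i\<in>UNIV. \<Oplus>\<^bsub>A\<^esub>j\<in>UNIV. (M $ i $ j \<odot>\<^bsub>A\<^esub> \<one>\<^bsub>A\<^esub>) \<otimes>\<^bsub>A\<^esub> x i \<otimes>\<^bsub>A\<^esub> x j) = t \<odot>\<^bsub>A\<^esub> \<one>\<^bsub>A\<^esub>"
    using eq_if_diff_zero[OF c, of "t \<odot>\<^bsub>A\<^esub> \<one>\<^bsub>A\<^esub>"] by (auto simp: a_minus_def M.r_neg)
  finally show ?thesis
    by (simp add: eq form_map_def mmul_def smat_def transpose_def vec_eq_iff)
qed

end

lemma free_hom_ext:
  fixes B :: "('k::field, 'b, 'y) module_scheme" and p :: "('x, 'k) free_alg"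
  assumes B: "k_algebra B" and f: "f \<in> algebra_hom free_algebra B"
  shows "f p = free_eval B (\<lambda>x. f (free_gen x)) p"
proof -
  interpret B: k_algebra B by fact
  note l = algebra_homD(1)[OF f]
  have cl: "f q \<in> carrier B" for q :: "('x, 'k) free_alg" using algebra_homD(3)[OF f] by simp
  note h = B.free_eval_algebra_hom[of "\<lambda>x. f (free_gen x)", OF cl]
  note s = B.free_eval_simps[of "\<lambda>x. f (free_gen x)", OF cl]
  have word: "f (single (Monomial xs) 1) = free_eval B (\<lambda>x. f (free_gen x)) (single (Monomial xs) 1)" for xs
  proof (induction xs)
    case Nil
    have "single (Monomial []) 1 = (1 :: ('x, 'k) free_alg)"
      by (metis single_one zero_free_monoid_def)
    then show ?case using algebra_homD(5)[OF f] by (simp add: s)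
  next
    case (Cons x xs)
    have eq: "single (Monomial (x # xs)) 1
        = free_gen x * (single (Monomial xs) 1 :: ('x, 'k) free_alg)"
      by (simp add: free_gen_def mult_single plus_free_monoid_def)
    show ?case using Cons algebra_homD(4)[OF f, of "free_gen x" "single (Monomial xs) 1"]
      unfolding eq by (simp add: s)
  qed
  have single: "f (single w c) = free_eval B (\<lambda>x. f (free_gen x)) (single w c)" for w c
  proof -
    obtain xs where w: "w = Monomial xs" by (cases w)
    show ?thesis
      using linear_hom_smult[OF l, of "single (Monomial xs) 1" c]
        linear_hom_smult[OF algebra_homD(1)[OF h], of "single (Monomial xs) 1" c]
      by (simp add: word w)
  qed
  have "keys p \<subseteq> UNIV" by simp
  then show ?thesis
  proof (induction p rule: poly_mapping_restricted_induct)
    case zero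
    show ?case using single[of 0 0] by simp
  next
    case (add u v)
    then show ?case using linear_hom_add[OF l, of u v] by (simp add: s)
  qed (rule single)
qed

text \<open>
  The quotient map is itself an evaluation, namely at the generators.
\<close>

lemma presented_relation:
  assumes "r \<in> Rel"
  shows "free_eval (presented_algebra Rel) (presented_gen Rel) r = \<zero>\<^bsub>presented_algebra Rel\<^esub>"
proof -
  interpret k_quotient_algebra free_algebra "Idl\<^bsub>free_algebra\<^esub> Rel" by (rule presented_quotient)
  have "cls r = free_eval (presented_algebra Rel) (presented_gen Rel) r"
    using free_hom_ext[OF quotient_k_algebra cls_algebra_hom, of r]
    by (simp add: presented_algebra_def presented_gen_def[abs_def])
  moreover have "r \<in> Idl\<^bsub>free_algebra\<^esub> Rel"
    using ring.genideal_self[OF k_algebra_ring[OF k_algebra_free_algebra], of Rel] assms by auto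
  then have "cls r = cls 0" using cls_eq_iff[of r 0] by (simp add: a_minus_def minus_eq_smult)
  ultimately show ?thesis by (simp add: presented_algebra_def quotient_zero)
qed

section \<open>The algebras \<open>\<B>(E,F)\<close>\<close>

definition gens :: "'k::field^'m^'m \<Rightarrow> 'k^'n^'n \<Rightarrow> ('m \<times> 'n, 'k) free_alg set^'n^'m" where
  "gens E F = (\<chi> i j. bilin_gen E F i j)"

lemma k_algebra_bilin: "k_algebra (bilin_algebra E F)"
  unfolding bilin_algebra_def by (rule k_algebra_presented)

lemma k_algebra_quadratic: "k_algebra (quadratic_algebra M t)"
  unfolding quadratic_algebra_def by (rule k_algebra_presented)

lemma bilin_gen_closed [simp]: "bilin_gen E F i j \<in> carrier (bilin_algebra E F)"
  by (simp add: bilin_gen_def bilin_algebra_def presented_gen_closed)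

lemma quadratic_gen_closed [simp]: "quadratic_gen M t i \<in> carrier (quadratic_algebra M t)"
  by (simp add: quadratic_gen_def quadratic_algebra_def presented_gen_closed)

lemma gens_in: "mat_in (bilin_algebra E F) (gens E F)"
  by (simp add: mat_in_def gens_def)

lemma bilin_point_gens:
  assumes "invertible E" "invertible F"
  shows "bilin_point (bilin_algebra E F) E F (gens E F)"
proof -
  have "(\<lambda>(i, j). gens E F $ i $ j) = presented_gen (bilin_rels E F)"
    by (simp add: fun_eq_iff gens_def bilin_gen_def)
  then have "\<forall>r\<in>bilin_rels E F. free_eval (bilin_algebra E F) (\<lambda>(i, j). gens E F $ i $ j) r
      = \<zero>\<^bsub>bilin_algebra E F\<^esub>"
    using presented_relation[of _ "bilin_rels E F"] by (simp add: bilin_algebra_def)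
  then show ?thesis
    using k_algebra.bilin_rels_iff[OF k_algebra_bilin assms gens_in[of E F]] by blast
qed

lemma bilin_lift_props:
  assumes "invertible E" "invertible F" and A: "k_algebra A" and X: "bilin_point A E F X"
  shows bilin_lift_hom: "presented_lift A (\<lambda>(i, j). X $ i $ j) \<in> algebra_hom (bilin_algebra E F) A"
    and bilin_lift_gen: "presented_lift A (\<lambda>(i, j). X $ i $ j) (bilin_gen E F i j) = X $ i $ j"
proof -
  have cl: "(case x of (i, j) \<Rightarrow> X $ i $ j) \<in> carrier A" for x
    using X by (auto simp: bilin_point_def mat_in_def split: prod.split)
  have rel: "free_eval A (\<lambda>(i, j). X $ i $ j) r = \<zero>\<^bsub>A\<^esub>" if "r \<in> bilin_rels E F" for r
    using k_algebra.bilin_rels_iff[OF A assms(1,2)] X that by (auto simp: bilin_point_def)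
  note p = presented_lift_props[OF A cl rel]
  show "presented_lift A (\<lambda>(i, j). X $ i $ j) \<in> algebra_hom (bilin_algebra E F) A"
    unfolding bilin_algebra_def by (rule p(1))
  show "presented_lift A (\<lambda>(i, j). X $ i $ j) (bilin_gen E F i j) = X $ i $ j"
    unfolding bilin_gen_def using p(2)[where x = "(i, j)"] by simp
qed

lemma quadratic_gens:
  "form_map (quadratic_algebra M t) M (\<chi> i j. t) ((\<chi> i j. quadratic_gen M t j) :: _^_^1)"
  using k_algebra.quadratic_rels_iff[OF k_algebra_quadratic, of "quadratic_gen M t" M t M t]
    presented_relation[of _ "quadratic_rels M t"]
  by (simp add: quadratic_algebra_def quadratic_gen_def[abs_def] presented_gen_closed)

lemma quadratic_lift_props:
  assumes A: "k_algebra A" and cl: "\<And>i. x i \<in> carrier A"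
    and x: "form_map A M (\<chi> i j. t) ((\<chi> i j. x j) :: _^_^1)"
  shows quadratic_lift_hom: "presented_lift A x \<in> algebra_hom (quadratic_algebra M t) A"
    and quadratic_lift_gen: "presented_lift A x (quadratic_gen M t i) = x i"
proof -
  have rel: "free_eval A x r = \<zero>\<^bsub>A\<^esub>" if "r \<in> quadratic_rels M t" for r
    using k_algebra.quadratic_rels_iff[OF A, of x M t] cl x that by auto
  note p = presented_lift_props[OF A cl rel]
  show "presented_lift A x \<in> algebra_hom (quadratic_algebra M t) A"
    unfolding quadratic_algebra_def by (rule p(1))
  show "presented_lift A x (quadratic_gen M t i) = x i"
    unfolding quadratic_gen_def by (rule p(2))
qed

lemma form_map_hom:
  assumes A: "k_algebra A" "k_algebra B" and h: "h \<in> algebra_hom A B" and "mat_in A X" "form_map A P Q X"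
  shows "form_map B P Q (map_matrix h X)"
proof -
  interpret A: k_algebra A by fact
  note m = algebra_hom_matrix[OF A h]
  have "map_matrix h (mmul A (mmul A X (smat A P)) (transpose X)) = map_matrix h (smat A Q)"
    using assms by (simp add: form_map_def)
  then show ?thesis using assms(4)
    by (simp add: form_map_def m A.mat_in_simps flip: map_matrix_transpose)
qed

lemma bilin_point_hom:
  assumes A: "k_algebra A" "k_algebra B" and h: "h \<in> algebra_hom A B" and X: "bilin_point A E F X"
  shows "bilin_point B E F (map_matrix h X)"
proof -
  interpret A: k_algebra A by fact
  show ?thesis using X
    by (simp add: bilin_point_def algebra_hom_matrix(2)[OF A h] form_map_hom[OF A h] A.mat_in_simps
        flip: map_matrix_transpose)
qed

lemma bilin_induct [consumes 1, case_names one gen add smult]: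
  assumes X: "X \<in> carrier (bilin_algebra E F)"
    and one: "P \<one>\<^bsub>bilin_algebra E F\<^esub>"
    and gen: "\<And>i j Y. \<lbrakk>Y \<in> carrier (bilin_algebra E F); P Y\<rbrakk>
      \<Longrightarrow> P (bilin_gen E F i j \<otimes>\<^bsub>bilin_algebra E F\<^esub> Y)"
    and add: "\<And>Y Z. \<lbrakk>Y \<in> carrier (bilin_algebra E F); Z \<in> carrier (bilin_algebra E F); P Y; P Z\<rbrakk>
      \<Longrightarrow> P (Y \<oplus>\<^bsub>bilin_algebra E F\<^esub> Z)"
    and smult: "\<And>c Y. \<lbrakk>Y \<in> carrier (bilin_algebra E F); P Y\<rbrakk> \<Longrightarrow> P (c \<odot>\<^bsub>bilin_algebra E F\<^esub> Y)"
  shows "P X"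
  using assms unfolding bilin_algebra_def bilin_gen_def
  by (induction X rule: presented_induct) (auto split: prod.splits)

lemma quadratic_induct [consumes 1, case_names one gen add smult]:
  assumes X: "X \<in> carrier (quadratic_algebra M t)"
    and one: "P \<one>\<^bsub>quadratic_algebra M t\<^esub>"
    and gen: "\<And>i Y. \<lbrakk>Y \<in> carrier (quadratic_algebra M t); P Y\<rbrakk>
      \<Longrightarrow> P (quadratic_gen M t i \<otimes>\<^bsub>quadratic_algebra M t\<^esub> Y)"
    and add: "\<And>Y Z. \<lbrakk>Y \<in> carrier (quadratic_algebra M t); Z \<in> carrier (quadratic_algebra M t); P Y; P Z\<rbrakk>
      \<Longrightarrow> P (Y \<oplus>\<^bsub>quadratic_algebra M t\<^esub> Z)"
    and smult: "\<And>c Y. \<lbrakk>Y \<in> carrier (quadratic_algebra M t); P Y\<rbrakk> \<Longrightarrow> P (c \<odot>\<^bsub>quadratic_algebra M t\<^esub> Y)"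
  shows "P X"
  using assms unfolding quadratic_algebra_def quadratic_gen_def
  by (induction X rule: presented_induct) auto

lemma bilin_hom_eqI:
  assumes "f \<in> algebra_hom (bilin_algebra E F) B" "g \<in> algebra_hom (bilin_algebra E F) B"
    and "\<And>i j. f (bilin_gen E F i j) = g (bilin_gen E F i j)" "X \<in> carrier (bilin_algebra E F)"
  shows "f X = g X"
  using algebra_hom_eqI[of f "bilin_rels E F" B g X] assms
  by (simp add: bilin_algebra_def bilin_gen_def split_paired_all)

lemma quadratic_hom_eqI:
  assumes "f \<in> algebra_hom (quadratic_algebra M t) B" "g \<in> algebra_hom (quadratic_algebra M t) B"
    and "\<And>i. f (quadratic_gen M t i) = g (quadratic_gen M t i)" "X \<in> carrier (quadratic_algebra M t)"
  shows "f X = g X"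
  using algebra_hom_eqI[of f "quadratic_rels M t" B g X] assms
  by (simp add: quadratic_algebra_def quadratic_gen_def)

context k_tensor_algebra
begin

lemma left_inclusion: "(\<lambda>a. a \<otimes>\<^sub>t \<one>\<^bsub>B\<^esub>) \<in> algebra_hom A (tensor A B)"
  by (rule algebra_homI) (simp_all add: bilinear_homD(2)[OF pure_bilinear] pure_mult tensor_one)

lemma right_inclusion: "(\<lambda>b. \<one>\<^bsub>A\<^esub> \<otimes>\<^sub>t b) \<in> algebra_hom B (tensor A B)"
  by (rule algebra_homI) (simp_all add: bilinear_homD(1)[OF pure_bilinear] pure_mult tensor_one)

definition tmul :: "'a^'n^'m \<Rightarrow> 'b^'p^'n \<Rightarrow> ('a, 'b, 'k) tensor^'p^'m" where
  "tmul X Y = (\<chi> i j. \<Oplus>\<^bsub>tensor A B\<^esub>k\<in>UNIV. (X $ i $ k) \<otimes>\<^sub>t (Y $ k $ j))"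

lemma tmul_mmul:
  assumes "mat_in A X" "mat_in B Y"
  shows "tmul X Y = mmul (tensor A B) (map_matrix (\<lambda>a. a \<otimes>\<^sub>t \<one>\<^bsub>B\<^esub>) X) (map_matrix (\<lambda>b. \<one>\<^bsub>A\<^esub> \<otimes>\<^sub>t b) Y)"
  using assms by (simp add: tmul_def mmul_def pure_mult mat_in_def)

lemma tmul_commute:
  assumes "mat_in A X" "mat_in B Y"
  shows "map_matrix (\<lambda>a. a \<otimes>\<^sub>t \<one>\<^bsub>B\<^esub>) X $ i $ k \<otimes>\<^bsub>tensor A B\<^esub> map_matrix (\<lambda>b. \<one>\<^bsub>A\<^esub> \<otimes>\<^sub>t b) Y $ l $ j
    = map_matrix (\<lambda>b. \<one>\<^bsub>A\<^esub> \<otimes>\<^sub>t b) Y $ l $ j \<otimes>\<^bsub>tensor A B\<^esub> map_matrix (\<lambda>a. a \<otimes>\<^sub>t \<one>\<^bsub>B\<^esub>) X $ i $ k"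
  using assms by (simp add: pure_mult mat_in_def)

text \<open>
  The entries of \<open>X \<otimes> 1\<close> commute with those of \<open>1 \<otimes> Y\<close>, so that points can be composed.
\<close>

lemma tmul_bilin_point:
  assumes "bilin_point A E F X" "bilin_point B F G Y"
  shows "bilin_point (tensor A B) E G (tmul X Y)"
proof -
  interpret T: k_algebra "tensor A B" by (rule k_algebra_tensor)
  have cl: "mat_in A X" "mat_in B Y" using assms by (auto simp: bilin_point_def)
  show ?thesis unfolding tmul_mmul[OF cl]
    by (rule T.bilin_point_comp[OF bilin_point_hom[OF _ _ left_inclusion assms(1)]
          bilin_point_hom[OF _ _ right_inclusion assms(2)] tmul_commute[OF cl]])
      (intro A.k_algebra_axioms B.k_algebra_axioms k_algebra_tensor)+
qed

lemma tmul_form_map: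
  assumes "mat_in A X" "mat_in B Y" "form_map A P Q X" "form_map B R P Y"
  shows "form_map (tensor A B) R Q (tmul X Y)"
proof -
  interpret T: k_algebra "tensor A B" by (rule k_algebra_tensor)
  show ?thesis unfolding tmul_mmul[OF assms(1,2)]
    by (rule T.form_map_comp[OF _ _ form_map_hom[OF _ _ left_inclusion assms(1,3)]
          form_map_hom[OF _ _ right_inclusion assms(2,4)] tmul_commute[OF assms(1,2)]])
      (intro A.k_algebra_axioms B.k_algebra_axioms k_algebra_tensor
        algebra_hom_matrix(2)[OF _ _ left_inclusion assms(1)]
        algebra_hom_matrix(2)[OF _ _ right_inclusion assms(2)])+
qed

end

lemma bilin_delta_props:
  fixes E :: "'k::field^'m^'m" and F :: "'k^'n^'n" and G :: "'k^'p^'p"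
  assumes "invertible E" "invertible F" "invertible G"
  shows bilin_delta_hom: "bilin_delta E F G \<in> algebra_hom (bilin_algebra E G) (tensor (bilin_algebra E F) (bilin_algebra F G))"
    and bilin_delta_gen: "bilin_delta E F G (bilin_gen E G i j)
      = (\<Oplus>\<^bsub>tensor (bilin_algebra E F) (bilin_algebra F G)\<^esub>k\<in>UNIV.
          pure_tensor (bilin_algebra E F) (bilin_algebra F G) (bilin_gen E F i k) (bilin_gen F G k j))"
proof -
  interpret k_tensor_algebra "bilin_algebra E F" "bilin_algebra F G"
    by (intro k_tensor_algebra.intro k_algebra_bilin)
  have eq: "bilin_delta E F G = presented_lift (tensor (bilin_algebra E F) (bilin_algebra F G))
      (\<lambda>(i, j). tmul (gens E F) (gens F G) $ i $ j)"
    by (simp add: bilin_delta_def tmul_def gens_def)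
  note p = tmul_bilin_point[OF bilin_point_gens[OF assms(1,2)] bilin_point_gens[OF assms(2,3)]]
  show "bilin_delta E F G \<in> algebra_hom (bilin_algebra E G) (tensor (bilin_algebra E F) (bilin_algebra F G))"
    unfolding eq by (rule bilin_lift_hom[OF assms(1,3) k_algebra_tensor p])
  show "bilin_delta E F G (bilin_gen E G i j)
      = (\<Oplus>\<^bsub>tensor (bilin_algebra E F) (bilin_algebra F G)\<^esub>k\<in>UNIV.
          pure_tensor (bilin_algebra E F) (bilin_algebra F G) (bilin_gen E F i k) (bilin_gen F G k j))"
    unfolding eq bilin_lift_gen[OF assms(1,3) k_algebra_tensor p] by (simp add: tmul_def gens_def)
qed

text \<open>The coaction \<open>x\<^sub>i \<mapsto> \<Sum>\<^sub>k x\<^sub>k \<otimes> a\<^sub>k\<^sub>i\<close> makes sense with two different forms.\<close>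

definition quad_delta ::
  "'k::field^'m^'m \<Rightarrow> 'k^'n^'n \<Rightarrow> 'k \<Rightarrow> ('n, 'k) free_alg set
    \<Rightarrow> (('m, 'k) free_alg set, ('m \<times> 'n, 'k) free_alg set, 'k) tensor" where
  "quad_delta E F t = presented_lift (tensor (quadratic_algebra (matrix_inv E) t) (bilin_algebra E F))
     (\<lambda>i. \<Oplus>\<^bsub>tensor (quadratic_algebra (matrix_inv E) t) (bilin_algebra E F)\<^esub>k\<in>UNIV.
        pure_tensor (quadratic_algebra (matrix_inv E) t) (bilin_algebra E F)
          (quadratic_gen (matrix_inv E) t k) (bilin_gen E F k i))"

lemma quad_delta_props:
  fixes E :: "'k::field^'m^'m" and F :: "'k^'n^'n"
  assumes "invertible E" "invertible F"
  shows quad_delta_hom: "quad_delta E F t \<in> algebra_hom (quadratic_algebra (matrix_inv F) t)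
      (tensor (quadratic_algebra (matrix_inv E) t) (bilin_algebra E F))"
    and quad_delta_gen: "quad_delta E F t (quadratic_gen (matrix_inv F) t i)
      = (\<Oplus>\<^bsub>tensor (quadratic_algebra (matrix_inv E) t) (bilin_algebra E F)\<^esub>k\<in>UNIV.
        pure_tensor (quadratic_algebra (matrix_inv E) t) (bilin_algebra E F)
          (quadratic_gen (matrix_inv E) t k) (bilin_gen E F k i))"
proof -
  let ?A = "quadratic_algebra (matrix_inv E) t" and ?B = "bilin_algebra E F"
  interpret k_tensor_algebra ?A ?B
    by (intro k_tensor_algebra.intro k_algebra_bilin k_algebra_quadratic)
  interpret T: k_algebra "tensor ?A ?B" by (rule k_algebra_tensor)
  let ?x = "(\<chi> i j. quadratic_gen (matrix_inv E) t j) :: _^'m^1"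
  let ?y = "\<lambda>i. \<Oplus>\<^bsub>tensor ?A ?B\<^esub>k\<in>UNIV. pure_tensor ?A ?B (quadratic_gen (matrix_inv E) t k) (bilin_gen E F k i)"
  have x: "mat_in ?A ?x" by (simp add: mat_in_def)
  have "form_map (tensor ?A ?B) (matrix_inv F) (\<chi> i j. t) (tmul ?x (gens E F))"
    using bilin_point_gens[OF assms]
    by (intro tmul_form_map[OF x gens_in quadratic_gens]) (simp add: bilin_point_def)
  moreover have "tmul ?x (gens E F) = (\<chi> i j. ?y j)"
    by (simp add: tmul_def gens_def vec_eq_iff)
  ultimately have y: "form_map (tensor ?A ?B) (matrix_inv F) (\<chi> i j. t) ((\<chi> i j. ?y j) :: _^'n^1)"
    by simp
  have cl: "?y i \<in> carrier (tensor ?A ?B)" for i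
    by (intro T.M.finsum_closed) auto
  note p = quadratic_lift_props[OF k_algebra_tensor cl y]
  show "quad_delta E F t \<in> algebra_hom (quadratic_algebra (matrix_inv F) t) (tensor ?A ?B)"
    unfolding quad_delta_def by (rule p(1))
  show "quad_delta E F t (quadratic_gen (matrix_inv F) t i) = ?y i"
    unfolding quad_delta_def by (rule p(2))
qed

section \<open>The antipode\<close>

definition opposite_algebra :: "('k::field, 'a, 'x) module_scheme \<Rightarrow> ('k, 'a, 'x) module_scheme" where
  "opposite_algebra A = A\<lparr>mult := \<lambda>x y. y \<otimes>\<^bsub>A\<^esub> x\<rparr>"

lemma opposite_algebra_simps [simp]:
  "carrier (opposite_algebra A) = carrier A" "\<one>\<^bsub>opposite_algebra A\<^esub> = \<one>\<^bsub>A\<^esub>"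
  "\<zero>\<^bsub>opposite_algebra A\<^esub> = \<zero>\<^bsub>A\<^esub>" "x \<oplus>\<^bsub>opposite_algebra A\<^esub> y = x \<oplus>\<^bsub>A\<^esub> y"
  "x \<otimes>\<^bsub>opposite_algebra A\<^esub> y = y \<otimes>\<^bsub>A\<^esub> x" "c \<odot>\<^bsub>opposite_algebra A\<^esub> x = c \<odot>\<^bsub>A\<^esub> x"
  "finsum (opposite_algebra A) = finsum A"
  by (simp_all add: opposite_algebra_def finsum_def)

text \<open>
  \<open>F\<^sup>-\<^sup>1 X\<^sup>t E\<close>, which is inverse to \<open>X\<close> by the defining relations.
\<close>

definition antipode_matrix :: "('k::field, 'a, 'x) module_scheme \<Rightarrow> 'k^'m^'m \<Rightarrow> 'k^'n^'n \<Rightarrow> 'a^'n^'m \<Rightarrow> 'a^'m^'n" where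
  "antipode_matrix A E F X = mmul A (mmul A (smat A (matrix_inv F)) (transpose X)) (smat A E)"

lemma matrix_inv_transpose:
  assumes "invertible (M :: 'k::field^'n^'n)"
  shows "transpose M ** transpose (matrix_inv M) = mat 1" "transpose (matrix_inv M) ** transpose M = mat 1"
  using matrix_inv_inverse[OF assms] by (simp_all add: transpose_mat flip: matrix_transpose_mul)

context k_algebra
begin

lemma k_algebra_opposite: "k_algebra (opposite_algebra A)"
proof (rule k_algebraI)
  show "k_vector_space (opposite_algebra A)"
    by (rule k_vector_spaceI) (simp_all add: smult_add_left smult_add_right smult_smult M.a_ac)
qed (simp_all add: A.m_assoc A.l_distr A.r_distr smult_mult_left smult_mult_right)

lemma mmul_opposite: "mmul (opposite_algebra A) X Y = transpose (mmul A (transpose Y) (transpose X))"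
  by (simp add: mmul_def transpose_def)

lemma smat_opposite: "smat (opposite_algebra A) M = smat A M"
  by (simp add: smat_def)

context
  fixes E :: "'k^'m^'m" and F :: "'k^'n^'n" and X
  assumes E: "invertible E" and F: "invertible F" and X: "bilin_point A E F X"
begin

lemma antipode_matrix_in: "mat_in A (antipode_matrix A E F X)"
  using X by (simp add: antipode_matrix_def bilin_point_def)

lemma antipode_mult:
  "mmul A (antipode_matrix A E F X) X = smat A (mat 1)"
  "mmul A X (antipode_matrix A E F X) = smat A (mat 1)"
proof -
  have X': "mat_in A X" "mmul A (mmul A (transpose X) (smat A E)) X = smat A F"
    "mmul A (mmul A X (smat A (matrix_inv F))) (transpose X) = smat A (matrix_inv E)"
    using X by (simp_all add: bilin_point_def form_map_def)
  have "mmul A (antipode_matrix A E F X) X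
      = mmul A (smat A (matrix_inv F)) (mmul A (mmul A (transpose X) (smat A E)) X)"
    using X'(1) by (simp add: antipode_matrix_def mmul_assoc)
  then show "mmul A (antipode_matrix A E F X) X = smat A (mat 1)"
    using X' F by (simp add: mmul_smat matrix_inv_inverse)
  have "mmul A X (antipode_matrix A E F X)
      = mmul A (mmul A (mmul A X (smat A (matrix_inv F))) (transpose X)) (smat A E)"
    using X'(1) by (simp add: antipode_matrix_def mmul_assoc)
  then show "mmul A X (antipode_matrix A E F X) = smat A (mat 1)"
    using X' E by (simp add: mmul_smat matrix_inv_inverse)
qed

text \<open>
  The products in the opposite algebra are transposed products of transposed matrices; in these
  terms the claim is \<open>Z\<^sup>t F\<^sup>t Z = E\<^sup>t\<close> and \<open>Z E\<^sup>-\<^sup>t Z\<^sup>t = F\<^sup>-\<^sup>t\<close> for \<open>Z = F\<^sup>-\<^sup>1 X\<^sup>t E\<close>, where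
  \<open>Z\<^sup>t = E\<^sup>t X F\<^sup>-\<^sup>t\<close> because \<open>E\<close> and \<open>F\<close> are scalar.  Both follow from \<open>X Z = 1\<close> and \<open>Z X = 1\<close>.
\<close>

lemma antipode_point: "bilin_point (opposite_algebra A) F E (antipode_matrix A E F X)"
proof -
  let ?S = "antipode_matrix A E F X"
  have X': "mat_in A X" "mmul A (mmul A (transpose X) (smat A E)) X = smat A F"
    "mmul A (mmul A X (smat A (matrix_inv F))) (transpose X) = smat A (matrix_inv E)"
    using X by (simp_all add: bilin_point_def form_map_def)
  have St: "transpose ?S = mmul A (mmul A (smat A (transpose E)) X) (smat A (transpose (matrix_inv F)))"
    using X'(1) by (simp add: antipode_matrix_def transpose_mmul_smat mmul_assoc)
  have cancelF: "mmul A (smat A (transpose (matrix_inv F))) (mmul A (smat A (transpose F)) Z) = Z"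
    if "mat_in A Z" for Z :: "'a^'q^'n"
    using that F by (simp add: mmul_assoc[symmetric] mmul_smat matrix_inv_transpose mmul_one_left)
  have cancelE: "mmul A (smat A E) (mmul A (smat A (matrix_inv E)) Z) = Z"
    "mmul A (smat A (transpose (matrix_inv E))) (mmul A (smat A (transpose E)) Z) = Z"
    if "mat_in A Z" for Z :: "'a^'q^'m"
    using that E by (simp_all add: mmul_assoc[symmetric] mmul_smat matrix_inv_inverse matrix_inv_transpose mmul_one_left)
  have "mmul A (transpose ?S) (mmul A (smat A (transpose F)) ?S)
      = mmul A (mmul A (smat A (transpose E)) X) (mmul A (smat A (transpose (matrix_inv F))) (mmul A (smat A (transpose F)) ?S))"
    using X'(1) antipode_matrix_in by (simp add: St mmul_assoc)
  also have "\<dots> = mmul A (smat A (transpose E)) (mmul A X ?S)"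
    using X'(1) antipode_matrix_in by (simp add: cancelF mmul_assoc)
  also have "\<dots> = smat A (transpose E)"
    using antipode_mult(2) by (simp add: mmul_smat)
  finally have 1: "mmul A (transpose ?S) (mmul A (smat A (transpose F)) ?S) = smat A (transpose E)" .
  have "mmul A ?S (mmul A (smat A (transpose (matrix_inv E))) (transpose ?S))
      = mmul A ?S (mmul A (smat A (transpose (matrix_inv E))) (mmul A (smat A (transpose E))
          (mmul A X (smat A (transpose (matrix_inv F))))))"
    using X'(1) by (simp add: St mmul_assoc)
  also have "\<dots> = mmul A (mmul A ?S X) (smat A (transpose (matrix_inv F)))"
    using X'(1) antipode_matrix_in by (simp add: cancelE mmul_assoc)
  also have "\<dots> = smat A (transpose (matrix_inv F))"
    using antipode_mult(1) by (simp add: mmul_smat)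
  finally have 2: "mmul A ?S (mmul A (smat A (transpose (matrix_inv E))) (transpose ?S))
    = smat A (transpose (matrix_inv F))" .
  show ?thesis
    using antipode_matrix_in
    by (simp add: bilin_point_def form_map_def mmul_opposite smat_opposite 1 2)
      (simp add: mat_in_def)
qed

end

end

definition antipode :: "'k::field^'m^'m \<Rightarrow> 'k^'n^'n \<Rightarrow> ('n \<times> 'm, 'k) free_alg set \<Rightarrow> ('m \<times> 'n, 'k) free_alg set" where
  "antipode E F = presented_lift (opposite_algebra (bilin_algebra E F))
     (\<lambda>(i, j). antipode_matrix (bilin_algebra E F) E F (gens E F) $ i $ j)"

lemma antipode_props:
  fixes E :: "'k::field^'m^'m" and F :: "'k^'n^'n"
  assumes "invertible E" "invertible F"
  shows antipode_hom: "antipode E F \<in> algebra_hom (bilin_algebra F E) (opposite_algebra (bilin_algebra E F))"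
    and antipode_closed: "y \<in> carrier (bilin_algebra F E) \<Longrightarrow> antipode E F y \<in> carrier (bilin_algebra E F)"
    and antipode_gen_left: "(\<Oplus>\<^bsub>bilin_algebra E F\<^esub>k\<in>UNIV. antipode E F (bilin_gen F E i k) \<otimes>\<^bsub>bilin_algebra E F\<^esub> bilin_gen E F k j)
      = (if i = j then 1 else 0) \<odot>\<^bsub>bilin_algebra E F\<^esub> \<one>\<^bsub>bilin_algebra E F\<^esub>"
proof -
  interpret B: k_algebra "bilin_algebra E F" by (rule k_algebra_bilin)
  note p = B.antipode_point[OF assms bilin_point_gens[OF assms]]
  show h: "antipode E F \<in> algebra_hom (bilin_algebra F E) (opposite_algebra (bilin_algebra E F))"
    unfolding antipode_def by (rule bilin_lift_hom[OF assms(2,1) B.k_algebra_opposite p])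
  show "y \<in> carrier (bilin_algebra F E) \<Longrightarrow> antipode E F y \<in> carrier (bilin_algebra E F)"
    using algebra_homD(3)[OF h] by simp
  have g: "antipode E F (bilin_gen F E i k) = antipode_matrix (bilin_algebra E F) E F (gens E F) $ i $ k" for i k
    unfolding antipode_def by (rule bilin_lift_gen[OF assms(2,1) B.k_algebra_opposite p])
  show "(\<Oplus>\<^bsub>bilin_algebra E F\<^esub>k\<in>UNIV. antipode E F (bilin_gen F E i k) \<otimes>\<^bsub>bilin_algebra E F\<^esub> bilin_gen E F k j)
      = (if i = j then 1 else 0) \<odot>\<^bsub>bilin_algebra E F\<^esub> \<one>\<^bsub>bilin_algebra E F\<^esub>"
    using arg_cong[OF B.antipode_mult(1)[OF assms bilin_point_gens[OF assms]], of "\<lambda>M. M $ i $ j"]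
    by (simp add: mmul_def smat_def g gens_def mat_def)
qed

section \<open>A ladder of representations\<close>

definition cst :: "'k::field \<Rightarrow> 'k poly" where "cst c = [:c:]"

lemma cst_simps: "cst (a + b) = cst a + cst b" "cst (a - b) = cst a - cst b" "cst (a * b) = cst a * cst b"
  "cst (- a) = - cst a"
  by (simp_all add: cst_def)

lemma cst_0_1 [simp]: "cst 0 = 0" "cst 1 = 1"
  by (simp_all add: cst_def one_pCons)

lemma const_sum: "cst (\<Sum>i\<in>I. c i) = (\<Sum>i\<in>I. cst (c i))"
  by (induction I rule: infinite_finite_induct) (simp_all add: cst_simps)

lemma cst_inverse: "c \<noteq> 0 \<Longrightarrow> cst c * (cst (inverse c) * a) = a" "c \<noteq> 0 \<Longrightarrow> cst (inverse c) * (cst c * a) = a"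
  by (simp_all add: cst_def)

text \<open>
  The operators below act on \<open>'k poly\<close>.  Scalars are written as constant polynomials \<open>cst c\<close>, kept
  folded in order that the simplifier does not turn products with them into \<open>Polynomial.smult\<close>.
\<close>

definition linear_op :: "('k::field poly \<Rightarrow> 'k poly) \<Rightarrow> bool" where
  "linear_op f \<longleftrightarrow> (\<forall>a b. f (a + b) = f a + f b) \<and> (\<forall>c a. f (cst (c) * a) = cst (c) * f a)"

lemma linear_op_sum:
  assumes "linear_op f" "finite I"
  shows "f (\<Sum>i\<in>I. cst (c i) * b i) = (\<Sum>i\<in>I. cst (c i) * f (b i))"
  using assms(2)
proof (induction I rule: finite_induct)
  case empty
  have "f (cst (0) * 0) = cst (0) * f 0" using assms(1) unfolding linear_op_def by blast
  then show ?case by simp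
next
  case (insert i I)
  then show ?case using assms(1) by (simp add: linear_op_def)
qed

lemma linear_op_simps:
  assumes "linear_op f"
  shows "f 0 = 0" "f (a + b) = f a + f b" "f (a - b) = f a - f b" "f (cst (c) * a) = cst (c) * f a"
proof -
  show "f 0 = 0" using linear_op_sum[OF assms, of "{}"] by simp
  show "f (a + b) = f a + f b" "f (cst (c) * a) = cst (c) * f a" using assms by (auto simp: linear_op_def)
  have "f (a + cst (-1) * b) = f a + cst (-1) * f b" using assms unfolding linear_op_def by presburger
  then show "f (a - b) = f a - f b" by (simp add: cst_simps)
qed

definition contract :: "'k::field^'m^'m \<Rightarrow> ('m \<Rightarrow> 'm \<Rightarrow> 'k poly) \<Rightarrow> 'k poly" where
  "contract E f = (\<Sum>p\<in>UNIV. cst (E $ fst p $ snd p) * f (fst p) (snd p))"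

lemma contract_double: "contract E f = (\<Sum>i\<in>UNIV. \<Sum>j\<in>UNIV. cst (E $ i $ j) * f i j)"
  unfolding contract_def UNIV_Times_UNIV[symmetric] sum.cartesian_product by (simp add: case_prod_beta)

lemma contract_simps:
  "contract E (\<lambda>i j. f i j + g i j) = contract E f + contract E g"
  "contract E (\<lambda>i j. f i j - g i j) = contract E f - contract E g"
  "contract E (\<lambda>i j. a * f i j) = a * contract E f"
  "contract E (\<lambda>i j. 0) = 0"
  by (simp_all add: contract_def ring_distribs sum.distrib sum_subtractf sum_distrib_left mult.left_commute)

text \<open>
  The operators \<open>u0\<close> and \<open>v0\<close> go between the spaces \<open>X\<^sub>0\<close> and \<open>X\<^sub>-\<^sub>1\<close> of the ladder, which are both taken
  to be \<open>'k poly\<close>.  For \<open>d \<ge> 0\<close> the space \<open>X\<^sub>d\<^sub>+\<^sub>1 \<subseteq> k\<^sup>m \<otimes> X\<^sub>d\<close> is realised inside the functions on words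
  of length \<open>d + 1\<close>; a function \<open>x\<close> on all words is the family of its restrictions to the words of each
  length.  The inclusion into \<open>k\<^sup>m \<otimes> X\<^sub>d\<close> is \<open>u\<close>, hence \<open>u\<^sub>k\<close> is the shift \<open>x \<mapsto> (\<lambda>w. x (k # w))\<close>, which
  in degree 0 continues as \<open>u0 k (x [])\<close>.
\<close>

locale ladder =
  fixes E :: "'k::field^'m^'m" and \<beta> :: 'k and u0 v0 :: "'m \<Rightarrow> 'k poly \<Rightarrow> 'k poly"
  assumes inv: "invertible E"
    and \<beta>: "\<beta> \<noteq> 0" and trace: "(\<Sum>i\<in>UNIV. \<Sum>j\<in>UNIV. E $ i $ j * matrix_inv E $ i $ j) = \<beta> + inverse \<beta>"
    and lin_u: "linear_op (u0 k)" and lin_v: "linear_op (v0 k)"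
    and base_uv: "contract E (\<lambda>i j. u0 i (v0 j b)) = b"
    and base_vu: "contract E (\<lambda>i j. v0 i (u0 j b)) = cst (\<beta>) * b"
begin

abbreviation "P \<equiv> matrix_inv E"

lemma contract_inv_right: "contract E (\<lambda>i j. cst (P $ j $ k) * a i) = a k"
proof -
  have "contract E (\<lambda>i j. cst (P $ j $ k) * a i) = (\<Sum>i\<in>UNIV. cst ((E ** P) $ i $ k) * a i)"
    by (simp add: contract_double matrix_matrix_mult_def const_sum sum_distrib_right cst_simps mult.assoc)
  also have "\<dots> = a k"
    by (simp add: matrix_inv_inverse[OF inv] mat_def if_distrib[of cst] if_distrib[of "\<lambda>c. c * _"] sum.delta cong: if_cong)
  finally show ?thesis .
qed

lemma contract_inv_left: "contract E (\<lambda>i j. cst (P $ k $ i) * a j) = a k"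
proof -
  have "contract E (\<lambda>i j. cst (P $ k $ i) * a j) = (\<Sum>j\<in>UNIV. cst ((P ** E) $ k $ j) * a j)"
    unfolding contract_double by (subst sum.swap)
      (simp add: matrix_matrix_mult_def const_sum sum_distrib_right sum_distrib_left cst_simps mult_ac)
  also have "\<dots> = a k"
    by (simp add: matrix_inv_inverse[OF inv] mat_def if_distrib[of cst] if_distrib[of "\<lambda>c. c * _"] sum.delta cong: if_cong)
  finally show ?thesis .
qed

text \<open>
  \<open>V w k x b\<close> is the value at \<open>w\<close> of \<open>v\<^sub>k x\<close>, where \<open>b\<close> is the component of degree \<open>-1\<close>.  Since \<open>u\<^sub>i\<close> is
  the shift, the relation \<open>\<beta>\<^sup>-\<^sup>1 u\<^sub>i v\<^sub>k + v\<^sub>i u\<^sub>k = (E\<^sup>-\<^sup>1)\<^sub>i\<^sub>k\<close> leaves no choice.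
\<close>

primrec V :: "'m list \<Rightarrow> 'm \<Rightarrow> ('m list \<Rightarrow> 'k poly) \<Rightarrow> 'k poly \<Rightarrow> 'k poly" where
  "V [] k x b = v0 k b"
| "V (i # w) k x b = cst (\<beta>) * (cst (P $ i $ k) * x w - V w i (\<lambda>w. x (k # w)) (u0 k (x [])))"

lemma V_add: "V w k (\<lambda>w. x w + y w) (a + b) = V w k x a + V w k y b"
  by (induction w arbitrary: k x y a b)
    (simp_all add: linear_op_simps[OF lin_v] linear_op_simps[OF lin_u] algebra_simps)

lemma V_scale: "V w k (\<lambda>w. cst (c) * x w) (cst (c) * b) = cst (c) * V w k x b"
  by (induction w arbitrary: k x b)
    (simp_all add: linear_op_simps(4)[OF lin_v] linear_op_simps(4)[OF lin_u] right_diff_distrib mult.left_commute)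

lemma V_zero: "V w k (\<lambda>w. 0) 0 = 0"
  using V_scale[of w k 0 "\<lambda>w. 0" 0] by simp

lemma V_sum: "finite I \<Longrightarrow> V w k (\<lambda>w. \<Sum>i\<in>I. cst (c i) * x i w) (\<Sum>i\<in>I. cst (c i) * b i) = (\<Sum>i\<in>I. cst (c i) * V w k (x i) (b i))"
  by (induction I rule: finite_induct) (simp_all only: sum.empty sum.insert V_zero V_add V_scale if_False not_False_eq_True simp_thms)

lemma V_contract: "V w k (\<lambda>w. contract E (\<lambda>i j. x i j w)) (contract E b) = contract E (\<lambda>i j. V w k (x i j) (b i j))"
  unfolding contract_def by (rule V_sum) simp

text \<open>
  \<open>E(u,u) = 0\<close>, in positive degrees and at the step from degree 1 to degree \<open>-1\<close>.  Requiring this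
  after every shift (\<open>stable\<close>) describes the kernels \<open>X\<^sub>d\<^sub>+\<^sub>1\<close>.
\<close>

definition cond where
  "cond x \<longleftrightarrow> (\<forall>w. contract E (\<lambda>i j. x (j # i # w)) = 0) \<and> contract E (\<lambda>i j. u0 i (x [j])) = 0"

text \<open>
  \<open>E(v,u) = \<beta>\<close>: by the recursion for \<open>V\<close> the contraction is \<open>\<beta> x\<close> minus a term in which \<open>E(u,u)\<close>
  appears.
\<close>

lemma contract_VS:
  assumes "cond x"
  shows "contract E (\<lambda>i j. V w i (\<lambda>w. x (j # w)) (u0 j (x []))) = cst (\<beta>) * x w"
proof (cases w)
  case Nil
  then show ?thesis using base_vu by simp
next
  case (Cons k w')
  have "contract E (\<lambda>i j. V w' k (\<lambda>w. x (j # i # w)) (u0 i (x [j])))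
      = V w' k (\<lambda>w. contract E (\<lambda>i j. x (j # i # w))) (contract E (\<lambda>i j. u0 i (x [j])))"
    by (simp add: V_contract)
  also have "\<dots> = 0" using assms by (simp add: cond_def V_zero)
  finally show ?thesis
    by (simp add: Cons contract_simps contract_inv_left)
qed

text \<open>
  \<open>E(u,v) = 1\<close>: contracting the recursion gives \<open>\<beta> (\<tau> - \<beta>) = 1\<close> times \<open>x\<close>, where \<open>\<tau> = \<beta> + \<beta>\<^sup>-\<^sup>1\<close> is the
  trace.
\<close>

lemma contract_SV:
  assumes "cond x"
  shows "contract E (\<lambda>i j. V (i # w) j x b) = x w"
proof -
  have "contract E (\<lambda>i j. cst (P $ i $ j) * x w) = cst (\<beta> + inverse \<beta>) * x w"
    by (simp add: contract_double trace[symmetric] const_sum sum_distrib_right cst_simps mult.assoc)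
  then have "contract E (\<lambda>i j. V (i # w) j x b) = cst \<beta> * ((cst \<beta> + cst (inverse \<beta>)) * x w - cst \<beta> * x w)"
    by (simp add: contract_simps contract_VS[OF assms] cst_simps)
  then show ?thesis using \<beta> by (simp add: ring_distribs cst_inverse)
qed

text \<open>
  \<open>E(v,v) = 0\<close>.  Here \<open>bb\<close> stands for the component of degree \<open>-1\<close> of \<open>v\<^sub>j\<close> applied to the element, so
  that the assumption on it is the case of degree 0.
\<close>

lemma contract_VV:
  assumes "cond x" and "contract E (\<lambda>i j. v0 i (bb j)) = 0"
  shows "contract E (\<lambda>i j. V w i (\<lambda>w. V w j x b) (bb j)) = 0"
proof (cases w)
  case Nil
  then show ?thesis using assms by simp
next
  case (Cons k w')
  have "contract E (\<lambda>i j. V w' k (\<lambda>w. V (i # w) j x b) (u0 i (V [] j x b)))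
     = V w' k x b"
    unfolding V_contract[symmetric] contract_SV[OF assms(1)] using base_uv by simp
  then show ?thesis
    by (simp add: Cons contract_simps contract_inv_left V.simps(2))
qed

definition stable where "stable x \<longleftrightarrow> (\<forall>p. cond (\<lambda>w. x (p @ w)))"

lemma stable_cond: "stable x \<Longrightarrow> cond x"
  unfolding stable_def by (drule spec[of _ "[]"]) simp

lemma stable_shift: "stable x \<Longrightarrow> stable (\<lambda>w. x (k # w))"
  unfolding stable_def
proof
  fix p assume "\<forall>p. cond (\<lambda>w. x (p @ w))"
  from spec[OF this, of "k # p"] show "cond (\<lambda>w. x (k # p @ w))" by simp
qed

lemma cond_add: "cond x \<Longrightarrow> cond y \<Longrightarrow> cond (\<lambda>w. x w + y w)"
  by (simp add: cond_def contract_simps linear_op_simps[OF lin_u])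

lemma cond_scale: "cond x \<Longrightarrow> cond (\<lambda>w. cst (c) * x w)"
  by (simp add: cond_def contract_simps linear_op_simps(4)[OF lin_u])

lemma cond_diff: "cond x \<Longrightarrow> cond y \<Longrightarrow> cond (\<lambda>w. x w - y w)"
  by (simp add: cond_def contract_simps linear_op_simps[OF lin_u])

text \<open>
  \<open>u\<^sub>j v\<^sub>k\<close> equals \<open>\<beta> ((E\<^sup>-\<^sup>1)\<^sub>j\<^sub>k - v\<^sub>j u\<^sub>k)\<close>, and the contraction with \<open>u\<^sub>i\<close> of its two terms is \<open>u\<^sub>k\<close> both times, the
  second time by \<open>E(u,v) = 1\<close>.
\<close>

lemma stable_V_aux: "stable x \<Longrightarrow> cond (\<lambda>w. V (p @ w) k x b)"
proof (induction p arbitrary: k x b)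
  case Nil
  have "contract E (\<lambda>i j. cst (P $ j $ k) * x (i # w)) = x (k # w)" for w
    by (rule contract_inv_right)
  moreover have "contract E (\<lambda>i j. V (i # w) j (\<lambda>w. x (k # w)) (u0 k (x []))) = x (k # w)" for w
    using contract_SV[OF stable_cond[OF stable_shift[OF Nil]]] by simp
  moreover have "contract E (\<lambda>i j. cst (P $ j $ k) * u0 i (x [])) = u0 k (x [])"
    by (rule contract_inv_right)
  moreover have "V (j # i # w) k x b = cst \<beta> * (cst (P $ j $ k) * x (i # w) - V (i # w) j (\<lambda>w. x (k # w)) (u0 k (x [])))" for i j w
    by (rule V.simps(2))
  moreover have "u0 i (V [j] k x b) = cst \<beta> * (cst (P $ j $ k) * u0 i (x []) - u0 i (v0 j (u0 k (x []))))" for i j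
    by (simp add: linear_op_simps(3,4)[OF lin_u])
  ultimately show ?case
    unfolding cond_def append_Nil by (simp only: contract_simps base_uv cancel_comm_monoid_add_class.diff_cancel mult_zero_right simp_thms)
next
  case (Cons l p)
  then show ?case
    using stable_shift[OF Cons.prems, of k]
    by (simp, intro cond_scale cond_diff Cons.IH) (simp_all add: stable_def)
qed

lemma stable_V: "stable x \<Longrightarrow> stable (\<lambda>w. V w k x b)"
  unfolding stable_def[of "\<lambda>w. V w k x b"] using stable_V_aux[of x] by simp

text \<open>
  The relations are symmetric under \<open>(u, v, \<beta>) \<mapsto> (\<beta>\<^sup>-\<^sup>1 v, u, \<beta>\<^sup>-\<^sup>1)\<close>.  The ladder with the exchanged roles
  provides the spaces \<open>X\<^sub>d\<close> with \<open>d < 0\<close>.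
\<close>

lemma dual: "ladder E (inverse \<beta>) (\<lambda>k b. cst (inverse \<beta>) * v0 k b) u0"
proof
  fix b
  have c: "cst (inverse \<beta>) * (cst (\<beta>) * b) = b" using \<beta> by (simp add: cst_inverse)
  show "contract E (\<lambda>i j. cst (inverse \<beta>) * v0 i (u0 j b)) = b"
    by (simp only: contract_simps base_vu c)
  show "contract E (\<lambda>i j. u0 i (cst (inverse \<beta>) * v0 j b)) = cst (inverse \<beta>) * b"
    by (simp only: linear_op_simps(4)[OF lin_u] contract_simps base_uv)
next
  show "linear_op (\<lambda>b. cst (inverse \<beta>) * v0 k b)" for k
    using lin_v[of k] by (simp add: linear_op_def algebra_simps)
qed (use inv \<beta> trace lin_u in auto)

end

section \<open>Algebras of endomorphisms\<close>

text \<open>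
  Endomorphisms of the carrier, extended by zero so that equality of functions is the right notion
  of equality.
\<close>

definition endo_algebra :: "('k::field, 'v, 'x) module_scheme \<Rightarrow> ('k, 'v \<Rightarrow> 'v) module" where
  "endo_algebra V = \<lparr>carrier = {T \<in> linear_hom V V. \<forall>z. z \<notin> carrier V \<longrightarrow> T z = \<zero>\<^bsub>V\<^esub>},
     mult = (\<lambda>S T z. S (T z)), one = (\<lambda>z. if z \<in> carrier V then z else \<zero>\<^bsub>V\<^esub>),
     zero = (\<lambda>_. \<zero>\<^bsub>V\<^esub>), add = (\<lambda>S T z. S z \<oplus>\<^bsub>V\<^esub> T z), smult = (\<lambda>c T z. c \<odot>\<^bsub>V\<^esub> T z)\<rparr>"

lemma endo_algebra_simps [simp]:
  "\<one>\<^bsub>endo_algebra V\<^esub> = (\<lambda>z. if z \<in> carrier V then z else \<zero>\<^bsub>V\<^esub>)"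
  "\<zero>\<^bsub>endo_algebra V\<^esub> = (\<lambda>_. \<zero>\<^bsub>V\<^esub>)"
  "S \<otimes>\<^bsub>endo_algebra V\<^esub> T = (\<lambda>z. S (T z))"
  "S \<oplus>\<^bsub>endo_algebra V\<^esub> T = (\<lambda>z. S z \<oplus>\<^bsub>V\<^esub> T z)"
  "c \<odot>\<^bsub>endo_algebra V\<^esub> T = (\<lambda>z. c \<odot>\<^bsub>V\<^esub> T z)"
  "T \<in> carrier (endo_algebra V) \<longleftrightarrow> T \<in> linear_hom V V \<and> (\<forall>z. z \<notin> carrier V \<longrightarrow> T z = \<zero>\<^bsub>V\<^esub>)"
  by (simp_all add: endo_algebra_def)

context k_vector_space
begin

lemma endo_apply_closed: "T \<in> carrier (endo_algebra V) \<Longrightarrow> T z \<in> carrier V"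
  by (cases "z \<in> carrier V") (auto intro: linear_hom_closed)

lemma k_algebra_endo: "k_algebra (endo_algebra V)"
proof (rule k_algebraI)
  note cl = endo_apply_closed[unfolded endo_algebra_simps]
  have ext: "f = g" if "\<And>z. f z = g z" for f g :: "'v \<Rightarrow> 'v" using that by blast
  note add = linear_hom_add and sm = linear_hom_smult
  have zero: "T \<zero>\<^bsub>V\<^esub> = \<zero>\<^bsub>V\<^esub>" if "T \<in> linear_hom V V" for T
    by (rule linear_hom_zero[OF that]) (rule k_vector_space_axioms)+
  show "k_vector_space (endo_algebra V)"
  proof (rule k_vector_spaceI)
    fix S T assume S: "S \<in> carrier (endo_algebra V)" and T: "T \<in> carrier (endo_algebra V)"
    have "(\<lambda>z. S z \<oplus>\<^bsub>V\<^esub> T z) \<in> linear_hom V V"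
      by (rule linear_homI) (use S T cl in \<open>auto simp: add sm smult_add_right M.a_ac\<close>)
    then show "S \<oplus>\<^bsub>endo_algebra V\<^esub> T \<in> carrier (endo_algebra V)" using S T by auto
  next
    fix c T assume T: "T \<in> carrier (endo_algebra V)"
    have "(\<lambda>z. c \<odot>\<^bsub>V\<^esub> T z) \<in> linear_hom V V"
      by (rule linear_homI) (use T cl in \<open>auto simp: add sm smult_add_right smult_smult mult.commute\<close>)
    then show "c \<odot>\<^bsub>endo_algebra V\<^esub> T \<in> carrier (endo_algebra V)" using T by auto
  qed (auto intro!: ext linear_hom_const_zero k_vector_space_axioms
      simp: cl M.a_ac smult_add_left smult_add_right smult_smult)
  fix S T assume S: "S \<in> carrier (endo_algebra V)" and T: "T \<in> carrier (endo_algebra V)"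
  show "S \<otimes>\<^bsub>endo_algebra V\<^esub> T \<in> carrier (endo_algebra V)"
    using S T linear_hom_compose[of T V V S V] by (auto simp: zero)
  fix c
  show "S \<otimes>\<^bsub>endo_algebra V\<^esub> (c \<odot>\<^bsub>endo_algebra V\<^esub> T) = c \<odot>\<^bsub>endo_algebra V\<^esub> (S \<otimes>\<^bsub>endo_algebra V\<^esub> T)"
    using S T by (auto intro!: ext simp: sm cl)
next
  show "\<one>\<^bsub>endo_algebra V\<^esub> \<in> carrier (endo_algebra V)"
    by (auto intro!: linear_homI)
next
  fix x y z assume "x \<in> carrier (endo_algebra V)" "y \<in> carrier (endo_algebra V)" "z \<in> carrier (endo_algebra V)"
  then show "z \<otimes>\<^bsub>endo_algebra V\<^esub> (x \<oplus>\<^bsub>endo_algebra V\<^esub> y)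
      = z \<otimes>\<^bsub>endo_algebra V\<^esub> x \<oplus>\<^bsub>endo_algebra V\<^esub> z \<otimes>\<^bsub>endo_algebra V\<^esub> y"
    using endo_apply_closed[of x] endo_apply_closed[of y]
    by (simp add: fun_eq_iff linear_hom_add)
next
  fix x assume x: "x \<in> carrier (endo_algebra V)"
  then show "\<one>\<^bsub>endo_algebra V\<^esub> \<otimes>\<^bsub>endo_algebra V\<^esub> x = x"
    using endo_apply_closed[OF x] by (simp add: fun_eq_iff)
  show "x \<otimes>\<^bsub>endo_algebra V\<^esub> \<one>\<^bsub>endo_algebra V\<^esub> = x"
    using x linear_hom_zero[of x V V] k_vector_space_axioms by (auto simp: fun_eq_iff)
qed (simp_all add: fun_eq_iff)

lemma endo_finsum_apply:
  assumes "finite I" "\<And>i. i \<in> I \<Longrightarrow> f i \<in> carrier (endo_algebra V)"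
  shows "(\<Oplus>\<^bsub>endo_algebra V\<^esub>i\<in>I. f i) z = (\<Oplus>\<^bsub>V\<^esub>i\<in>I. f i z)"
proof -
  interpret EA: k_algebra "endo_algebra V" by (rule k_algebra_endo)
  have "(\<lambda>T. T z) \<in> linear_hom (endo_algebra V) V"
    by (rule linear_homI) (use endo_apply_closed in auto)
  then show ?thesis
    by (rule linear_hom_finsum[where g = f and f = "\<lambda>T. T z", OF _ EA.k_vector_space_axioms k_vector_space_axioms])
      (use assms in auto)
qed

lemma endo_mmul3_apply:
  assumes X: "mat_in (endo_algebra V) X" and Y: "mat_in (endo_algebra V) Y" and z: "z \<in> carrier V"
  shows "(mmul (endo_algebra V) (mmul (endo_algebra V) X (smat (endo_algebra V) M)) Y $ i $ j) z
    = (\<Oplus>\<^bsub>V\<^esub>k\<in>UNIV. \<Oplus>\<^bsub>V\<^esub>l\<in>UNIV. M $ l $ k \<odot>\<^bsub>V\<^esub> (X $ i $ l) ((Y $ k $ j) z))"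
proof -
  let ?A = "endo_algebra V"
  interpret EA: k_algebra ?A by (rule k_algebra_endo)
  note x = EA.mat_inD[OF X] and y = EA.mat_inD[OF Y]
  have yz: "(Y $ k $ j) z \<in> carrier V" for k using endo_apply_closed[OF y] .
  have xm: "mmul ?A X (smat ?A M) $ i $ k = (\<Oplus>\<^bsub>?A\<^esub>l\<in>UNIV. M $ l $ k \<odot>\<^bsub>?A\<^esub> (X $ i $ l))" for k
  proof -
    have "X $ i $ l \<otimes>\<^bsub>?A\<^esub> (M $ l $ k \<odot>\<^bsub>?A\<^esub> \<one>\<^bsub>?A\<^esub>) = M $ l $ k \<odot>\<^bsub>?A\<^esub> (X $ i $ l)" for l
      by (rule EA.scalar_mult_right[OF x])
    then show ?thesis by (simp only: mmul_def smat_def vec_lambda_beta)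
  qed
  have c: "mmul ?A X (smat ?A M) $ i $ k \<otimes>\<^bsub>?A\<^esub> Y $ k $ j \<in> carrier ?A" for k
    using EA.mat_inD[of "mmul ?A X (smat ?A M)"] X y
    by (intro EA.A.m_closed) (auto simp del: endo_algebra_simps)
  have "(mmul ?A (mmul ?A X (smat ?A M)) Y $ i $ j) z
      = (\<Oplus>\<^bsub>V\<^esub>k\<in>UNIV. (mmul ?A X (smat ?A M) $ i $ k \<otimes>\<^bsub>?A\<^esub> Y $ k $ j) z)"
    unfolding mmul_def[of _ "mmul ?A X (smat ?A M)"] vec_lambda_beta
    by (rule endo_finsum_apply) (simp_all add: c del: endo_algebra_simps)
  also have "\<dots> = (\<Oplus>\<^bsub>V\<^esub>k\<in>UNIV. \<Oplus>\<^bsub>V\<^esub>l\<in>UNIV. M $ l $ k \<odot>\<^bsub>V\<^esub> (X $ i $ l) ((Y $ k $ j) z))"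
  proof -
    have "(mmul ?A X (smat ?A M) $ i $ k \<otimes>\<^bsub>?A\<^esub> Y $ k $ j) z
        = (\<Oplus>\<^bsub>V\<^esub>l\<in>UNIV. M $ l $ k \<odot>\<^bsub>V\<^esub> (X $ i $ l) ((Y $ k $ j) z))" for k
      unfolding xm endo_algebra_simps(3)
      by (subst endo_finsum_apply) (use EA.smult_closed'[OF x] in \<open>simp_all only: endo_algebra_simps(5) finite_UNIV finite\<close>)
    then show ?thesis by simp
  qed
  finally show ?thesis .
qed

end

section \<open>Starting operators for the ladder\<close>

definition pairing :: "'k::field^'m^'m \<Rightarrow> 'k^'m \<Rightarrow> 'k^'m \<Rightarrow> 'k" where
  "pairing E a b = (\<Sum>i\<in>UNIV. \<Sum>j\<in>UNIV. E $ i $ j * (a $ i * b $ j))"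

lemma contract_pairing: "contract E (\<lambda>i j. cst (a $ i) * (cst (b $ j) * p)) = cst (pairing E a b) * p"
  by (simp add: contract_double pairing_def const_sum cst_simps sum_distrib_right mult.assoc)

lemma pairing_alt:
  "pairing E a b = (\<Sum>i\<in>UNIV. a $ i * (E *v b) $ i)"
  "pairing E a b = (\<Sum>j\<in>UNIV. (transpose E *v a) $ j * b $ j)"
  unfolding pairing_def matrix_vector_mult_def transpose_def
   apply (simp add: sum_distrib_left mult_ac)
  apply (subst sum.swap)
  apply (simp add: sum_distrib_right sum_distrib_left mult_ac)
  done

lemma pairing_axis: "pairing E (axis s 1) b = (E *v b) $ s"
  by (simp add: pairing_alt(1) axis_def if_distrib[of "\<lambda>c. c * _"] cong: if_cong)

lemma proportional_vectors:
  fixes p q :: "'k::field^'m"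
  assumes "\<And>i j. p $ i * q $ j = p $ j * q $ i" "q \<noteq> 0"
  obtains c where "p = c *s q"
proof -
  obtain j where j: "q $ j \<noteq> 0" using assms(2) by (auto simp: vec_eq_iff)
  have "p = (p $ j / q $ j) *s q"
    using j assms(1)[of _ j] by (simp add: vec_eq_iff field_simps)
  then show thesis by (rule that)
qed

text \<open>
  Cramer's rule for the two coordinates \<open>i\<close> and \<open>j\<close>.
\<close>

lemma two_equations:
  fixes p q :: "'k::field^'m"
  assumes "p $ i * q $ j \<noteq> p $ j * q $ i"
  obtains g :: "'k^'m" where "(\<Sum>l\<in>UNIV. p $ l * g $ l) = s" "(\<Sum>l\<in>UNIV. q $ l * g $ l) = t"
proof -
  define d where "d = p $ i * q $ j - p $ j * q $ i"
  have d: "d \<noteq> 0" using assms by (simp add: d_def)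
  define g :: "'k^'m" where "g = ((s * q $ j - t * p $ j) / d) *s axis i 1 + ((t * p $ i - s * q $ i) / d) *s axis j 1"
  have g: "(\<Sum>l\<in>UNIV. r $ l * g $ l) = r $ i * ((s * q $ j - t * p $ j) / d) + r $ j * ((t * p $ i - s * q $ i) / d)" for r :: "'k^'m"
    by (simp add: g_def axis_def ring_distribs sum.distrib if_distrib[of "\<lambda>c. _ * c"] cong: if_cong)
  show thesis
    by (rule that[of g]; unfold g; insert d; simp add: field_simps; simp add: d_def algebra_simps)
qed

text \<open>
  A matrix for which every vector is an eigenvector is scalar; applied to \<open>E\<^sup>-\<^sup>1 E\<^sup>t\<close>.
\<close>

lemma all_eigenvectors:
  fixes E :: "'k::field^'m^'m"
  assumes E: "invertible E" and eig: "\<And>f. f \<noteq> 0 \<Longrightarrow> \<exists>c. transpose E *v f = c *s (E *v f)"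
  obtains c where "\<And>i j. E $ j $ i = c * E $ i $ j"
proof -
  define M where "M = matrix_inv E ** transpose E"
  have eigM: "\<exists>c. M *v f = c *s f" if "f \<noteq> 0" for f
  proof -
    from eig[OF that] obtain c where c: "transpose E *v f = c *s (E *v f)" ..
    have "M *v f = matrix_inv E *v (transpose E *v f)"
      unfolding M_def by (rule matrix_vector_mul_assoc[symmetric])
    also have "\<dots> = c *s ((matrix_inv E ** E) *v f)"
      by (simp only: c vector_scalar_commute matrix_vector_mul_assoc)
    also have "\<dots> = c *s f" by (simp only: matrix_inv_inverse(2)[OF E] matrix_vector_mul_lid)
    finally show ?thesis by (rule exI)
  qed
  have ax: "axis s (1::'k) \<noteq> (0 :: 'k^'m)" for s by (auto simp: vec_eq_iff axis_def)
  have col: "(M *v axis s 1) $ i = M $ i $ s" for i s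
    by (simp add: matrix_vector_mult_def axis_def if_distrib[of "\<lambda>c. _ * c"] cong: if_cong)
  have diag: "M $ i $ s = 0" if "i \<noteq> s" for i s
    using eigM[OF ax[of s]] col[of s i] that by (auto simp: axis_def)
  have eq: "M $ s $ s = M $ t $ t" for s t
  proof (cases "s = t")
    case False
    have "axis s (1::'k) + axis t 1 \<noteq> (0 :: 'k^'m)"
      using False by (auto simp: vec_eq_iff axis_def intro!: exI[of _ s])
    then obtain c where c: "M *v (axis s 1 + axis t 1) = c *s (axis s 1 + axis t 1)" using eigM by blast
    have "M $ i $ s + M $ i $ t = c * (axis s 1 + axis t 1) $ i" for i
      using arg_cong[OF c, of "\<lambda>v. v $ i"] by (simp add: matrix_vector_right_distrib col)
    from this[of s] this[of t] show ?thesis using False diag[of s t] diag[of t s] by (simp add: axis_def)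
  qed simp
  define c where "c = M $ undefined $ undefined"
  have M: "M $ i $ j = (if i = j then c else 0)" for i j
    using diag[of i j] eq[of i undefined] by (auto simp: c_def)
  have tE: "transpose E = E ** M"
    using E by (simp add: M_def matrix_mul_assoc matrix_inv_inverse)
  have "E $ j $ i = c * E $ i $ j" for i j
  proof -
    have "E $ j $ i = transpose E $ i $ j" by (simp add: transpose_def)
    also have "\<dots> = (E ** M) $ i $ j" by (simp only: tE)
    also have "\<dots> = c * E $ i $ j"
      by (simp add: matrix_matrix_mult_def M if_distrib[of "\<lambda>c. _ * c"] mult.commute cong: if_cong)
    finally show ?thesis .
  qed
  from that[OF this] show thesis .
qed

lemma linear_op_cst: "linear_op (\<lambda>b. cst c * b)"
  by (simp add: linear_op_def algebra_simps)

lemma pderiv_cst: "pderiv (cst c * b) = cst c * pderiv b"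
  by (simp add: cst_def pderiv_smult)

lemma linear_op_intros:
  "linear_op (\<lambda>b. b)" "linear_op f \<Longrightarrow> linear_op (\<lambda>b. pderiv (f b))" "linear_op f \<Longrightarrow> linear_op (\<lambda>b. q * f b)"
  "\<lbrakk>linear_op f; linear_op g\<rbrakk> \<Longrightarrow> linear_op (\<lambda>b. f b + g b)"
  by (auto simp: linear_op_def pderiv_add pderiv_cst distrib_left mult.left_commute)

text \<open>
  If some vector \<open>f\<close> makes the linear forms \<open>E(f,-)\<close> and \<open>E(-,f)\<close> independent, then there is a vector \<open>g\<close>
  with \<open>E(f,g) = 1\<close> and \<open>E(g,f) = \<beta>\<close>, and scalars do.  Otherwise \<open>E\<^sup>t = c E\<close> for a scalar \<open>c\<close>, and
  commuting operators cannot work unless \<open>\<beta> = c\<close>.  Then one uses \<open>D X - X D = 1\<close> for the derivative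
  \<open>D\<close> and the multiplication by the indeterminate \<open>X\<close>, with operators of the form \<open>u = f + D e\<close> and
  \<open>v = g + X h + X D g'\<close> for suitable vectors.  Since \<open>E(v,u)\<close> is \<open>c\<close> times \<open>E(u,v)\<close> up to the commutator,
  the constant \<open>k = 1 - \<beta> / c\<close> is what the commutator has to supply.
\<close>

lemma starting_operators:
  fixes E :: "'k::field^'m^'m"
  assumes E: "invertible E" and card: "CARD('m) \<ge> 2" and \<beta>: "\<beta> \<noteq> 0"
  obtains u v :: "'m \<Rightarrow> 'k poly \<Rightarrow> 'k poly" where
    "\<And>k. linear_op (u k)" "\<And>k. linear_op (v k)"
    "\<And>b. contract E (\<lambda>i j. u i (v j b)) = b" "\<And>b. contract E (\<lambda>i j. v i (u j b)) = cst \<beta> * b"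
proof (cases "\<forall>f. f \<noteq> 0 \<longrightarrow> (\<exists>c. transpose E *v f = c *s (E *v f))")
  case False
  then obtain f where f: "f \<noteq> 0" "\<nexists>c. transpose E *v f = c *s (E *v f)" by blast
  have "E *v f \<noteq> 0"
  proof
    assume "E *v f = 0"
    then have "matrix_inv E *v (E *v f) = 0" by simp
    then show False using E f(1) by (simp add: matrix_vector_mul_assoc matrix_inv_inverse)
  qed
  then obtain i j where "(transpose E *v f) $ i * (E *v f) $ j \<noteq> (transpose E *v f) $ j * (E *v f) $ i"
    using proportional_vectors[of "transpose E *v f" "E *v f"] f(2) by metis
  then obtain g where g: "(\<Sum>l\<in>UNIV. (transpose E *v f) $ l * g $ l) = 1" "(\<Sum>l\<in>UNIV. (E *v f) $ l * g $ l) = \<beta>"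
    by (rule two_equations)
  have "pairing E f g = 1" using g(1) by (simp add: pairing_alt(2))
  moreover have "pairing E g f = \<beta>" using g(2) by (simp add: pairing_alt(1) mult.commute)
  ultimately show thesis
    by (intro that[of "\<lambda>k b. cst (f $ k) * b" "\<lambda>k b. cst (g $ k) * b"] linear_op_cst)
      (simp_all add: contract_pairing)
next
  case True
  then obtain c where c: "\<And>i j. E $ j $ i = c * E $ i $ j" using all_eigenvectors[OF E] by blast
  obtain a b :: 'm where ab: "a \<noteq> b"
  proof -
    have "\<not> (\<forall>a b :: 'm. a = b)"
      using card card_le_Suc0_iff_eq[of "UNIV :: 'm set"] by auto
    then show thesis using that by blast
  qed
  have "c \<noteq> 0"
  proof
    assume "c = 0"
    then have "E = 0" using c by (simp add: vec_eq_iff)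
    then have "mat 1 = (0 :: 'k^'m^'m)" using matrix_inv_inverse(1)[OF E] by (simp add: matrix_matrix_mult_def vec_eq_iff)
    then show False by (simp add: vec_eq_iff mat_def) (metis zero_neq_one)
  qed
  have sym: "pairing E y x = c * pairing E x y" for x y
  proof -
    have "pairing E y x = (\<Sum>j\<in>UNIV. \<Sum>i\<in>UNIV. E $ i $ j * (y $ i * x $ j))"
      unfolding pairing_def by (rule sum.swap)
    also have "\<dots> = (\<Sum>j\<in>UNIV. \<Sum>i\<in>UNIV. c * (E $ j $ i * (x $ j * y $ i)))"
      by (intro sum.cong refl) (subst c, simp add: mult_ac)
    finally show ?thesis by (simp add: pairing_def sum_distrib_left)
  qed
  let ?e = "axis a 1 :: 'k^'m" and ?f = "axis b 1 :: 'k^'m"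
  have solve: "E *v (matrix_inv E *v t) = t" for t
    using E by (simp add: matrix_vector_mul_assoc matrix_inv_inverse)
  \<comment> \<open>\<open>E(u,v) = E(f,g) + k D X - k X D\<close> and \<open>E(v,u) = c (E(f,g) + k X D - k X D)\<close>\<close>
  define k where "k = 1 - \<beta> / c"
  define g where "g = matrix_inv E *v ((\<beta> / c) *s ?f)"
  define h where "h = matrix_inv E *v (k *s ?e)"
  define g' where "g' = matrix_inv E *v ((- k) *s ?f)"
  have p: "pairing E ?f g = \<beta> / c" "pairing E ?e g = 0" "pairing E ?f h = 0" "pairing E ?e h = k"
    "pairing E ?e g' = 0" "pairing E ?f g' = - k"
    using ab by (simp_all add: pairing_axis g_def h_def g'_def solve) (simp_all add: axis_def)
  define X :: "'k poly" where "X = [:0, 1:]"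
  have dX: "pderiv (X * q) = q + X * pderiv q" for q
    by (simp add: X_def pderiv_mult pderiv_pCons one_pCons[symmetric])
  define u where "u = (\<lambda>i p. cst (?f $ i) * p + cst (?e $ i) * pderiv p)"
  define v where "v = (\<lambda>i p. cst (g $ i) * p + cst (h $ i) * (X * p) + cst (g' $ i) * (X * pderiv p))"
  have dv: "pderiv (v j p) = cst (g $ j) * pderiv p + cst (h $ j) * (p + X * pderiv p)
      + cst (g' $ j) * (pderiv p + X * pderiv (pderiv p))" for j p
    by (simp only: v_def pderiv_add pderiv_cst dX)
  have uv: "contract E (\<lambda>i j. u i (v j p)) = p" for p
  proof -
    have "contract E (\<lambda>i j. u i (v j p)) = contract E (\<lambda>i j.
        cst (?f $ i) * (cst (g $ j) * p) + cst (?f $ i) * (cst (h $ j) * (X * p)) + cst (?f $ i) * (cst (g' $ j) * (X * pderiv p))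
        + (cst (?e $ i) * (cst (g $ j) * pderiv p) + cst (?e $ i) * (cst (h $ j) * (p + X * pderiv p))
         + cst (?e $ i) * (cst (g' $ j) * (pderiv p + X * pderiv (pderiv p)))))"
      unfolding u_def dv by (simp add: v_def distrib_left)
    also have "\<dots> = p"
    proof -
      have "cst (\<beta> / c) * p + cst 0 * (X * p) + cst (- k) * (X * pderiv p)
        + (cst 0 * pderiv p + cst k * (p + X * pderiv p) + cst 0 * (pderiv p + X * pderiv (pderiv p))) = p"
        by (simp add: k_def cst_simps algebra_simps)
      then show ?thesis by (simp only: contract_simps(1) contract_pairing p)
    qed
    finally show ?thesis .
  qed
  have vu: "contract E (\<lambda>i j. v i (u j p)) = cst \<beta> * p" for p
  proof -
    have "contract E (\<lambda>i j. v i (u j p)) = contract E (\<lambda>i j.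
        cst (g $ i) * (cst (?f $ j) * p) + cst (g $ i) * (cst (?e $ j) * pderiv p)
        + (cst (h $ i) * (cst (?f $ j) * (X * p)) + cst (h $ i) * (cst (?e $ j) * (X * pderiv p)))
        + (cst (g' $ i) * (cst (?f $ j) * (X * pderiv p)) + cst (g' $ i) * (cst (?e $ j) * (X * pderiv (pderiv p)))))"
      unfolding u_def by (simp add: v_def pderiv_add pderiv_cst distrib_left mult.left_commute)
    also have "\<dots> = cst \<beta> * p"
      using \<open>c \<noteq> 0\<close>
      by (simp only: contract_simps(1) contract_pairing sym[of g] sym[of h] sym[of g'] p)
        (simp add: cst_simps algebra_simps)
    finally show ?thesis .
  qed
  show thesis
    by (rule that[OF _ _ uv vu]; unfold u_def v_def; intro linear_op_intros)
qed

section \<open>The algebra \<open>\<B>(E,F)\<close> does not vanish\<close>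

text \<open>
  The form \<open>G\<close> on a plane with \<open>tr (G\<^sup>-\<^sup>1 G\<^sup>t) = \<beta> + \<beta>\<^sup>-\<^sup>1\<close> for which the generic matrix of \<open>\<B>(E,G)\<close>
  has a lowering and a raising column.
\<close>

definition two_form :: "'k::field \<Rightarrow> 'k^2^2" where
  "two_form \<beta> = (\<chi> i j. if i = 1 \<and> j = 2 then 1 else if i = 2 \<and> j = 1 then \<beta> else 0)"

definition two_form_inv :: "'k::field \<Rightarrow> 'k^2^2" where
  "two_form_inv \<beta> = (\<chi> i j. if i = 1 \<and> j = 2 then inverse \<beta> else if i = 2 \<and> j = 1 then 1 else 0)"

lemma two_form_inverse:
  assumes "\<beta> \<noteq> 0"
  shows "two_form \<beta> ** two_form_inv \<beta> = mat 1" "two_form_inv \<beta> ** two_form \<beta> = mat 1"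
  using assms
  by (auto simp: two_form_def two_form_inv_def matrix_matrix_mult_def vec_eq_iff sum_2 mat_def forall_2)

lemma matrix_inv_unique:
  fixes M N :: "'k::field^'n^'n"
  assumes "M ** N = mat 1" "N ** M = mat 1"
  shows "matrix_inv M = N"
proof -
  have "invertible M" using assms by (auto simp: invertible_def)
  then have "matrix_inv M = matrix_inv M ** (M ** N)" by (simp add: assms)
  also have "\<dots> = (matrix_inv M ** M) ** N" by (rule matrix_mul_assoc)
  also have "\<dots> = N" by (simp add: matrix_inv_inverse(2)[OF \<open>invertible M\<close>])
  finally show ?thesis .
qed

context ladder
begin

interpretation D: ladder E "inverse \<beta>" "\<lambda>k b. cst (inverse \<beta>) * v0 k b" u0
  by (rule dual)

text \<open>
  The component \<open>True\<close> of a state collects the degrees \<open>d \<ge> 0\<close>, the component \<open>False\<close> the degrees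
  \<open>d < 0\<close>, with the empty word standing for degree 0 and degree \<open>-1\<close>.
\<close>

definition state_set :: "(bool \<Rightarrow> 'm list \<Rightarrow> 'k poly) set" where
  "state_set = {z. stable (z True) \<and> D.stable (z False)}"

definition states :: "('k, bool \<Rightarrow> 'm list \<Rightarrow> 'k poly) module" where
  "states = \<lparr>carrier = state_set, mult = (\<lambda>_ _. undefined), one = undefined, zero = (\<lambda>_ _. 0),
     add = (\<lambda>z z' s w. z s w + z' s w), smult = (\<lambda>c z s w. cst c * z s w)\<rparr>"

lemma states_simps [simp]:
  "carrier states = state_set" "\<zero>\<^bsub>states\<^esub> = (\<lambda>_ _. 0)"
  "z \<oplus>\<^bsub>states\<^esub> z' = (\<lambda>s w. z s w + z' s w)" "c \<odot>\<^bsub>states\<^esub> z = (\<lambda>s w. cst c * z s w)"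
  by (simp_all add: states_def)

lemma stable_lin:
  "stable (\<lambda>_. 0)" "\<lbrakk>stable x; stable y\<rbrakk> \<Longrightarrow> stable (\<lambda>w. x w + y w)" "stable x \<Longrightarrow> stable (\<lambda>w. cst c * x w)"
  by (simp_all add: stable_def cond_add cond_scale)
    (simp add: cond_def contract_simps linear_op_simps(1)[OF lin_u])

lemma D_stable_lin:
  "D.stable (\<lambda>_. 0)" "\<lbrakk>D.stable x; D.stable y\<rbrakk> \<Longrightarrow> D.stable (\<lambda>w. x w + y w)" "D.stable x \<Longrightarrow> D.stable (\<lambda>w. cst c * x w)"
  by (rule ladder.stable_lin[OF dual]; assumption)+

lemma k_vector_space_states: "k_vector_space states"
  by (rule k_vector_spaceI)
    (auto simp: state_set_def stable_lin D_stable_lin fun_eq_iff cst_simps algebra_simps)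

lemma states_finsum:
  assumes "finite I" "\<And>i. i \<in> I \<Longrightarrow> f i \<in> state_set"
  shows "(\<Oplus>\<^bsub>states\<^esub>i\<in>I. f i) = (\<lambda>s w. \<Sum>i\<in>I. f i s w)"
proof -
  interpret S: k_vector_space states by (rule k_vector_space_states)
  show ?thesis using assms
    by (induction I rule: finite_induct) (simp_all add: Pi_def)
qed

text \<open>
  Column 1 is \<open>u\<close>, column 2 is \<open>v\<close>.  On the negative side \<open>\<beta>\<^sup>-\<^sup>1 v\<close> is the shift.
\<close>

definition ladder_op :: "2 \<Rightarrow> 'm \<Rightarrow> (bool \<Rightarrow> 'm list \<Rightarrow> 'k poly) \<Rightarrow> bool \<Rightarrow> 'm list \<Rightarrow> 'k poly" where
  "ladder_op r k z s w = (if r = 1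
     then (if s then z True (k # w) else D.V w k (z False) (z True []))
     else (if s then V w k (z True) (z False []) else cst \<beta> * z False (k # w)))"

lemma op_simps:
  "ladder_op 1 k z True = (\<lambda>w. z True (k # w))"
  "ladder_op 1 k z False = (\<lambda>w. D.V w k (z False) (z True []))"
  "ladder_op 2 k z True = (\<lambda>w. V w k (z True) (z False []))"
  "ladder_op 2 k z False = (\<lambda>w. cst \<beta> * z False (k # w))"
  by (simp_all add: ladder_op_def fun_eq_iff)

lemma two_cases: "(r :: 2) = 1 \<or> r = 2"
  by (metis exhaust_2)

lemma op_closed: "z \<in> state_set \<Longrightarrow> ladder_op r k z \<in> state_set"
  using two_cases[of r]
  by (auto simp: state_set_def op_simps intro: stable_shift stable_V D.stable_V D_stable_lin(3)[OF D.stable_shift])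

lemma op_linear: "ladder_op r k \<in> linear_hom states states"
proof (rule linear_homI)
  show "ladder_op r k (z \<oplus>\<^bsub>states\<^esub> z') = ladder_op r k z \<oplus>\<^bsub>states\<^esub> ladder_op r k z'" for z z'
    by (auto simp: fun_eq_iff ladder_op_def V_add D.V_add algebra_simps)
  show "ladder_op r k (c \<odot>\<^bsub>states\<^esub> z) = c \<odot>\<^bsub>states\<^esub> ladder_op r k z" for c z
    by (auto simp: fun_eq_iff ladder_op_def V_scale D.V_scale mult.left_commute)
qed (simp add: op_closed)

lemma op_form:
  assumes z: "z \<in> state_set"
  shows "contract E (\<lambda>i j. ladder_op r i (ladder_op q j z) s w) = cst (two_form \<beta> $ r $ q) * z s w"
proof -
  have st: "stable (z True)" "D.stable (z False)" using z by (auto simp: state_set_def)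
  note c = stable_cond[OF st(1)] and d = D.stable_cond[OF st(2)]
  have b: "cst \<beta> * (cst (inverse \<beta>) * x) = x" "cst (inverse \<beta>) * (cst \<beta> * x) = x" for x
    using cst_inverse[OF \<beta>] by auto
  have n: "cst x \<noteq> 0" if "x \<noteq> 0" for x :: 'k using that by (simp add: cst_def)
  note two_cases[of r] two_cases[of q]
  then consider "r = 1" "q = 1" | "r = 1" "q = 2" | "r = 2" "q = 1" | "r = 2" "q = 2" by blast
  then show ?thesis
  proof cases
    case 1
    have "contract E (\<lambda>i j. D.V w i (\<lambda>w. D.V w j (z False) (z True [])) (z True [j])) = 0"
      by (rule D.contract_VV[OF d]) (use c in \<open>simp add: cond_def\<close>)
    then show ?thesis using 1 c by (cases s) (simp_all add: op_simps two_form_def cond_def)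
  next
    case 2
    have "contract E (\<lambda>i j. D.V w i (\<lambda>w. cst \<beta> * z False (j # w)) (v0 j (z False []))) = z False w"
    proof -
      have "D.V w i (\<lambda>w. cst \<beta> * z False (j # w)) (v0 j (z False []))
          = cst \<beta> * D.V w i (\<lambda>w. z False (j # w)) (cst (inverse \<beta>) * v0 j (z False []))" for i j
        by (simp only: D.V_scale[symmetric] b)
      then show ?thesis using D.contract_VS[OF d, of w] by (simp only: contract_simps b)
    qed
    then show ?thesis using 2 contract_SV[OF c] by (cases s) (simp_all add: op_simps two_form_def del: V.simps(2))
  next
    case 3
    then show ?thesis using contract_VS[OF c, of w] D.contract_SV[OF d]
      by (cases s) (simp_all add: op_simps two_form_def contract_simps del: V.simps(2) D.V.simps(2))
  next
    case 4
    have "contract E (\<lambda>i j. v0 i (cst \<beta> * z False [j])) = cst \<beta> * contract E (\<lambda>i j. v0 i (z False [j]))"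
      by (simp only: linear_op_simps(4)[OF lin_v] contract_simps)
    moreover have "contract E (\<lambda>i j. v0 i (z False [j])) = 0"
      using d n[of "inverse \<beta>"] \<beta> by (simp add: D.cond_def contract_simps)
    ultimately have "contract E (\<lambda>i j. V w i (\<lambda>w. V w j (z True) (z False [])) (cst \<beta> * z False [j])) = 0"
      by (intro contract_VV[OF c]) simp
    then show ?thesis using 4 d by (cases s) (simp_all add: op_simps two_form_def D.cond_def contract_simps)
  qed
qed

lemma op_inverse_form:
  "cst (inverse \<beta>) * ladder_op 1 i (ladder_op 2 j z) s w + ladder_op 2 i (ladder_op 1 j z) s w = cst (P $ i $ j) * z s w"
proof -
  have b: "cst \<beta> * (cst (inverse \<beta>) * x) = x" "cst (inverse \<beta>) * (cst \<beta> * x) = x" for x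
    using cst_inverse[OF \<beta>] by auto
  have "cst (inverse \<beta>) * D.V w i (\<lambda>w. cst \<beta> * z False (j # w)) (v0 j (z False []))
      = D.V w i (\<lambda>w. z False (j # w)) (cst (inverse \<beta>) * v0 j (z False []))"
    by (simp only: D.V_scale[symmetric] b)
  then show ?thesis by (cases s) (simp_all add: op_simps b)
qed

definition op_matrix :: "((bool \<Rightarrow> 'm list \<Rightarrow> 'k poly) \<Rightarrow> bool \<Rightarrow> 'm list \<Rightarrow> 'k poly)^2^'m" where
  "op_matrix = (\<chi> k r. (\<lambda>z. if z \<in> state_set then ladder_op r k z else (\<lambda>_ _. 0)))"

lemma op_matrix_in: "mat_in (endo_algebra states) op_matrix"
proof -
  interpret S: k_vector_space states by (rule k_vector_space_states)
  have "(\<lambda>z. if z \<in> state_set then ladder_op r k z else (\<lambda>_ _. 0)) \<in> linear_hom states states" for r k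
    by (rule linear_hom_cong[OF op_linear[of r k]]) (simp_all add: k_vector_space_states)
  then show ?thesis by (simp add: mat_in_def op_matrix_def)
qed

lemma op_matrix_point: "bilin_point (endo_algebra states) E (two_form \<beta>) op_matrix"
proof -
  interpret S: k_vector_space states by (rule k_vector_space_states)
  interpret EA: k_algebra "endo_algebra states" by (rule S.k_algebra_endo)
  note X = op_matrix_in
  have Xt: "mat_in (endo_algebra states) (transpose op_matrix)" using X by simp
  have cl: "ladder_op r k z \<in> state_set" if "z \<in> state_set" for r k z using op_closed[OF that] .
  have sc: "(\<lambda>s w. cst c * ladder_op r k z s w) \<in> state_set" if "z \<in> state_set" for c r k z
    using S.smult_closed'[of "ladder_op r k z" c] op_closed[OF that] by simp
  have sum_closed: "(\<lambda>s w. \<Sum>l\<in>UNIV. cst (c l) * ladder_op (r l) (m l) (ladder_op q k z) s w) \<in> state_set"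
    if z: "z \<in> state_set" for c and r :: "'l::finite \<Rightarrow> 2" and m and q k z
    using states_finsum[of "UNIV :: 'l set" "\<lambda>l s w. cst (c l) * ladder_op (r l) (m l) (ladder_op q k z) s w"]
      S.M.finsum_closed[of "\<lambda>l s w. cst (c l) * ladder_op (r l) (m l) (ladder_op q k z) s w" "UNIV :: 'l set"]
      sc[OF cl[OF z]] by auto
  have eqI: "M = N" if M: "mat_in (endo_algebra states) M" and N: "mat_in (endo_algebra states) N"
    and e: "\<And>i j z s w. z \<in> state_set \<Longrightarrow> (M $ i $ j) z s w = (N $ i $ j) z s w" for M N :: "_^'q^'p"
  proof -
    have "(M $ i $ j) z = (N $ i $ j) z" for i j z
      using e[of z i j] EA.mat_inD[OF M, of i j] EA.mat_inD[OF N, of i j]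
      by (cases "z \<in> state_set") (auto simp: fun_eq_iff)
    then show ?thesis by (simp add: vec_eq_iff fun_eq_iff)
  qed
  have "form_map (endo_algebra states) E (two_form \<beta>) (transpose op_matrix)"
    unfolding form_map_def transpose_transpose
  proof (rule eqI)
    fix r q :: 2 and z :: "bool \<Rightarrow> 'm list \<Rightarrow> 'k poly" and s w assume z: "z \<in> state_set"
    have "(mmul (endo_algebra states) (mmul (endo_algebra states) (transpose op_matrix) (smat (endo_algebra states) E)) op_matrix $ r $ q) z s w
        = (\<Sum>k\<in>UNIV. \<Sum>l\<in>UNIV. cst (E $ l $ k) * ladder_op r l (ladder_op q k z) s w)"
      using z by (subst S.endo_mmul3_apply[OF Xt X])
        (simp_all add: op_matrix_def transpose_def cl sc states_finsum sum_closed)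
    also have "\<dots> = contract E (\<lambda>i j. ladder_op r i (ladder_op q j z) s w)"
      unfolding contract_double by (rule sum.swap)
    also have "\<dots> = (smat (endo_algebra states) (two_form \<beta>) $ r $ q) z s w"
      using z by (simp add: op_form smat_def)
    finally show "(mmul (endo_algebra states) (mmul (endo_algebra states) (transpose op_matrix) (smat (endo_algebra states) E)) op_matrix $ r $ q) z s w
        = (smat (endo_algebra states) (two_form \<beta>) $ r $ q) z s w" .
  qed (simp_all add: X)
  moreover have "form_map (endo_algebra states) (matrix_inv (two_form \<beta>)) P op_matrix"
    unfolding form_map_def matrix_inv_unique[OF two_form_inverse[OF \<beta>]]
  proof (rule eqI)
    fix i j :: 'm and z :: "bool \<Rightarrow> 'm list \<Rightarrow> 'k poly" and s w assume z: "z \<in> state_set"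
    have "(mmul (endo_algebra states) (mmul (endo_algebra states) op_matrix (smat (endo_algebra states) (two_form_inv \<beta>))) (transpose op_matrix) $ i $ j) z s w
        = (\<Sum>k\<in>UNIV. \<Sum>l\<in>UNIV. cst (two_form_inv \<beta> $ l $ k) * ladder_op l i (ladder_op k j z) s w)"
      using z by (subst S.endo_mmul3_apply[OF X Xt])
        (simp_all add: op_matrix_def transpose_def cl sc states_finsum sum_closed)
    also have "\<dots> = cst (inverse \<beta>) * ladder_op 1 i (ladder_op 2 j z) s w + ladder_op 2 i (ladder_op 1 j z) s w"
      by (simp add: sum_2 two_form_inv_def)
    also have "\<dots> = (smat (endo_algebra states) P $ i $ j) z s w"
      using z op_inverse_form by (simp add: smat_def)
    finally show "(mmul (endo_algebra states) (mmul (endo_algebra states) op_matrix (smat (endo_algebra states) (two_form_inv \<beta>))) (transpose op_matrix) $ i $ j) z s w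
        = (smat (endo_algebra states) P $ i $ j) z s w" .
  qed (simp_all add: X)
  ultimately show ?thesis using X by (simp add: bilin_point_def)
qed

lemma endo_states_nontrivial: "\<one>\<^bsub>endo_algebra states\<^esub> \<noteq> \<zero>\<^bsub>endo_algebra states\<^esub>"
proof
  define z :: "bool \<Rightarrow> 'm list \<Rightarrow> 'k poly" where "z = (\<lambda>s w. if s \<and> w = [] then 1 else 0)"
  have "stable (z True)"
    by (simp add: stable_def cond_def z_def contract_simps linear_op_simps(1)[OF lin_u])
  moreover have "z False = (\<lambda>_. 0)" by (simp add: z_def)
  ultimately have z: "z \<in> state_set" by (simp add: state_set_def D_stable_lin)
  assume "\<one>\<^bsub>endo_algebra states\<^esub> = \<zero>\<^bsub>endo_algebra states\<^esub>"
  then have "\<one>\<^bsub>endo_algebra states\<^esub> z = \<zero>\<^bsub>endo_algebra states\<^esub> z" by (rule fun_cong)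
  then have "z True [] = 0" using z by simp
  then show False by (simp add: z_def)
qed

end

lemma nontrivial_of_hom:
  assumes "k_algebra A" "k_algebra B" "h \<in> algebra_hom A B" "\<one>\<^bsub>B\<^esub> \<noteq> \<zero>\<^bsub>B\<^esub>"
  shows "\<one>\<^bsub>A\<^esub> \<noteq> \<zero>\<^bsub>A\<^esub>"
  using linear_hom_zero[OF algebra_homD(1)[OF assms(3)]] algebra_homD(5)[OF assms(3)] assms
  by (metis k_algebra_vs)

lemma nontrivial_of_point:
  assumes "invertible E" "invertible F" "k_algebra A" "bilin_point A E F X" "\<one>\<^bsub>A\<^esub> \<noteq> \<zero>\<^bsub>A\<^esub>"
  shows "\<one>\<^bsub>bilin_algebra E F\<^esub> \<noteq> \<zero>\<^bsub>bilin_algebra E F\<^esub>"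
  by (rule nontrivial_of_hom[OF k_algebra_bilin assms(3) bilin_lift_hom[OF assms(1-4)] assms(5)])

lemma nontrivial_two_form:
  fixes E :: "'k::field^'m^'m"
  assumes E: "invertible E" and card: "CARD('m) \<ge> 2" and \<beta>: "\<beta> \<noteq> 0"
    and trace: "trace (matrix_inv E ** transpose E) = \<beta> + inverse \<beta>"
  shows "\<one>\<^bsub>bilin_algebra E (two_form \<beta>)\<^esub> \<noteq> \<zero>\<^bsub>bilin_algebra E (two_form \<beta>)\<^esub>"
proof -
  have tr: "(\<Sum>i\<in>UNIV. \<Sum>j\<in>UNIV. E $ i $ j * matrix_inv E $ i $ j) = \<beta> + inverse \<beta>"
    using trace by (simp add: trace_def matrix_matrix_mult_def transpose_def mult.commute)
  obtain u v where uv: "\<And>k. linear_op (u k)" "\<And>k. linear_op (v k)"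
    "\<And>b. contract E (\<lambda>i j. u i (v j b)) = b" "\<And>b. contract E (\<lambda>i j. v i (u j b)) = cst \<beta> * b"
    by (rule starting_operators[OF E card \<beta>]) (rule that)
  interpret ladder E \<beta> u v
    by unfold_locales (use E \<beta> tr uv in auto)
  have "invertible (two_form \<beta>)"
    using two_form_inverse[OF \<beta>] by (auto simp: invertible_def)
  then show ?thesis
    by (rule nontrivial_of_point[OF E _ k_vector_space.k_algebra_endo[OF k_vector_space_states] op_matrix_point endo_states_nontrivial])
qed

lemma nontrivial_swap:
  assumes "invertible E" "invertible F" "\<one>\<^bsub>bilin_algebra E F\<^esub> \<noteq> \<zero>\<^bsub>bilin_algebra E F\<^esub>"
  shows "\<one>\<^bsub>bilin_algebra F E\<^esub> \<noteq> \<zero>\<^bsub>bilin_algebra F E\<^esub>"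
  by (rule nontrivial_of_hom[OF k_algebra_bilin k_algebra.k_algebra_opposite[OF k_algebra_bilin] antipode_hom[OF assms(1,2)]])
    (use assms in simp)

text \<open>
  Extend a basis of the ideal of relations by 1 to a basis of the free algebra and take the
  coordinate of 1.
\<close>

lemma functional_one:
  assumes "\<one>\<^bsub>presented_algebra Rel\<^esub> \<noteq> \<zero>\<^bsub>presented_algebra Rel\<^esub>"
  obtains l where "l \<in> linear_hom (presented_algebra Rel) scalar_algebra" "l \<one>\<^bsub>presented_algebra Rel\<^esub> = 1"
proof -
  interpret k_quotient_algebra free_algebra "Idl\<^bsub>free_algebra\<^esub> Rel" by (rule presented_quotient)
  let ?I = "Idl\<^bsub>free_algebra\<^esub> Rel"
  have I: "pm.subspace ?I"
    using submoduleE(4,5)[OF sub] additive_subgroup.zero_closed[OF additive_subgroup_axioms]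
    by (simp add: pm.subspace_def)
  have "1 \<notin> ?I"
    using assms cls_eq_iff[of 1 0] by (simp add: presented_algebra_def quotient_one quotient_zero a_minus_def minus_eq_smult)
  obtain B where B: "B \<subseteq> ?I" "pm.independent B" "?I \<subseteq> pm.span B" by (rule pm.maximal_independent_subset)
  have sB: "pm.span B \<subseteq> ?I" using B(1) I by (rule pm.span_minimal)
  have ind: "pm.independent (insert 1 B)"
    using \<open>1 \<notin> ?I\<close> sB B(2) by (intro pm.independent_insertI) auto
  define C where "C = pm.extend_basis (insert 1 B)"
  have C: "pm.independent C" "pm.span C = UNIV" "insert 1 B \<subseteq> C"
    using pm.independent_extend_basis[OF ind] pm.span_extend_basis[OF ind] pm.extend_basis_superset[OF ind]
    by (auto simp: C_def)
  define f where "f = (\<lambda>p. pm.representation C p 1)"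
  have f: "f \<in> linear_hom free_algebra scalar_algebra"
    by (rule linear_homI) (simp_all add: f_def pm.representation_add[OF C(1)] pm.representation_scale[OF C(1)] C(2))
  have f1: "f 1 = 1" using pm.representation_basis[OF C(1), of 1] C(3) by (simp add: f_def)
  have "f b = 0" if "b \<in> B" for b
  proof -
    have "b \<noteq> 1" "b \<in> C" using that B(1) C(3) \<open>1 \<notin> ?I\<close> by auto
    then show ?thesis using pm.representation_basis[OF C(1), of b] by (simp add: f_def)
  qed
  moreover have "pm.subspace {p. f p = 0}"
    using linear_hom_add[OF f] linear_hom_smult[OF f] by (auto simp: pm.subspace_def f_def pm.representation_zero)
  ultimately have "pm.span B \<subseteq> {p. f p = 0}" by (intro pm.span_minimal) auto
  then have f0: "f p = \<zero>\<^bsub>scalar_algebra\<^esub>" if "p \<in> ?I" for p using that B(3) by auto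
  have lin: "(\<lambda>X. the_elem (f ` X)) \<in> linear_hom (presented_algebra Rel) scalar_algebra"
    unfolding presented_algebra_def by (rule lift_linear[OF f k_vector_space_scalar_algebra]) (rule f0)
  moreover have "the_elem (f ` \<one>\<^bsub>presented_algebra Rel\<^esub>) = 1"
    unfolding presented_algebra_def quotient_one
    by (subst lift_cls[OF f k_vector_space_scalar_algebra]) (use f0 f1 in auto)
  ultimately show thesis by (rule that)
qed

lemma functional_one_bilin:
  assumes "\<one>\<^bsub>bilin_algebra E F\<^esub> \<noteq> \<zero>\<^bsub>bilin_algebra E F\<^esub>"
  obtains l where "l \<in> linear_hom (bilin_algebra E F) scalar_algebra" "l \<one>\<^bsub>bilin_algebra E F\<^esub> = 1"
  using functional_one[of "bilin_rels E F"] assms unfolding bilin_algebra_def by blast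

text \<open>
  The image of 1 in \<open>\<B>(E,F) \<otimes> \<B>(F,G)\<close> is \<open>1 \<otimes> 1\<close>, which a product of two linear forms maps to 1.
\<close>

lemma nontrivial_trans:
  assumes "invertible E" "invertible F" "invertible G"
    and EF: "\<one>\<^bsub>bilin_algebra E F\<^esub> \<noteq> \<zero>\<^bsub>bilin_algebra E F\<^esub>"
    and FG: "\<one>\<^bsub>bilin_algebra F G\<^esub> \<noteq> \<zero>\<^bsub>bilin_algebra F G\<^esub>"
  shows "\<one>\<^bsub>bilin_algebra E G\<^esub> \<noteq> \<zero>\<^bsub>bilin_algebra E G\<^esub>"
proof -
  interpret T: k_tensor_algebra "bilin_algebra E F" "bilin_algebra F G"
    by (intro k_tensor_algebra.intro k_algebra_bilin)
  obtain l where l: "l \<in> linear_hom (bilin_algebra E F) scalar_algebra" "l \<one>\<^bsub>bilin_algebra E F\<^esub> = 1"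
    using EF by (rule functional_one_bilin)
  obtain m where m: "m \<in> linear_hom (bilin_algebra F G) scalar_algebra" "m \<one>\<^bsub>bilin_algebra F G\<^esub> = 1"
    using FG by (rule functional_one_bilin)
  have bil: "(\<lambda>x y. l x * m y) \<in> bilinear_hom (bilin_algebra E F) (bilin_algebra F G) scalar_algebra"
    by (intro bilinear_homI linear_homI)
      (simp_all add: linear_hom_add[OF l(1)] linear_hom_add[OF m(1)] linear_hom_smult[OF l(1)]
        linear_hom_smult[OF m(1)] algebra_simps)
  note tl = T.tensor_lift_linear[OF k_vector_space_scalar_algebra bil]
    T.tensor_lift_pure[OF k_vector_space_scalar_algebra bil]
  have "tensor_lift scalar_algebra (\<lambda>x y. l x * m y) \<one>\<^bsub>tensor (bilin_algebra E F) (bilin_algebra F G)\<^esub> = 1"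
    using l m by (simp add: T.tensor_one tl(2))
  moreover have "tensor_lift scalar_algebra (\<lambda>x y. l x * m y) \<zero>\<^bsub>tensor (bilin_algebra E F) (bilin_algebra F G)\<^esub> = 0"
    using linear_hom_zero[OF tl(1) T.k_vector_space_tensor k_vector_space_scalar_algebra] by simp
  ultimately have "\<one>\<^bsub>tensor (bilin_algebra E F) (bilin_algebra F G)\<^esub> \<noteq> \<zero>\<^bsub>tensor (bilin_algebra E F) (bilin_algebra F G)\<^esub>"
    by auto
  then show ?thesis
    by (rule nontrivial_of_hom[OF k_algebra_bilin T.k_algebra_tensor bilin_delta_hom[OF assms(1-3)]])
qed

text \<open>
  Both algebras are compared with the 2 by 2 form of the same trace; \<open>\<beta>\<close> is a root of
  \<open>X\<^sup>2 - \<tau> X + 1\<close>.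
\<close>

lemma nontrivial_alg_closed:
  fixes E :: "'k::alg_closed_field^'m^'m" and F :: "'k^'n^'n"
  assumes E: "invertible E" and F: "invertible F" and card: "CARD('m) \<ge> 2" "CARD('n) \<ge> 2"
    and trace: "trace (matrix_inv E ** transpose E) = trace (matrix_inv F ** transpose F)"
  shows "\<one>\<^bsub>bilin_algebra E F\<^esub> \<noteq> \<zero>\<^bsub>bilin_algebra E F\<^esub>"
proof -
  define \<tau> where "\<tau> = trace (matrix_inv E ** transpose E)"
  have "\<exists>x. poly [:1, - \<tau>, 1:] x = 0" by (rule alg_closed_imp_poly_has_root) simp
  then obtain \<beta> where "1 + \<beta> * (\<beta> - \<tau>) = 0" by auto
  then have eq: "\<beta> * \<tau> = 1 + \<beta> * \<beta>" by (simp add: algebra_simps)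
  then have \<beta>0: "\<beta> \<noteq> 0" by auto
  have "\<tau> = inverse \<beta> * (\<beta> * \<tau>)" using \<beta>0 by simp
  also have "\<dots> = \<beta> + inverse \<beta>" unfolding eq using \<beta>0 by (simp add: algebra_simps)
  finally have \<beta>: "\<beta> \<noteq> 0" "\<tau> = \<beta> + inverse \<beta>" using \<beta>0 by auto
  have G: "invertible (two_form \<beta>)"
    using two_form_inverse[OF \<beta>(1)] by (auto simp: invertible_def)
  have "\<one>\<^bsub>bilin_algebra E (two_form \<beta>)\<^esub> \<noteq> \<zero>\<^bsub>bilin_algebra E (two_form \<beta>)\<^esub>"
    by (rule nontrivial_two_form[OF E card(1) \<beta>(1)]) (use \<beta> \<tau>_def in simp)
  moreover have "\<one>\<^bsub>bilin_algebra F (two_form \<beta>)\<^esub> \<noteq> \<zero>\<^bsub>bilin_algebra F (two_form \<beta>)\<^esub>"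
    by (rule nontrivial_two_form[OF F card(2) \<beta>(1)]) (use \<beta> \<tau>_def trace in simp)
  ultimately show ?thesis
    using nontrivial_trans[OF E G F] nontrivial_swap[OF F G] by blast
qed

section \<open>Change of the base field\<close>

definition restrict_scalars :: "('k \<Rightarrow> 'l) \<Rightarrow> ('l, 'a, 'x) module_scheme \<Rightarrow> ('k, 'a) module" where
  "restrict_scalars h A = \<lparr>carrier = carrier A, mult = mult A, one = one A, zero = zero A, add = add A,
     smult = (\<lambda>c x. h c \<odot>\<^bsub>A\<^esub> x)\<rparr>"

lemma finsum_restrict_scalars: "finsum (restrict_scalars h A) = finsum A"
proof -
  have "finprod (add_monoid (restrict_scalars h A)) = finprod (add_monoid A)"
    by (intro ext) (simp add: finprod_def restrict_scalars_def)
  then show ?thesis by (simp add: finsum_def)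
qed

lemma bilin_point_restrict_scalars:
  fixes h :: "'k::field \<Rightarrow> 'l::field" and E :: "'k^'m^'m" and F :: "'k^'n^'n"
  assumes h: "h 0 = 0" "h 1 = 1" "\<And>a b. h (a + b) = h a + h b" "\<And>a b. h (a * b) = h a * h b"
    and E: "invertible E" and F: "invertible F" and A: "k_algebra A"
    and X: "bilin_point A (map_matrix h E) (map_matrix h F) X"
  shows "k_algebra (restrict_scalars h A)" "bilin_point (restrict_scalars h A) E F X"
proof -
  interpret A: k_algebra A by fact
  show "k_algebra (restrict_scalars h A)"
  proof (rule k_algebraI)
    show "k_vector_space (restrict_scalars h A)"
      by (rule k_vector_spaceI)
        (simp_all add: restrict_scalars_def h A.smult_add_left A.smult_add_right A.smult_smult A.M.a_ac)
  qed (simp_all add: restrict_scalars_def A.A.m_assoc A.A.l_distr A.A.r_distr A.smult_mult_left A.smult_mult_right)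
  have mm: "map_matrix h (M ** N) = map_matrix h M ** map_matrix h N" for M N :: "'k^'q^'q"
  proof -
    have "h (\<Sum>k\<in>I. f k) = (\<Sum>k\<in>I. h (f k))" for I and f :: "'q \<Rightarrow> 'k"
      by (induction I rule: infinite_finite_induct) (simp_all add: h)
    then show ?thesis by (simp add: vec_eq_iff matrix_matrix_mult_def h)
  qed
  have one: "map_matrix h (mat 1) = mat 1" by (simp add: vec_eq_iff mat_def h)
  have inv: "matrix_inv (map_matrix h M) = map_matrix h (matrix_inv M)" if "invertible M" for M :: "'k^'q^'q"
    by (rule matrix_inv_unique) (simp_all add: matrix_inv_inverse[OF that] one flip: mm)
  have s: "smat (restrict_scalars h A) M = smat A (map_matrix h M)" for M
    by (simp add: smat_def restrict_scalars_def vec_eq_iff)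
  have m: "mmul (restrict_scalars h A) Y Z = mmul A Y Z" for Y :: "_^'q^'p" and Z :: "_^'r^'q"
    by (simp add: mmul_def finsum_restrict_scalars, simp add: restrict_scalars_def)
  show "bilin_point (restrict_scalars h A) E F X"
    using X by (simp add: bilin_point_def form_map_def mat_in_def s m inv[OF E] inv[OF F])
      (simp add: restrict_scalars_def)
qed

text \<open>
  Over the algebraic closure the corresponding algebra, regarded as an algebra over the base field,
  contains a point of \<open>\<B>(E,F)\<close>.
\<close>

lemma bilin_nontrivial:
  fixes E :: "'k::field^'m^'m" and F :: "'k^'n^'n"
  assumes E: "invertible E" and F: "invertible F" and card: "CARD('m) \<ge> 2" "CARD('n) \<ge> 2"
    and trace: "trace (matrix_inv E ** transpose E) = trace (matrix_inv F ** transpose F)"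
  shows "\<one>\<^bsub>bilin_algebra E F\<^esub> \<noteq> \<zero>\<^bsub>bilin_algebra E F\<^esub>"
proof -
  have mm: "map_matrix to_ac (M ** N) = map_matrix to_ac M ** map_matrix to_ac N" for M N :: "'k^'q^'q"
    by (simp add: vec_eq_iff matrix_matrix_mult_def to_ac_sum)
  have one: "map_matrix to_ac (mat 1) = mat 1" by (simp add: vec_eq_iff mat_def)
  have inv: "map_matrix to_ac M ** map_matrix to_ac (matrix_inv M) = mat 1"
    "map_matrix to_ac (matrix_inv M) ** map_matrix to_ac M = mat 1" if "invertible M" for M :: "'k^'q^'q"
    by (simp_all add: matrix_inv_inverse[OF that] one flip: mm)
  have tr: "trace (matrix_inv (map_matrix to_ac M) ** transpose (map_matrix to_ac M))
      = to_ac (trace (matrix_inv M ** transpose M))" if "invertible M" for M :: "'k^'q^'q"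
    unfolding matrix_inv_unique[OF inv[OF that]] by (simp add: trace_def to_ac_sum map_matrix_transpose[symmetric] flip: mm)
  have i: "invertible (map_matrix to_ac M)" if "invertible M" for M :: "'k^'q^'q"
    using inv[OF that] by (auto simp: invertible_def)
  let ?B = "bilin_algebra (map_matrix to_ac E) (map_matrix to_ac F)"
  have n: "\<one>\<^bsub>?B\<^esub> \<noteq> \<zero>\<^bsub>?B\<^esub>"
    by (rule nontrivial_alg_closed[OF i[OF E] i[OF F] card]) (simp add: tr E F trace)
  note p = bilin_point_restrict_scalars[of to_ac, OF _ _ _ _ E F k_algebra_bilin bilin_point_gens[OF i[OF E] i[OF F]]]
  show ?thesis
    by (rule nontrivial_of_point[OF E F p]) (use n in \<open>simp_all add: restrict_scalars_def\<close>)
qed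

section \<open>Records with the same underlying algebra\<close>

text \<open>
  The tensor product and all maps defined with it see only the algebra fields of a record.  The
  lemmas of this section replace the comodule and coalgebra records by the underlying algebras.
\<close>

definition same_algebra :: "('k, 'a, 'x) module_scheme \<Rightarrow> ('k, 'a, 'y) module_scheme \<Rightarrow> bool" where
  "same_algebra A B \<longleftrightarrow> carrier A = carrier B \<and> mult A = mult B \<and> one A = one B \<and> zero A = zero B
     \<and> add A = add B \<and> smult A = smult B"

lemma same_algebra_refl: "same_algebra A A"
  and same_algebra_sym: "same_algebra A B \<Longrightarrow> same_algebra B A"
  by (auto simp: same_algebra_def)

lemma same_algebra_finsum: "same_algebra A B \<Longrightarrow> finsum A = finsum B"
proof -
  assume s: "same_algebra A B"
  have "finprod (add_monoid A) = finprod (add_monoid B)"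
    using s by (intro ext) (simp add: finprod_def same_algebra_def)
  then show ?thesis by (simp add: finsum_def)
qed

lemma same_algebra_vs: "\<lbrakk>same_algebra A B; k_vector_space A\<rbrakk> \<Longrightarrow> k_vector_space B"
proof -
  assume s: "same_algebra A B" and "k_vector_space A"
  then interpret k_vector_space A by simp
  show "k_vector_space B"
    using same_algebra_sym[OF s] unfolding same_algebra_def
    by (intro k_vector_spaceI) (simp_all add: smult_add_left smult_add_right smult_smult M.a_ac)
qed

lemma same_algebra_k_algebra: "\<lbrakk>same_algebra A B; k_algebra A\<rbrakk> \<Longrightarrow> k_algebra B"
proof -
  assume s: "same_algebra A B" and "k_algebra A"
  then interpret k_algebra A by simp
  show "k_algebra B"
    using same_algebra_sym[OF s] same_algebra_vs[OF s k_vector_space_axioms] unfolding same_algebra_def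
    by (intro k_algebraI)
      (simp_all add: A.m_assoc A.l_distr A.r_distr smult_mult_left smult_mult_right)
qed

lemma same_algebra_linear_hom: "\<lbrakk>same_algebra A A'; same_algebra B B'\<rbrakk> \<Longrightarrow> linear_hom A B = linear_hom A' B'"
  by (simp add: linear_hom_def same_algebra_def)

lemma same_algebra_algebra_hom: "\<lbrakk>same_algebra A A'; same_algebra B B'\<rbrakk> \<Longrightarrow> algebra_hom A B = algebra_hom A' B'"
  using same_algebra_linear_hom[of A A' B B']
  by (simp add: algebra_hom_def ring_hom_def same_algebra_def)

lemma same_algebra_relators:
  assumes "same_algebra V V'" "same_algebra W W'"
  shows "bilinear_relators V W \<subseteq> bilinear_relators V' W'"
proof
  fix u assume "u \<in> bilinear_relators V W"
  then show "u \<in> bilinear_relators V' W'"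
    using assms unfolding same_algebra_def
    by (induction rule: bilinear_relators.induct) (simp_all add: bilinear_relators.intros)
qed

lemma same_algebra_tensor:
  assumes "same_algebra V V'" "same_algebra W W'"
  shows "tensor V W = tensor V' W'" "pure_tensor V W = pure_tensor V' W'"
proof -
  have f: "free_tensor V W = free_tensor V' W'"
    using assms by (simp add: free_tensor_def same_algebra_def)
  have "bilinear_relators V W = bilinear_relators V' W'"
    using same_algebra_relators[OF assms] same_algebra_relators[OF assms[THEN same_algebra_sym]] by blast
  then have r: "bilinear_relations V W = bilinear_relations V' W'"
    by (simp add: bilinear_relations_def)
  show "tensor V W = tensor V' W'" by (simp add: tensor_def f r)
  show "pure_tensor V W = pure_tensor V' W'" by (simp add: fun_eq_iff pure_tensor_def f r)
qed

lemma same_algebra_tensor_lift: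
  assumes "same_algebra U U'"
  shows "tensor_lift U f = tensor_lift U' f"
  using assms by (intro ext) (simp add: tensor_lift_def same_algebra_finsum[OF assms], simp add: same_algebra_def)

lemma same_algebra_tensor_map:
  assumes "same_algebra V V'" "same_algebra W W'"
  shows "tensor_map V W f g = tensor_map V' W' f g"
  by (simp add: tensor_map_def same_algebra_tensor[OF assms])

lemma same_algebra_tensor_assoc:
  assumes "same_algebra U U'" "same_algebra V V'" "same_algebra W W'"
  shows "tensor_assoc U V W = tensor_assoc U' V' W'"
  by (simp add: tensor_assoc_def same_algebra_tensor[OF assms(2,3)]
      same_algebra_tensor[OF assms(1) same_algebra_refl])

lemma same_bialgebra: "same_algebra (bilin_bialgebra E) (bilin_algebra E E)"
  by (simp add: same_algebra_def bilin_bialgebra_def module.defs)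

lemma same_bicomodule: "same_algebra (bilin_bicomodule E F) (bilin_algebra E F)"
  by (simp add: same_algebra_def bilin_bicomodule_def module.defs)

lemma same_quadratic: "same_algebra (quadratic_comodule E t) (quadratic_algebra (matrix_inv E) t)"
  by (simp add: same_algebra_def quadratic_comodule_def module.defs Let_def)

lemma structure_maps [simp]:
  "comult (bilin_bialgebra E) = bilin_delta E E E"
  "counit (bilin_bialgebra E) = presented_lift scalar_algebra (\<lambda>(i, j). if i = j then 1 else 0)"
  "left_coact (bilin_bicomodule E F) = bilin_delta E E F"
  "right_coact (bilin_bicomodule E F) = bilin_delta E F F"
  "coact (quadratic_comodule E t) = quad_delta E E t"
  by (simp_all add: bilin_bialgebra_def bilin_bicomodule_def quadratic_comodule_def quad_delta_def
      module.defs coalgebra.defs bicomodule.defs comodule.defs Let_def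
      same_algebra_tensor[OF same_algebra_refl same_bialgebra[unfolded bilin_bialgebra_def module.defs coalgebra.defs, simplified]])

section \<open>Coassociativity and counits\<close>

text \<open>
  The common computation behind coassociativity on generators: both sides are double sums of
  \<open>x\<^sub>l \<otimes> y\<^sub>l\<^sub>k \<otimes> z\<^sub>k\<close>.
\<close>

lemma tensor_assoc_sums:
  fixes A :: "('k::field, 'a, 'x) module_scheme" and B :: "('k, 'b, 'y) module_scheme"
    and C :: "('k, 'c, 'z) module_scheme" and x :: "'l::finite \<Rightarrow> 'a" and y :: "'l \<Rightarrow> 'n::finite \<Rightarrow> 'b"
  assumes vs: "k_vector_space A" "k_vector_space B" "k_vector_space C"
    and cl: "\<And>l. x l \<in> carrier A" "\<And>l k. y l k \<in> carrier B" "\<And>k. z k \<in> carrier C"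
  shows "tensor_assoc A B C (\<Oplus>\<^bsub>tensor (tensor A B) C\<^esub>k\<in>UNIV.
        pure_tensor (tensor A B) C (\<Oplus>\<^bsub>tensor A B\<^esub>l\<in>UNIV. pure_tensor A B (x l) (y l k)) (z k))
    = (\<Oplus>\<^bsub>tensor A (tensor B C)\<^esub>l\<in>UNIV.
        pure_tensor A (tensor B C) (x l) (\<Oplus>\<^bsub>tensor B C\<^esub>k\<in>UNIV. pure_tensor B C (y l k) (z k)))"
proof -
  interpret AB: k_tensor A B by (intro k_tensor.intro vs)
  interpret BC: k_tensor B C by (intro k_tensor.intro vs)
  interpret L: k_tensor "tensor A B" C by (intro k_tensor.intro vs AB.k_vector_space_tensor)
  interpret R: k_tensor A "tensor B C" by (intro k_tensor.intro vs BC.k_vector_space_tensor)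
  interpret RT: k_vector_space "tensor A (tensor B C)" by (rule R.k_vector_space_tensor)
  interpret LT: k_vector_space "tensor (tensor A B) C" by (rule L.k_vector_space_tensor)
  note l = tensor_assoc_linear[OF vs]
  have "pure_tensor (tensor A B) C (\<Oplus>\<^bsub>tensor A B\<^esub>l\<in>UNIV. pure_tensor A B (x l) (y l k)) (z k)
      = (\<Oplus>\<^bsub>tensor (tensor A B) C\<^esub>l\<in>UNIV. pure_tensor (tensor A B) C (pure_tensor A B (x l) (y l k)) (z k))" for k
    by (rule linear_hom_finsum[OF bilinear_homD(2)[OF L.pure_bilinear]]) (auto simp: cl AB.k_vector_space_tensor L.k_vector_space_tensor)
  then have "tensor_assoc A B C (\<Oplus>\<^bsub>tensor (tensor A B) C\<^esub>k\<in>UNIV.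
        pure_tensor (tensor A B) C (\<Oplus>\<^bsub>tensor A B\<^esub>l\<in>UNIV. pure_tensor A B (x l) (y l k)) (z k))
     = (\<Oplus>\<^bsub>tensor A (tensor B C)\<^esub>k\<in>UNIV. \<Oplus>\<^bsub>tensor A (tensor B C)\<^esub>l\<in>UNIV.
         pure_tensor A (tensor B C) (x l) (pure_tensor B C (y l k) (z k)))"
    by (simp add: linear_hom_finsum[OF l L.k_vector_space_tensor R.k_vector_space_tensor] cl
        tensor_assoc_pure[OF vs] LT.M.finsum_closed)
  also have "\<dots> = (\<Oplus>\<^bsub>tensor A (tensor B C)\<^esub>l\<in>UNIV. \<Oplus>\<^bsub>tensor A (tensor B C)\<^esub>k\<in>UNIV.
         pure_tensor A (tensor B C) (x l) (pure_tensor B C (y l k) (z k)))"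
    by (rule RT.finsum_swap) (auto simp: cl)
  also have "\<dots> = (\<Oplus>\<^bsub>tensor A (tensor B C)\<^esub>l\<in>UNIV.
        pure_tensor A (tensor B C) (x l) (\<Oplus>\<^bsub>tensor B C\<^esub>k\<in>UNIV. pure_tensor B C (y l k) (z k)))"
    by (simp add: linear_hom_finsum[OF bilinear_homD(1)[OF R.pure_bilinear] BC.k_vector_space_tensor R.k_vector_space_tensor] cl)
  finally show ?thesis .
qed

lemma tensor_map_sum:
  assumes vs: "k_vector_space V" "k_vector_space W" "k_vector_space V'" "k_vector_space W'"
    and f: "f \<in> linear_hom V V'" and g: "g \<in> linear_hom W W'"
    and cl: "\<And>k. x k \<in> carrier V" "\<And>k. y k \<in> carrier W"
  shows "tensor_map V' W' f g (\<Oplus>\<^bsub>tensor V W\<^esub>k\<in>(UNIV::'i::finite set). pure_tensor V W (x k) (y k))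
    = (\<Oplus>\<^bsub>tensor V' W'\<^esub>k\<in>UNIV. pure_tensor V' W' (f (x k)) (g (y k)))"
proof -
  interpret T: k_tensor V W by (intro k_tensor.intro vs)
  interpret T': k_tensor V' W' by (intro k_tensor.intro vs)
  show ?thesis
    by (simp add: linear_hom_finsum[OF tensor_map_linear[OF vs f g] T.k_vector_space_tensor T'.k_vector_space_tensor]
        tensor_map_pure[OF vs f g] cl)
qed

context
  fixes E :: "'k::field^'m^'m" and F :: "'k^'n^'n" and G :: "'k^'p^'p" and H :: "'k^'q^'q" and t :: 'k
  assumes inv: "invertible E" "invertible F" "invertible G" "invertible H"
begin

lemma bilin_delta_coassoc: "c \<in> carrier (bilin_algebra E H) \<Longrightarrow>
    tensor_assoc (bilin_algebra E F) (bilin_algebra F G) (bilin_algebra G H)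
      (tensor_map (tensor (bilin_algebra E F) (bilin_algebra F G)) (bilin_algebra G H) (bilin_delta E F G) id (bilin_delta E G H c))
    = tensor_map (bilin_algebra E F) (tensor (bilin_algebra F G) (bilin_algebra G H)) id (bilin_delta F G H) (bilin_delta E F H c)"
proof -
  let ?A = "bilin_algebra E F" and ?B = "bilin_algebra F G" and ?C = "bilin_algebra G H"
  interpret AB: k_tensor_algebra ?A ?B by (intro k_tensor_algebra.intro k_algebra_bilin)
  interpret BC: k_tensor_algebra ?B ?C by (intro k_tensor_algebra.intro k_algebra_bilin)
  note alg = k_algebra_bilin AB.k_algebra_tensor BC.k_algebra_tensor
  note d = bilin_delta_hom[OF inv(1,2,3)] bilin_delta_hom[OF inv(1,3,4)]
    bilin_delta_hom[OF inv(2,3,4)] bilin_delta_hom[OF inv(1,2,4)]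
  note vs = alg[THEN k_algebra_vs]
  show "c \<in> carrier (bilin_algebra E H) \<Longrightarrow> ?thesis"
  proof (rule bilin_hom_eqI[of "\<lambda>c. tensor_assoc ?A ?B ?C (tensor_map (tensor ?A ?B) ?C (bilin_delta E F G) id (bilin_delta E G H c))"
        E H "tensor ?A (tensor ?B ?C)" "\<lambda>c. tensor_map ?A (tensor ?B ?C) id (bilin_delta F G H) (bilin_delta E F H c)"])
    show "(\<lambda>c. tensor_assoc ?A ?B ?C (tensor_map (tensor ?A ?B) ?C (bilin_delta E F G) id (bilin_delta E G H c)))
        \<in> algebra_hom (bilin_algebra E H) (tensor ?A (tensor ?B ?C))"
      by (rule algebra_hom_compose[OF algebra_hom_compose[OF d(2) tensor_map_algebra_hom[OF _ _ _ _ d(1) algebra_hom_id]]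
            tensor_assoc_algebra_hom]) (intro alg)+
    show "(\<lambda>c. tensor_map ?A (tensor ?B ?C) id (bilin_delta F G H) (bilin_delta E F H c))
        \<in> algebra_hom (bilin_algebra E H) (tensor ?A (tensor ?B ?C))"
      by (rule algebra_hom_compose[OF d(4) tensor_map_algebra_hom[OF _ _ _ _ algebra_hom_id d(3)]]) (intro alg)+
    show "tensor_assoc ?A ?B ?C (tensor_map (tensor ?A ?B) ?C (bilin_delta E F G) id (bilin_delta E G H (bilin_gen E H i j)))
      = tensor_map ?A (tensor ?B ?C) id (bilin_delta F G H) (bilin_delta E F H (bilin_gen E H i j))" for i j
      unfolding bilin_delta_gen[OF inv(1,3,4)] bilin_delta_gen[OF inv(1,2,4)]
      by (subst tensor_map_sum[OF _ _ _ _ algebra_homD(1)[OF d(1)] linear_hom_id], (intro vs bilin_gen_closed)+,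
          subst tensor_map_sum[OF _ _ _ _ linear_hom_id algebra_homD(1)[OF d(3)]], (intro vs bilin_gen_closed)+)
        (simp add: bilin_delta_gen[OF inv(1,2,3)] bilin_delta_gen[OF inv(2,3,4)] tensor_assoc_sums[OF vs(1) vs(1) vs(1)])
  qed
qed

lemma quad_delta_coassoc: "c \<in> carrier (quadratic_algebra (matrix_inv G) t) \<Longrightarrow>
    tensor_assoc (quadratic_algebra (matrix_inv E) t) (bilin_algebra E F) (bilin_algebra F G)
      (tensor_map (tensor (quadratic_algebra (matrix_inv E) t) (bilin_algebra E F)) (bilin_algebra F G) (quad_delta E F t) id (quad_delta F G t c))
    = tensor_map (quadratic_algebra (matrix_inv E) t) (tensor (bilin_algebra E F) (bilin_algebra F G)) id (bilin_delta E F G) (quad_delta E G t c)"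
proof -
  let ?A = "quadratic_algebra (matrix_inv E) t" and ?B = "bilin_algebra E F" and ?C = "bilin_algebra F G"
  interpret AB: k_tensor_algebra ?A ?B by (intro k_tensor_algebra.intro k_algebra_bilin k_algebra_quadratic)
  interpret BC: k_tensor_algebra ?B ?C by (intro k_tensor_algebra.intro k_algebra_bilin)
  note alg = k_algebra_bilin AB.k_algebra_tensor BC.k_algebra_tensor k_algebra_quadratic
  note d = quad_delta_hom[OF inv(1,2)] quad_delta_hom[OF inv(2,3)] bilin_delta_hom[OF inv(1,2,3)] quad_delta_hom[OF inv(1,3)]
  note vs = alg[THEN k_algebra_vs]
  show "c \<in> carrier (quadratic_algebra (matrix_inv G) t) \<Longrightarrow> ?thesis"
  proof (rule quadratic_hom_eqI[of "\<lambda>c. tensor_assoc ?A ?B ?C (tensor_map (tensor ?A ?B) ?C (quad_delta E F t) id (quad_delta F G t c))"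
        "matrix_inv G" t "tensor ?A (tensor ?B ?C)" "\<lambda>c. tensor_map ?A (tensor ?B ?C) id (bilin_delta E F G) (quad_delta E G t c)"])
    show "(\<lambda>c. tensor_assoc ?A ?B ?C (tensor_map (tensor ?A ?B) ?C (quad_delta E F t) id (quad_delta F G t c)))
        \<in> algebra_hom (quadratic_algebra (matrix_inv G) t) (tensor ?A (tensor ?B ?C))"
      by (rule algebra_hom_compose[OF algebra_hom_compose[OF d(2) tensor_map_algebra_hom[OF _ _ _ _ d(1) algebra_hom_id]]
            tensor_assoc_algebra_hom]) (intro alg)+
    show "(\<lambda>c. tensor_map ?A (tensor ?B ?C) id (bilin_delta E F G) (quad_delta E G t c))
        \<in> algebra_hom (quadratic_algebra (matrix_inv G) t) (tensor ?A (tensor ?B ?C))"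
      by (rule algebra_hom_compose[OF d(4) tensor_map_algebra_hom[OF _ _ _ _ algebra_hom_id d(3)]]) (intro alg)+
    show "tensor_assoc ?A ?B ?C (tensor_map (tensor ?A ?B) ?C (quad_delta E F t) id (quad_delta F G t (quadratic_gen (matrix_inv G) t i)))
      = tensor_map ?A (tensor ?B ?C) id (bilin_delta E F G) (quad_delta E G t (quadratic_gen (matrix_inv G) t i))" for i
      unfolding quad_delta_gen[OF inv(2,3)] quad_delta_gen[OF inv(1,3)]
      by (subst tensor_map_sum[OF _ _ _ _ algebra_homD(1)[OF d(1)] linear_hom_id], (intro vs bilin_gen_closed quadratic_gen_closed)+,
          subst tensor_map_sum[OF _ _ _ _ linear_hom_id algebra_homD(1)[OF d(3)]], (intro vs bilin_gen_closed quadratic_gen_closed)+)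
        (simp add: quad_delta_gen[OF inv(1,2)] bilin_delta_gen[OF inv(1,2,3)] tensor_assoc_sums[OF vs(4) vs(1) vs(1)])
  qed
qed

end

text \<open>
  \<open>id \<otimes> \<epsilon>\<close> is an algebra map, hence the counit axioms may be checked on generators.
\<close>

lemma counit_lift_right:
  assumes A: "k_algebra A" "k_algebra B" and e: "e \<in> algebra_hom B scalar_algebra"
  shows "tensor_lift A (\<lambda>a b. e b \<odot>\<^bsub>A\<^esub> a) \<in> algebra_hom (tensor A B) A"
    and "\<lbrakk>a \<in> carrier A; b \<in> carrier B\<rbrakk> \<Longrightarrow> tensor_lift A (\<lambda>a b. e b \<odot>\<^bsub>A\<^esub> a) (pure_tensor A B a b) = e b \<odot>\<^bsub>A\<^esub> a"
proof -
  interpret T: k_tensor_algebra A B by (intro k_tensor_algebra.intro A)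
  note l = algebra_homD(1)[OF e]
  have bil: "(\<lambda>a b. e b \<odot>\<^bsub>A\<^esub> a) \<in> bilinear_hom A B A"
    by (intro bilinear_homI linear_homI)
      (simp_all add: linear_hom_add[OF l] linear_hom_smult[OF l] T.A.smult_add_left T.A.smult_add_right T.A.smult_smult mult.commute)
  note p = T.tensor_lift_pure[OF T.A.k_vector_space_axioms bil]
  show "\<lbrakk>a \<in> carrier A; b \<in> carrier B\<rbrakk> \<Longrightarrow> tensor_lift A (\<lambda>a b. e b \<odot>\<^bsub>A\<^esub> a) (pure_tensor A B a b) = e b \<odot>\<^bsub>A\<^esub> a"
    by (rule p)
  show "tensor_lift A (\<lambda>a b. e b \<odot>\<^bsub>A\<^esub> a) \<in> algebra_hom (tensor A B) A"
    by (rule T.tensor_algebra_homI[OF A(1) T.tensor_lift_linear[OF T.A.k_vector_space_axioms bil]])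
      (simp_all add: p algebra_homD(4,5)[OF e] T.A.smult_mult_left T.A.smult_mult_right T.A.smult_smult mult.commute)
qed

lemma counit_lift_left:
  assumes A: "k_algebra A" "k_algebra B" and e: "e \<in> algebra_hom B scalar_algebra"
  shows "tensor_lift A (\<lambda>b a. e b \<odot>\<^bsub>A\<^esub> a) \<in> algebra_hom (tensor B A) A"
    and "\<lbrakk>a \<in> carrier A; b \<in> carrier B\<rbrakk> \<Longrightarrow> tensor_lift A (\<lambda>b a. e b \<odot>\<^bsub>A\<^esub> a) (pure_tensor B A b a) = e b \<odot>\<^bsub>A\<^esub> a"
proof -
  interpret T: k_tensor_algebra B A by (intro k_tensor_algebra.intro A)
  note l = algebra_homD(1)[OF e]
  have bil: "(\<lambda>b a. e b \<odot>\<^bsub>A\<^esub> a) \<in> bilinear_hom B A A"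
    by (intro bilinear_homI linear_homI)
      (simp_all add: linear_hom_add[OF l] linear_hom_smult[OF l] T.B.smult_add_left T.B.smult_add_right T.B.smult_smult mult.commute)
  note p = T.tensor_lift_pure[OF T.B.k_vector_space_axioms bil]
  show "\<lbrakk>a \<in> carrier A; b \<in> carrier B\<rbrakk> \<Longrightarrow> tensor_lift A (\<lambda>b a. e b \<odot>\<^bsub>A\<^esub> a) (pure_tensor B A b a) = e b \<odot>\<^bsub>A\<^esub> a"
    by (rule p)
  show "tensor_lift A (\<lambda>b a. e b \<odot>\<^bsub>A\<^esub> a) \<in> algebra_hom (tensor B A) A"
    by (rule T.tensor_algebra_homI[OF A(1) T.tensor_lift_linear[OF T.B.k_vector_space_axioms bil]])
      (simp_all add: p algebra_homD(4,5)[OF e] T.B.smult_mult_left T.B.smult_mult_right T.B.smult_smult mult.commute)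
qed

context
  fixes E :: "'k::field^'m^'m" and t :: 'k
  assumes E: "invertible E"
begin

abbreviation "eps \<equiv> counit (bilin_bialgebra E)"

lemma counit_props:
  shows counit_hom: "eps \<in> algebra_hom (bilin_algebra E E) scalar_algebra"
    and counit_gen: "eps (bilin_gen E E i j) = (if i = j then 1 else 0)"
proof -
  let ?X = "mat 1 :: 'k^'m^'m"
  have s: "smat scalar_algebra M = M" for M by (simp add: smat_def vec_eq_iff)
  have f: "finsum scalar_algebra g I = (\<Sum>i\<in>I. g i)" if "finite I" for g :: "'i \<Rightarrow> 'k" and I
    using that
  proof (induction I rule: finite_induct)
    interpret k_vector_space "scalar_algebra :: ('k, 'k) module" by (rule k_vector_space_scalar_algebra)
    { case empty show ?case by simp }
    { case (insert x F) then show ?case by (simp add: Pi_def) }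
  qed
  have m: "mmul scalar_algebra M N = M ** N" for M N :: "'k^'m^'m"
    by (simp add: mmul_def matrix_matrix_mult_def f)
  have "bilin_point scalar_algebra E E ?X"
    by (simp add: bilin_point_def form_map_def mat_in_def s m transpose_mat)
  note p = bilin_lift_props[OF E E k_algebra_scalar_algebra this]
  have eq: "eps = presented_lift scalar_algebra (\<lambda>(i, j). ?X $ i $ j)"
    by (simp add: mat_def)
  show "eps \<in> algebra_hom (bilin_algebra E E) scalar_algebra" unfolding eq by (rule p(1))
  show "eps (bilin_gen E E i j) = (if i = j then 1 else 0)" unfolding eq p(2) by (simp add: mat_def)
qed

lemma k_bialgebra_bilin: "k_bialgebra (bilin_bialgebra E)"
proof -
  let ?H = "bilin_bialgebra E" and ?B = "bilin_algebra E E"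
  interpret B: k_algebra ?B by (rule k_algebra_bilin)
  note same = same_bialgebra[of E]
  note t = same_algebra_tensor[OF same same] same_algebra_tensor[OF same same_algebra_refl]
    same_algebra_tensor[OF same_algebra_refl same]
    same_algebra_tensor_lift[OF same] same_algebra_tensor_map[OF same same_algebra_refl]
    same_algebra_tensor_map[OF same_algebra_refl same]
    same_algebra_linear_hom[OF same same_algebra_refl] same_algebra_algebra_hom[OF same same_algebra_refl]
    same_algebra_tensor_assoc[OF same same same]
  have c: "carrier ?H = carrier ?B" "smult ?H = smult ?B" using same by (auto simp: same_algebra_def)
  note d = bilin_delta_hom[OF E E E] and dg = bilin_delta_gen[OF E E E]
  have H: "k_algebra ?H" by (rule same_algebra_k_algebra[OF same_algebra_sym[OF same] B.k_algebra_axioms])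
  interpret T: k_tensor_algebra ?B ?B by (intro k_tensor_algebra.intro k_algebra_bilin)
  have sum_delta': "(\<Oplus>\<^bsub>?B\<^esub>k\<in>UNIV. (if k = j then 1 else 0) \<odot>\<^bsub>?B\<^esub> bilin_gen E E i k) = bilin_gen E E i j" for i j
  proof -
    have "(if k = j then (1::'k) else 0) = (if j = k then 1 else 0)" for k :: 'm by auto
    then show ?thesis using B.finsum_delta[of "bilin_gen E E i" j] by simp
  qed
  have cl: "tensor_lift ?B (\<lambda>a b. eps a \<odot>\<^bsub>?B\<^esub> b) (bilin_delta E E E c) = c" if "c \<in> carrier ?B" for c
  proof (rule bilin_hom_eqI[OF algebra_hom_compose[OF d counit_lift_left(1)[OF k_algebra_bilin k_algebra_bilin counit_hom]] algebra_hom_id _ that, simplified id_apply])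
    show "tensor_lift ?B (\<lambda>a b. eps a \<odot>\<^bsub>?B\<^esub> b) (bilin_delta E E E (bilin_gen E E i j)) = bilin_gen E E i j" for i j
      using B.finsum_delta[of "\<lambda>k. bilin_gen E E k j" i]
      by (simp only: dg linear_hom_finsum[OF algebra_homD(1)[OF counit_lift_left(1)[OF k_algebra_bilin k_algebra_bilin counit_hom]]
         T.k_vector_space_tensor B.k_vector_space_axioms] T.pure_closed bilin_gen_closed finite_UNIV finite
         counit_lift_left(2)[OF k_algebra_bilin k_algebra_bilin counit_hom] counit_gen)
  qed
  have cr: "tensor_lift ?B (\<lambda>a b. eps b \<odot>\<^bsub>?B\<^esub> a) (bilin_delta E E E c) = c" if "c \<in> carrier ?B" for c
  proof (rule bilin_hom_eqI[OF algebra_hom_compose[OF d counit_lift_right(1)[OF k_algebra_bilin k_algebra_bilin counit_hom]] algebra_hom_id _ that, simplified id_apply])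
    show "tensor_lift ?B (\<lambda>a b. eps b \<odot>\<^bsub>?B\<^esub> a) (bilin_delta E E E (bilin_gen E E i j)) = bilin_gen E E i j" for i j
      by (simp only: dg linear_hom_finsum[OF algebra_homD(1)[OF counit_lift_right(1)[OF k_algebra_bilin k_algebra_bilin counit_hom]]
         T.k_vector_space_tensor B.k_vector_space_axioms] T.pure_closed bilin_gen_closed finite_UNIV finite
         counit_lift_right(2)[OF k_algebra_bilin k_algebra_bilin counit_hom] counit_gen sum_delta')
  qed
  show ?thesis
    by (intro k_bialgebra.intro k_coalgebra.intro k_bialgebra_axioms.intro k_coalgebra_axioms.intro H k_algebra_vs[OF H];
        unfold t c structure_maps(1); (intro d algebra_homD(1)[OF d] counit_hom algebra_homD(1)[OF counit_hom])?;
        (rule cl cr bilin_delta_coassoc[OF E E E E]; assumption)?)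
qed

lemma quadratic_comodule_algebra: "right_comodule_algebra (bilin_bialgebra E) (quadratic_comodule E t)"
proof -
  let ?H = "bilin_bialgebra E" and ?B = "bilin_algebra E E"
  let ?V = "quadratic_comodule E t" and ?A = "quadratic_algebra (matrix_inv E) t"
  interpret B: k_algebra ?B by (rule k_algebra_bilin)
  interpret A: k_algebra ?A by (rule k_algebra_quadratic)
  interpret H: k_bialgebra ?H by (rule k_bialgebra_bilin)
  interpret T: k_tensor_algebra ?A ?B by (intro k_tensor_algebra.intro k_algebra_bilin k_algebra_quadratic)
  note same = same_bialgebra[of E] and same2 = same_quadratic[of E t]
  note t = same_algebra_tensor[OF same2 same_algebra_refl] same_algebra_tensor[OF same same_algebra_refl]
    same_algebra_tensor[OF same_algebra_refl same]
    same_algebra_tensor_lift[OF same2] same_algebra_tensor_map[OF same2 same_algebra_refl]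
    same_algebra_tensor_map[OF same_algebra_refl same]
    same_algebra_linear_hom[OF same2 same_algebra_refl] same_algebra_algebra_hom[OF same2 same_algebra_refl]
    same_algebra_tensor_assoc[OF same2 same same]
  have c: "carrier ?V = carrier ?A" "smult ?V = smult ?A" using same2 by (auto simp: same_algebra_def)
  note d = quad_delta_hom[OF E E, of t] and dg = quad_delta_gen[OF E E, of t]
  have V: "k_algebra ?V" by (rule same_algebra_k_algebra[OF same_algebra_sym[OF same2] A.k_algebra_axioms])
  let ?x = "quadratic_gen (matrix_inv E) t"
  have sum_delta': "(\<Oplus>\<^bsub>?A\<^esub>k\<in>UNIV. (if k = j then 1 else 0) \<odot>\<^bsub>?A\<^esub> ?x k) = ?x j" for j
  proof -
    have "(if k = j then (1::'k) else 0) = (if j = k then 1 else 0)" for k :: 'm by auto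
    then show ?thesis using A.finsum_delta[of ?x j] by simp
  qed
  have cr: "tensor_lift ?A (\<lambda>a b. eps b \<odot>\<^bsub>?A\<^esub> a) (quad_delta E E t c) = c" if "c \<in> carrier ?A" for c
  proof (rule quadratic_hom_eqI[OF algebra_hom_compose[OF d counit_lift_right(1)[OF k_algebra_quadratic k_algebra_bilin counit_hom]] algebra_hom_id _ that, simplified id_apply])
    show "tensor_lift ?A (\<lambda>a b. eps b \<odot>\<^bsub>?A\<^esub> a) (quad_delta E E t (?x i)) = ?x i" for i
      by (simp only: dg linear_hom_finsum[OF algebra_homD(1)[OF counit_lift_right(1)[OF k_algebra_quadratic k_algebra_bilin counit_hom]]
         T.k_vector_space_tensor A.k_vector_space_axioms] T.pure_closed bilin_gen_closed quadratic_gen_closed finite_UNIV finite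
         counit_lift_right(2)[OF k_algebra_quadratic k_algebra_bilin counit_hom] counit_gen sum_delta')
  qed
  show ?thesis
    by (intro right_comodule_algebra.intro right_comodule.intro right_comodule_algebra_axioms.intro
        right_comodule_axioms.intro V k_algebra_vs[OF V] H.k_bialgebra_axioms H.k_coalgebra_axioms;
        unfold t c structure_maps(1,5); (intro d algebra_homD(1)[OF d])?;
        (rule cr quad_delta_coassoc[OF E E E E]; assumption)?)
qed

end

section \<open>Functoriality of the tensor product\<close>

lemma tensor_map_compose:
  assumes "k_vector_space V" "k_vector_space W" "k_vector_space V'" "k_vector_space W'"
    "k_vector_space V''" "k_vector_space W''"
    and f: "f \<in> linear_hom V V'" "f' \<in> linear_hom V' V''" and g: "g \<in> linear_hom W W'" "g' \<in> linear_hom W' W''"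
    and X: "X \<in> carrier (tensor V W)"
  shows "tensor_map V'' W'' f' g' (tensor_map V' W' f g X) = tensor_map V'' W'' (\<lambda>x. f' (f x)) (\<lambda>x. g' (g x)) X"
proof -
  note c = linear_hom_closed[OF f(1)] linear_hom_closed[OF g(1)]
  show ?thesis
    by (rule k_tensor.linear_hom_tensor_eqI[OF k_tensor.intro[OF assms(1,2)]
          linear_hom_compose[OF tensor_map_linear[OF assms(1-4) f(1) g(1)] tensor_map_linear[OF assms(3-6) f(2) g(2)]]
          tensor_map_linear[OF assms(1,2,5,6) linear_hom_compose[OF f] linear_hom_compose[OF g]] _ X])
      (simp add: c tensor_map_pure[OF assms(1-4) f(1) g(1)] tensor_map_pure[OF assms(3-6) f(2) g(2)]
        tensor_map_pure[OF assms(1,2,5,6) linear_hom_compose[OF f] linear_hom_compose[OF g]])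
qed

lemma tensor_map_cong:
  assumes "k_vector_space V" "k_vector_space W" "k_vector_space V'" "k_vector_space W'"
    and f: "f \<in> linear_hom V V'" "\<And>v. v \<in> carrier V \<Longrightarrow> f v = f' v"
    and g: "g \<in> linear_hom W W'" "\<And>w. w \<in> carrier W \<Longrightarrow> g w = g' w"
    and X: "X \<in> carrier (tensor V W)"
  shows "tensor_map V' W' f g X = tensor_map V' W' f' g' X"
proof -
  have f': "f' \<in> linear_hom V V'" by (rule linear_hom_cong[OF f assms(1)])
  have g': "g' \<in> linear_hom W W'" by (rule linear_hom_cong[OF g assms(2)])
  show ?thesis
    by (rule k_tensor.linear_hom_tensor_eqI[OF k_tensor.intro[OF assms(1,2)]
          tensor_map_linear[OF assms(1-4) f(1) g(1)] tensor_map_linear[OF assms(1-4) f' g'] _ X])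
      (simp add: tensor_map_pure[OF assms(1-4) f(1) g(1)] tensor_map_pure[OF assms(1-4) f' g'] f(2) g(2))
qed

lemma tensor_map_id:
  assumes "k_vector_space V" "k_vector_space W" "X \<in> carrier (tensor V W)"
    and "\<And>v. v \<in> carrier V \<Longrightarrow> f v = v" "\<And>w. w \<in> carrier W \<Longrightarrow> g w = w"
  shows "tensor_map V W f g X = X"
proof -
  have f: "f \<in> linear_hom V V" by (rule linear_hom_cong[OF linear_hom_id _ assms(1)]) (simp add: assms)
  have g: "g \<in> linear_hom W W" by (rule linear_hom_cong[OF linear_hom_id _ assms(2)]) (simp add: assms)
  have "tensor_map V W f g X = id X"
    by (rule k_tensor.linear_hom_tensor_eqI[OF k_tensor.intro[OF assms(1,2)]
          tensor_map_linear[OF assms(1,2) assms(1,2) f g] linear_hom_id _ assms(3)])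
      (simp add: tensor_map_pure[OF assms(1,2) assms(1,2) f g] assms)
  then show ?thesis by simp
qed

lemma tensor_assoc_natural:
  assumes vs: "k_vector_space U" "k_vector_space V" "k_vector_space W" "k_vector_space U'"
    and f: "f \<in> linear_hom U U'" and X: "X \<in> carrier (tensor (tensor U V) W)"
  shows "tensor_assoc U' V W (tensor_map (tensor U' V) W (tensor_map U' V f id) id X)
    = tensor_map U' (tensor V W) f id (tensor_assoc U V W X)"
proof -
  interpret UV: k_tensor U V by (intro k_tensor.intro vs)
  interpret UV': k_tensor U' V by (intro k_tensor.intro vs)
  interpret VW: k_tensor V W by (intro k_tensor.intro vs)
  note t = UV.k_vector_space_tensor UV'.k_vector_space_tensor VW.k_vector_space_tensor
  note m1 = vs(1,2,4,2) f linear_hom_id[of V]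
  note m2 = t(1) vs(3) t(2) vs(3) tensor_map_linear[OF m1] linear_hom_id[of W]
  note m3 = vs(1) t(3) vs(4) t(3) f linear_hom_id[of "tensor V W"]
  show ?thesis
    by (rule linear_hom_tensor3_eqI[OF vs(1-3)
          linear_hom_compose[OF tensor_map_linear[OF m2] tensor_assoc_linear[OF vs(4,2,3)]]
          linear_hom_compose[OF tensor_assoc_linear[OF vs(1-3)] tensor_map_linear[OF m3]] _ X])
      (simp add: tensor_map_pure[OF m1] tensor_map_pure[OF m2] tensor_map_pure[OF m3]
        tensor_assoc_pure[OF vs(1-3)] tensor_assoc_pure[OF vs(4,2,3)] linear_hom_closed[OF f])
qed

text \<open>
  Injectivity of the associator is needed for the coaction on the cotensor product, which is defined by
  inverting a map.
\<close>

definition tensor_assoc_inv where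
  "tensor_assoc_inv U V W =
     tensor_lift (tensor (tensor U V) W) (\<lambda>u Z.
       tensor_lift (tensor (tensor U V) W) (\<lambda>v w.
         pure_tensor (tensor U V) W (pure_tensor U V u v) w) Z)"

context
  fixes U :: "('k::field, 'u, 'x0) module_scheme"
    and V :: "('k, 'v, 'x1) module_scheme" and W :: "('k, 'w, 'x2) module_scheme"
  assumes vs: "k_vector_space U" "k_vector_space V" "k_vector_space W"
begin

interpretation UV: k_tensor U V by (intro k_tensor.intro vs)
interpretation VW: k_tensor V W by (intro k_tensor.intro vs)
interpretation L: k_tensor "tensor U V" W by (intro k_tensor.intro vs UV.k_vector_space_tensor)
interpretation R: k_tensor U "tensor V W" by (intro k_tensor.intro vs VW.k_vector_space_tensor)

lemma tensor_assoc_inv_inner_bilinear: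
  "u \<in> carrier U \<Longrightarrow> (\<lambda>v w. pure_tensor (tensor U V) W (pure_tensor U V u v) w) \<in> bilinear_hom V W (tensor (tensor U V) W)"
  by (intro bilinear_homI linear_hom_pureI(1) vs UV.k_vector_space_tensor bilinear_homD(1)[OF UV.pure_bilinear]
      bilinear_homD(1)[OF L.pure_bilinear]) auto

lemma tensor_assoc_inv_bilinear:
  "(\<lambda>u Z. tensor_lift (tensor (tensor U V) W) (\<lambda>v w.
     pure_tensor (tensor U V) W (pure_tensor U V u v) w) Z)
   \<in> bilinear_hom U (tensor V W) (tensor (tensor U V) W)"
proof (rule bilinear_homI)
  fix Z assume Z: "Z \<in> carrier (tensor V W)"
  show "(\<lambda>u. tensor_lift (tensor (tensor U V) W) (\<lambda>v w.
     pure_tensor (tensor U V) W (pure_tensor U V u v) w) Z) \<in> linear_hom U (tensor (tensor U V) W)"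
    by (rule VW.tensor_lift_param[OF L.k_vector_space_tensor vs(1) tensor_assoc_inv_inner_bilinear _ Z])
     (auto intro!: linear_hom_pureI(1) vs UV.k_vector_space_tensor bilinear_homD(2)[OF UV.pure_bilinear])
qed (intro VW.tensor_lift_linear L.k_vector_space_tensor tensor_assoc_inv_inner_bilinear)

lemma tensor_assoc_inv_linear:
  "tensor_assoc_inv U V W \<in> linear_hom (tensor U (tensor V W)) (tensor (tensor U V) W)"
  unfolding tensor_assoc_inv_def
  by (rule R.tensor_lift_linear[OF L.k_vector_space_tensor tensor_assoc_inv_bilinear])

lemma tensor_assoc_inv_assoc:
  assumes "X \<in> carrier (tensor (tensor U V) W)"
  shows "tensor_assoc_inv U V W (tensor_assoc U V W X) = X"
proof -
  have "tensor_assoc_inv U V W (pure_tensor U (tensor V W) u (pure_tensor V W v w))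
      = pure_tensor (tensor U V) W (pure_tensor U V u v) w"
    if "u \<in> carrier U" "v \<in> carrier V" "w \<in> carrier W" for u v w
    unfolding tensor_assoc_inv_def using that
    by (subst R.tensor_lift_pure[OF L.k_vector_space_tensor tensor_assoc_inv_bilinear])
      (auto simp: VW.tensor_lift_pure[OF L.k_vector_space_tensor tensor_assoc_inv_inner_bilinear])
  then have "tensor_assoc_inv U V W (tensor_assoc U V W X) = id X"
    by (intro linear_hom_tensor3_eqI[OF vs linear_hom_compose[OF tensor_assoc_linear[OF vs] tensor_assoc_inv_linear]
          linear_hom_id _ assms]) (simp add: tensor_assoc_pure[OF vs])
  then show ?thesis by simp
qed

end

section \<open>Transport of a comodule algebra structure\<close>

lemma inverse_algebra_hom:
  assumes A: "k_algebra A" and f: "f \<in> algebra_hom A B" and bij: "bij_betw f (carrier A) (carrier B)"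
  shows "the_inv_into (carrier A) f \<in> algebra_hom B A"
proof -
  interpret A: k_algebra A by fact
  let ?g = "the_inv_into (carrier A) f"
  have inj: "inj_on f (carrier A)" and im: "f ` carrier A = carrier B" using bij by (auto simp: bij_betw_def)
  have gf: "?g (f x) = x" if "x \<in> carrier A" for x using the_inv_into_f_f[OF inj that] .
  have ex: "\<exists>x\<in>carrier A. y = f x" if "y \<in> carrier B" for y using im that by auto
  note l = algebra_homD(1)[OF f]
  show ?thesis
  proof (rule algebra_homI)
    show "?g \<in> linear_hom B A"
      by (rule linear_homI; drule ex; (drule ex)?)
        (auto simp: gf simp flip: linear_hom_add[OF l] linear_hom_smult[OF l])
    show "?g (x \<otimes>\<^bsub>B\<^esub> y) = ?g x \<otimes>\<^bsub>A\<^esub> ?g y" if "x \<in> carrier B" "y \<in> carrier B" for x y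
      using ex[OF that(1)] ex[OF that(2)] by (auto simp: gf simp flip: algebra_homD(4)[OF f])
    show "?g \<one>\<^bsub>B\<^esub> = \<one>\<^bsub>A\<^esub>" using gf[of "\<one>\<^bsub>A\<^esub>"] by (simp add: algebra_homD(5)[OF f])
  qed
qed

text \<open>
  Here \<open>B\<close> is only known to be an algebra with a map \<open>coact B\<close>; that this map is a coaction is
  inherited from \<open>A\<close> by naturality of the associator.
\<close>

lemma comodule_algebra_transport:
  fixes H :: "('k::field, 'h, 'x) coalgebra_scheme" and A :: "('k, 'a, 'h, 'y) comodule_scheme"
    and B :: "('k, 'b, 'h, 'z) comodule_scheme"
  assumes A: "right_comodule_algebra H A" and B: "k_algebra B"
    and f: "f \<in> algebra_hom A B" and bij: "bij_betw f (carrier A) (carrier B)"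
    and co: "\<And>x. x \<in> carrier A \<Longrightarrow> coact B (f x) = tensor_map B H f id (coact A x)"
  shows "right_comodule_algebra H B" and "the_inv_into (carrier A) f \<in> comodule_algebra_iso H B A"
proof -
  interpret A: right_comodule_algebra H A by fact
  interpret B: k_algebra B by fact
  have Aalg: "k_algebra A" and Halg: "k_algebra H"
    by (rule A.k_algebra_axioms A.H.k_algebra_axioms)+
  let ?g = "the_inv_into (carrier A) f"
  have g: "?g \<in> algebra_hom B A" by (rule inverse_algebra_hom[OF Aalg f bij])
  have inj: "inj_on f (carrier A)" and im: "f ` carrier A = carrier B" using bij by (auto simp: bij_betw_def)
  have gf: "?g (f x) = x" if "x \<in> carrier A" for x using the_inv_into_f_f[OF inj that] .
  have fg: "f (?g y) = y" if "y \<in> carrier B" for y using f_the_inv_into_f_bij_betw[OF bij, of y] that by simp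
  note gc = algebra_homD(3)[OF g] and fc = algebra_homD(3)[OF f]
  have vA: "k_vector_space A" and vB: "k_vector_space B" and vH: "k_vector_space H"
    using Aalg Halg B by auto
  interpret AH: k_tensor_algebra A H by (intro k_tensor_algebra.intro Aalg Halg)
  interpret BH: k_tensor_algebra B H by (intro k_tensor_algebra.intro B Halg)
  interpret HH: k_tensor_algebra H H by (intro k_tensor_algebra.intro Halg)
  note vt = AH.k_vector_space_tensor BH.k_vector_space_tensor HH.k_vector_space_tensor
  note fl = algebra_homD(1)[OF f] and gl = algebra_homD(1)[OF g]
  note hom = tensor_map_algebra_hom[OF Aalg Halg B Halg f algebra_hom_id]
  have coB: "coact B y = tensor_map B H f id (coact A (?g y))" if "y \<in> carrier B" for y
    using co[OF gc[OF that]] fg[OF that] by simp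
  have cohom: "(\<lambda>y. tensor_map B H f id (coact A (?g y))) \<in> algebra_hom B (tensor B H)"
    by (rule algebra_hom_compose[OF algebra_hom_compose[OF g A.coact_hom] hom])
  have colin: "coact B \<in> linear_hom B (tensor B H)"
    by (rule linear_hom_cong[OF algebra_homD(1)[OF cohom] _ vB]) (simp add: coB)
  have coalg: "coact B \<in> algebra_hom B (tensor B H)"
    by (rule algebra_homI[OF colin]) (simp_all add: coB algebra_homD(4,5)[OF cohom])
  have aH: "coact A x \<in> carrier (tensor A H)" if "x \<in> carrier A" for x
    using algebra_homD(3)[OF A.coact_hom that] .
  note m = vA vH vB vH fl linear_hom_id[of H]
  show "right_comodule_algebra H B"
  proof (intro right_comodule_algebra.intro right_comodule.intro right_comodule_algebra_axioms.intro
      right_comodule_axioms.intro B vB A.H.k_bialgebra_axioms A.H.k_coalgebra_axioms colin coalg)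
    fix y assume y: "y \<in> carrier B"
    define a where "a = coact A (?g y)"
    have a: "a \<in> carrier (tensor A H)" using aH[OF gc[OF y]] by (simp add: a_def)
    have cy: "coact B y = tensor_map B H f id a" using coB[OF y] by (simp add: a_def)
    have "tensor_map (tensor B H) H (coact B) id (tensor_map B H f id a)
        = tensor_map (tensor B H) H (\<lambda>x. coact B (f x)) (\<lambda>x. id (id x)) a"
      by (rule tensor_map_compose[OF vA vH vB vH vt(2) vH fl colin linear_hom_id linear_hom_id a])
    also have "\<dots> = tensor_map (tensor B H) H (\<lambda>x. tensor_map B H f id (coact A x)) (\<lambda>x. id (id x)) a"
      by (rule tensor_map_cong[OF vA vH vt(2) vH linear_hom_compose[OF fl colin] _ linear_hom_compose[OF linear_hom_id linear_hom_id] _ a])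
        (simp_all add: co)
    also have "\<dots> = tensor_map (tensor B H) H (tensor_map B H f id) id (tensor_map (tensor A H) H (coact A) id a)"
      by (rule tensor_map_compose[symmetric, OF vA vH vt(1) vH vt(2) vH A.coact_linear tensor_map_linear[OF m] linear_hom_id linear_hom_id a])
    finally have 1: "tensor_map (tensor B H) H (coact B) id (coact B y) = \<dots>" unfolding cy .
    have "tensor_assoc B H H (tensor_map (tensor B H) H (coact B) id (coact B y))
        = tensor_map B (tensor H H) f id (tensor_assoc A H H (tensor_map (tensor A H) H (coact A) id a))"
      unfolding 1
      by (rule tensor_assoc_natural[OF vA vH vH vB fl])
        (rule linear_hom_closed[OF tensor_map_linear[OF vA vH vt(1) vH A.coact_linear linear_hom_id] a])
    also have "\<dots> = tensor_map B (tensor H H) f id (tensor_map A (tensor H H) id (comult H) a)"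
      using A.coact_coassoc[OF gc[OF y]] by (simp add: a_def)
    also have "\<dots> = tensor_map B (tensor H H) (\<lambda>x. f (id x)) (\<lambda>x. id (comult H x)) a"
      by (rule tensor_map_compose[OF vA vH vA vt(3) vB vt(3) linear_hom_id fl A.H.comult_linear linear_hom_id a])
    also have "\<dots> = tensor_map B (tensor H H) id (comult H) (tensor_map B H f id a)"
      by (subst tensor_map_compose[OF vA vH vB vH vB vt(3) fl linear_hom_id linear_hom_id A.H.comult_linear a]) simp
    finally show "tensor_assoc B H H (tensor_map (tensor B H) H (coact B) id (coact B y))
        = tensor_map B (tensor H H) id (comult H) (coact B y)" unfolding cy .
    note eA = counit_lift_right[OF Aalg Halg A.H.counit_hom] and eB = counit_lift_right[OF B Halg A.H.counit_hom]
    have "tensor_lift B (\<lambda>v c. counit H c \<odot>\<^bsub>B\<^esub> v) (tensor_map B H f id a)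
        = f (tensor_lift A (\<lambda>v c. counit H c \<odot>\<^bsub>A\<^esub> v) a)"
      by (rule AH.linear_hom_tensor_eqI[OF linear_hom_compose[OF tensor_map_linear[OF m] algebra_homD(1)[OF eB(1)]]
            linear_hom_compose[OF algebra_homD(1)[OF eA(1)] fl] _ a])
        (simp add: tensor_map_pure[OF m] eA(2) eB(2) fc linear_hom_smult[OF fl])
    also have "\<dots> = y" using A.coact_counit[OF gc[OF y]] fg[OF y] by (simp add: a_def)
    finally show "tensor_lift B (\<lambda>v c. counit H c \<odot>\<^bsub>B\<^esub> v) (coact B y) = y" unfolding cy .
  qed
  have "coact A (?g y) = tensor_map A H ?g id (coact B y)" if y: "y \<in> carrier B" for y
  proof -
    have a: "coact A (?g y) \<in> carrier (tensor A H)" using aH[OF gc[OF y]] .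
    have "tensor_map A H ?g id (coact B y) = tensor_map A H (\<lambda>x. ?g (f x)) (\<lambda>x. id (id x)) (coact A (?g y))"
      unfolding coB[OF y] by (rule tensor_map_compose[OF vA vH vB vH vA vH fl gl linear_hom_id linear_hom_id a])
    also have "\<dots> = coact A (?g y)"
      by (rule tensor_map_id[OF vA vH a]) (simp_all add: gf)
    finally show ?thesis by simp
  qed
  then show "?g \<in> comodule_algebra_iso H B A"
    using g bij_betw_the_inv_into[OF bij] by (simp add: comodule_algebra_iso_def)
qed

section \<open>Contraction against the antipode\<close>

text \<open>
  The linear form \<open>l\<close> witnesses that \<open>\<B>(E,F)\<close> does not vanish.
\<close>

locale bilin_pair =
  fixes E :: "'k::field^'m^'m" and F :: "'k^'n^'n" and t :: 'k and l
  assumes E: "invertible E" and F: "invertible F"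
    and l: "l \<in> linear_hom (bilin_algebra E F) scalar_algebra" and l1: "l \<one>\<^bsub>bilin_algebra E F\<^esub> = 1"
begin

abbreviation "AE \<equiv> quadratic_algebra (matrix_inv E) t"
abbreviation "AF \<equiv> quadratic_algebra (matrix_inv F) t"
abbreviation "BEE \<equiv> bilin_algebra E E"
abbreviation "BEF \<equiv> bilin_algebra E F"
abbreviation "BFE \<equiv> bilin_algebra F E"
abbreviation "BFF \<equiv> bilin_algebra F F"
abbreviation "xE \<equiv> quadratic_gen (matrix_inv E) t"
abbreviation "xF \<equiv> quadratic_gen (matrix_inv F) t"

interpretation B: k_algebra BEF by (rule k_algebra_bilin)
interpretation B': k_algebra BFE by (rule k_algebra_bilin)

lemma antipode_linear: "antipode E F \<in> linear_hom BFE BEF"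
  using algebra_homD(1)[OF antipode_hom[OF E F]] by (simp add: linear_hom_def)

lemma antipode_mult: "\<lbrakk>x \<in> carrier BFE; y \<in> carrier BFE\<rbrakk>
    \<Longrightarrow> antipode E F (x \<otimes>\<^bsub>BFE\<^esub> y) = antipode E F y \<otimes>\<^bsub>BEF\<^esub> antipode E F x"
  and antipode_one: "antipode E F \<one>\<^bsub>BFE\<^esub> = \<one>\<^bsub>BEF\<^esub>"
  using algebra_homD(4,5)[OF antipode_hom[OF E F]] by simp_all

lemmas antipode_cl = antipode_closed[OF E F]

lemma l_form_linear:
  "b \<in> carrier BEF \<Longrightarrow> (\<lambda>c. l (antipode E F c \<otimes>\<^bsub>BEF\<^esub> b)) \<in> linear_hom BFE scalar_algebra"
  "c \<in> carrier BFE \<Longrightarrow> (\<lambda>b. l (antipode E F c \<otimes>\<^bsub>BEF\<^esub> b)) \<in> linear_hom BEF scalar_algebra"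
  by (rule linear_homI; simp add: linear_hom_add[OF antipode_linear] linear_hom_smult[OF antipode_linear]
      antipode_cl B.A.l_distr B.A.r_distr B.smult_mult_left B.smult_mult_right linear_hom_add[OF l] linear_hom_smult[OF l])+

text \<open>
  The second factor is contracted with \<open>c \<mapsto> l (S(c) b)\<close>, so that \<open>b = a u\<close> brings the relation
  \<open>S(a) a = 1\<close> into play.
\<close>

definition contr :: "('k, 'y, 'z) module_scheme \<Rightarrow> _ \<Rightarrow> ('y, ('n \<times> 'm, 'k) free_alg set, 'k) tensor \<Rightarrow> 'y" where
  "contr Y b = tensor_lift Y (\<lambda>y c. l (antipode E F c \<otimes>\<^bsub>BEF\<^esub> b) \<odot>\<^bsub>Y\<^esub> y)"

lemma contr_bilinear:
  assumes "k_vector_space Y" "b \<in> carrier BEF"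
  shows "(\<lambda>y c. l (antipode E F c \<otimes>\<^bsub>BEF\<^esub> b) \<odot>\<^bsub>Y\<^esub> y) \<in> bilinear_hom Y BFE Y"
proof -
  interpret Y: k_vector_space Y by fact
  show ?thesis
    by (intro bilinear_homI linear_homI)
      (simp_all add: linear_hom_add[OF l_form_linear(1)[OF assms(2)]] linear_hom_smult[OF l_form_linear(1)[OF assms(2)]]
        Y.smult_add_left Y.smult_add_right Y.smult_smult mult.commute)
qed

lemma contr_linear:
  assumes "k_vector_space Y" "b \<in> carrier BEF"
  shows "contr Y b \<in> linear_hom (tensor Y BFE) Y"
  unfolding contr_def
  by (intro k_tensor.tensor_lift_linear k_tensor.intro contr_bilinear assms B'.k_vector_space_axioms)

lemma contr_pure:
  assumes "k_vector_space Y" "b \<in> carrier BEF" "y \<in> carrier Y" "c \<in> carrier BFE"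
  shows "contr Y b (pure_tensor Y BFE y c) = l (antipode E F c \<otimes>\<^bsub>BEF\<^esub> b) \<odot>\<^bsub>Y\<^esub> y"
  unfolding contr_def
  by (intro k_tensor.tensor_lift_pure k_tensor.intro contr_bilinear assms B'.k_vector_space_axioms)

lemma contr_linear_right:
  assumes Y: "k_vector_space Y" and z: "z \<in> carrier (tensor Y BFE)"
  shows "(\<lambda>b. contr Y b z) \<in> linear_hom BEF Y"
proof -
  interpret Y: k_vector_space Y by fact
  interpret T: k_tensor Y BFE by (intro k_tensor.intro Y B'.k_vector_space_axioms)
  show ?thesis unfolding contr_def
  proof (rule T.tensor_lift_param[OF Y B.k_vector_space_axioms contr_bilinear[OF Y] _ z])
    fix y c assume "y \<in> carrier Y" "c \<in> carrier BFE"
    then show "(\<lambda>b. l (antipode E F c \<otimes>\<^bsub>BEF\<^esub> b) \<odot>\<^bsub>Y\<^esub> y) \<in> linear_hom BEF Y"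
      by (intro linear_homI) (simp_all add: linear_hom_add[OF l_form_linear(2)] linear_hom_smult[OF l_form_linear(2)]
        Y.smult_add_left Y.smult_smult)
  qed
qed

text \<open>
  \<open>S(c0 c) b = S(c) (S(c0) b)\<close>, since the antipode reverses products.
\<close>

lemma contr_mult:
  assumes Y: "k_algebra Y" and b: "b \<in> carrier BEF" and y0: "y0 \<in> carrier Y" and c0: "c0 \<in> carrier BFE"
    and z: "z \<in> carrier (tensor Y BFE)"
  shows "contr Y b (pure_tensor Y BFE y0 c0 \<otimes>\<^bsub>tensor Y BFE\<^esub> z)
    = y0 \<otimes>\<^bsub>Y\<^esub> contr Y (antipode E F c0 \<otimes>\<^bsub>BEF\<^esub> b) z"
proof -
  interpret Y: k_algebra Y by fact
  interpret T: k_tensor_algebra Y BFE by (intro k_tensor_algebra.intro Y k_algebra_bilin)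
  interpret TA: k_algebra "tensor Y BFE" by (rule T.k_algebra_tensor)
  note v = Y.k_vector_space_axioms
  have sb: "antipode E F c0 \<otimes>\<^bsub>BEF\<^esub> b \<in> carrier BEF" using b c0 by (simp add: antipode_cl)
  note lin = contr_linear[OF v b] contr_linear[OF v sb]
  show ?thesis using z
  proof (induction z rule: T.tensor_induct)
    case (pure y c)
    then show ?case using y0 c0 b sb
      by (simp add: T.pure_mult contr_pure[OF v] antipode_mult antipode_cl B.A.m_assoc Y.smult_mult_right)
  next
    case (add z z')
    then show ?case using y0 c0
      by (simp add: TA.A.r_distr linear_hom_add[OF lin(1)] linear_hom_add[OF lin(2)] Y.A.r_distr
          linear_hom_closed[OF lin(2)])
  qed
qed

text \<open>
  \<open>r \<otimes> b \<mapsto> contr Y b (\<Lambda> r)\<close>.  It is used for the quadratic algebras, giving \<open>g\<close>, and for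
  \<open>\<B>(E) \<otimes> \<B>(E,F)\<close>, giving \<open>ell\<close>.
\<close>

definition pairing_map where
  "pairing_map Y \<Lambda> = tensor_lift Y (\<lambda>r b. contr Y b (\<Lambda> r))"

context
  fixes R :: "('k, 'r, 'z1) module_scheme" and Y :: "('k, 'y, 'z2) module_scheme" and \<Lambda>
  assumes R: "k_algebra R" and Y: "k_algebra Y" and \<Lambda>: "\<Lambda> \<in> algebra_hom R (tensor Y BFE)"
begin

interpretation R: k_algebra R by (rule R)
interpretation Y: k_algebra Y by (rule Y)
interpretation T: k_tensor_algebra R BEF by (intro k_tensor_algebra.intro R k_algebra_bilin)
interpretation T': k_tensor_algebra Y BFE by (intro k_tensor_algebra.intro Y k_algebra_bilin)
interpretation TA: k_algebra "tensor R BEF" by (rule T.k_algebra_tensor)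
interpretation TA': k_algebra "tensor Y BFE" by (rule T'.k_algebra_tensor)

lemma pairing_bilinear: "(\<lambda>r b. contr Y b (\<Lambda> r)) \<in> bilinear_hom R BEF Y"
  by (intro bilinear_homI contr_linear_right linear_hom_compose[OF algebra_homD(1)[OF \<Lambda>] contr_linear]
      algebra_homD(3)[OF \<Lambda>] Y.k_vector_space_axioms)

lemma pairing_linear: "pairing_map Y \<Lambda> \<in> linear_hom (tensor R BEF) Y"
  unfolding pairing_map_def by (rule T.tensor_lift_linear[OF Y.k_vector_space_axioms pairing_bilinear])

lemma pairing_pure: "\<lbrakk>r \<in> carrier R; b \<in> carrier BEF\<rbrakk> \<Longrightarrow> pairing_map Y \<Lambda> (pure_tensor R BEF r b) = contr Y b (\<Lambda> r)"
  unfolding pairing_map_def by (rule T.tensor_lift_pure[OF Y.k_vector_space_axioms pairing_bilinear])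

lemma pairing_one: "pairing_map Y \<Lambda> \<one>\<^bsub>tensor R BEF\<^esub> = \<one>\<^bsub>Y\<^esub>"
  by (simp add: T.tensor_one pairing_pure algebra_homD(5)[OF \<Lambda>] T'.tensor_one contr_pure Y.k_vector_space_axioms
      antipode_one l1)

text \<open>
  On \<open>u = x \<otimes> b\<close> the left side is
  \<open>\<Sum>\<^sub>k y\<^sub>k contr Y (\<Sum>\<^sub>i S(a\<^sub>k\<^sub>i) a\<^sub>i\<^sub>j b) (\<Lambda> x)\<close>, and the inner sum is \<open>\<delta>\<^sub>k\<^sub>j b\<close>.
\<close>

lemma pairing_mult:
  assumes r: "\<And>i. r i \<in> carrier R" and y: "\<And>k. y k \<in> carrier Y"
    and gen: "\<And>i. \<Lambda> (r i) = (\<Oplus>\<^bsub>tensor Y BFE\<^esub>k\<in>UNIV. pure_tensor Y BFE (y k) (bilin_gen F E k i))"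
    and u: "u \<in> carrier (tensor R BEF)"
  shows "pairing_map Y \<Lambda> ((\<Oplus>\<^bsub>tensor R BEF\<^esub>i\<in>UNIV. pure_tensor R BEF (r i) (bilin_gen E F i j)) \<otimes>\<^bsub>tensor R BEF\<^esub> u)
    = y j \<otimes>\<^bsub>Y\<^esub> pairing_map Y \<Lambda> u"
  using u
proof (induction u rule: T.tensor_induct)
  case (pure x b)
  note Yv = Y.k_vector_space_axioms
  have L: "\<Lambda> x \<in> carrier (tensor Y BFE)" using algebra_homD(3)[OF \<Lambda> pure(1)] .
  note cr = contr_linear_right[OF Yv L]
  let ?a = "bilin_gen E F" and ?s = "\<lambda>k i. antipode E F (bilin_gen F E k i)"
  have ab: "?a i j \<otimes>\<^bsub>BEF\<^esub> b \<in> carrier BEF" for i using pure by simp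
  have sc: "?s k i \<in> carrier BEF" for k i by (simp add: antipode_cl)
  have cc: "contr Y b' (\<Lambda> x) \<in> carrier Y" if "b' \<in> carrier BEF" for b' using linear_hom_closed[OF cr that] .
  have "pairing_map Y \<Lambda> (pure_tensor R BEF (r i) (?a i j) \<otimes>\<^bsub>tensor R BEF\<^esub> pure_tensor R BEF x b)
      = (\<Oplus>\<^bsub>Y\<^esub>k\<in>UNIV. y k \<otimes>\<^bsub>Y\<^esub> contr Y (?s k i \<otimes>\<^bsub>BEF\<^esub> (?a i j \<otimes>\<^bsub>BEF\<^esub> b)) (\<Lambda> x))" for i
  proof -
    have "pairing_map Y \<Lambda> (pure_tensor R BEF (r i) (?a i j) \<otimes>\<^bsub>tensor R BEF\<^esub> pure_tensor R BEF x b)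
        = contr Y (?a i j \<otimes>\<^bsub>BEF\<^esub> b) (\<Lambda> (r i) \<otimes>\<^bsub>tensor Y BFE\<^esub> \<Lambda> x)"
      using pure r by (simp add: T.pure_mult pairing_pure algebra_homD(4)[OF \<Lambda>])
    also have "\<dots> = contr Y (?a i j \<otimes>\<^bsub>BEF\<^esub> b)
        (\<Oplus>\<^bsub>tensor Y BFE\<^esub>k\<in>UNIV. pure_tensor Y BFE (y k) (bilin_gen F E k i) \<otimes>\<^bsub>tensor Y BFE\<^esub> \<Lambda> x)"
      unfolding gen using y L by (subst TA'.A.finsum_ldistr) auto
    also have "\<dots> = (\<Oplus>\<^bsub>Y\<^esub>k\<in>UNIV. contr Y (?a i j \<otimes>\<^bsub>BEF\<^esub> b)
        (pure_tensor Y BFE (y k) (bilin_gen F E k i) \<otimes>\<^bsub>tensor Y BFE\<^esub> \<Lambda> x))"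
      using y L by (intro linear_hom_finsum[OF contr_linear[OF Yv ab] TA'.k_vector_space_axioms Yv]) auto
    finally show ?thesis using y L by (simp add: contr_mult[OF Y ab])
  qed
  then have "pairing_map Y \<Lambda> ((\<Oplus>\<^bsub>tensor R BEF\<^esub>i\<in>UNIV. pure_tensor R BEF (r i) (?a i j)) \<otimes>\<^bsub>tensor R BEF\<^esub> pure_tensor R BEF x b)
      = (\<Oplus>\<^bsub>Y\<^esub>i\<in>UNIV. \<Oplus>\<^bsub>Y\<^esub>k\<in>UNIV. y k \<otimes>\<^bsub>Y\<^esub> contr Y (?s k i \<otimes>\<^bsub>BEF\<^esub> (?a i j \<otimes>\<^bsub>BEF\<^esub> b)) (\<Lambda> x))"
    using r pure
    by (simp add: TA.A.finsum_ldistr linear_hom_finsum[OF pairing_linear TA.k_vector_space_axioms Yv])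
  also have "\<dots> = (\<Oplus>\<^bsub>Y\<^esub>k\<in>UNIV. \<Oplus>\<^bsub>Y\<^esub>i\<in>UNIV. y k \<otimes>\<^bsub>Y\<^esub> contr Y (?s k i \<otimes>\<^bsub>BEF\<^esub> (?a i j \<otimes>\<^bsub>BEF\<^esub> b)) (\<Lambda> x))"
    using y ab sc by (intro Y.finsum_swap) (auto intro!: Y.A.m_closed cc)
  also have "\<dots> = (\<Oplus>\<^bsub>Y\<^esub>k\<in>UNIV. (if j = k then 1 else 0) \<odot>\<^bsub>Y\<^esub> (y k \<otimes>\<^bsub>Y\<^esub> contr Y b (\<Lambda> x)))"
  proof -
    have "(\<Oplus>\<^bsub>Y\<^esub>i\<in>UNIV. y k \<otimes>\<^bsub>Y\<^esub> contr Y (?s k i \<otimes>\<^bsub>BEF\<^esub> (?a i j \<otimes>\<^bsub>BEF\<^esub> b)) (\<Lambda> x))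
        = (if j = k then 1 else 0) \<odot>\<^bsub>Y\<^esub> (y k \<otimes>\<^bsub>Y\<^esub> contr Y b (\<Lambda> x))" for k
    proof -
      have "(\<Oplus>\<^bsub>Y\<^esub>i\<in>UNIV. y k \<otimes>\<^bsub>Y\<^esub> contr Y (?s k i \<otimes>\<^bsub>BEF\<^esub> (?a i j \<otimes>\<^bsub>BEF\<^esub> b)) (\<Lambda> x))
          = y k \<otimes>\<^bsub>Y\<^esub> (\<Oplus>\<^bsub>Y\<^esub>i\<in>UNIV. contr Y (?s k i \<otimes>\<^bsub>BEF\<^esub> (?a i j \<otimes>\<^bsub>BEF\<^esub> b)) (\<Lambda> x))"
        using y ab sc by (subst Y.A.finsum_rdistr) (auto intro!: cc)
      also have "(\<Oplus>\<^bsub>Y\<^esub>i\<in>UNIV. contr Y (?s k i \<otimes>\<^bsub>BEF\<^esub> (?a i j \<otimes>\<^bsub>BEF\<^esub> b)) (\<Lambda> x))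
          = contr Y (\<Oplus>\<^bsub>BEF\<^esub>i\<in>UNIV. ?s k i \<otimes>\<^bsub>BEF\<^esub> (?a i j \<otimes>\<^bsub>BEF\<^esub> b)) (\<Lambda> x)"
        using ab sc by (intro linear_hom_finsum[symmetric, OF cr B.k_vector_space_axioms Yv]) auto
      also have "(\<Oplus>\<^bsub>BEF\<^esub>i\<in>UNIV. ?s k i \<otimes>\<^bsub>BEF\<^esub> (?a i j \<otimes>\<^bsub>BEF\<^esub> b))
          = (\<Oplus>\<^bsub>BEF\<^esub>i\<in>UNIV. ?s k i \<otimes>\<^bsub>BEF\<^esub> ?a i j) \<otimes>\<^bsub>BEF\<^esub> b"
        using pure sc by (subst B.A.finsum_ldistr) (auto simp: B.A.m_assoc)
      also have "\<dots> = (if j = k then 1 else 0) \<odot>\<^bsub>BEF\<^esub> b"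
        unfolding antipode_gen_left[OF E F] using pure by (simp add: B.scalar_mult_left)
      finally show ?thesis
        using pure y cc by (simp add: linear_hom_smult[OF cr] Y.smult_mult_right)
    qed
    then show ?thesis by simp
  qed
  also have "\<dots> = y j \<otimes>\<^bsub>Y\<^esub> contr Y b (\<Lambda> x)"
    using pure y cc by (intro Y.finsum_delta) simp
  finally show ?case using pure by (simp add: pairing_pure)
next
  case (add u u')
  have s: "(\<Oplus>\<^bsub>tensor R BEF\<^esub>i\<in>UNIV. pure_tensor R BEF (r i) (bilin_gen E F i j)) \<in> carrier (tensor R BEF)"
    using r by (intro TA.M.finsum_closed) auto
  then show ?case using add y
    by (simp add: TA.A.r_distr linear_hom_add[OF pairing_linear] linear_hom_closed[OF pairing_linear] Y.A.r_distr)
qed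

end

section \<open>The isomorphism\<close>

abbreviation "T \<equiv> tensor AE BEF"
abbreviation "f \<equiv> quad_delta E F t"
abbreviation "g \<equiv> pairing_map AF (quad_delta F E t)"

interpretation T: k_tensor_algebra AE BEF
  by (intro k_tensor_algebra.intro k_algebra_quadratic k_algebra_bilin)
interpretation TA: k_algebra T by (rule T.k_algebra_tensor)
interpretation AF: k_algebra AF by (rule k_algebra_quadratic)
interpretation AE: k_algebra AE by (rule k_algebra_quadratic)
interpretation EF: k_tensor_algebra BEE BEF by (intro k_tensor_algebra.intro k_algebra_bilin)

lemmas f_hom = quad_delta_hom[OF E F, of t]
lemmas g_linear = pairing_linear[OF k_algebra_quadratic k_algebra_quadratic quad_delta_hom[OF F E, of t]]
lemmas g_pure = pairing_pure[OF k_algebra_quadratic k_algebra_quadratic quad_delta_hom[OF F E, of t]]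

lemma g_f: "y \<in> carrier AF \<Longrightarrow> g (f y) = y"
proof (induction y rule: quadratic_induct)
  case one
  show ?case using pairing_one[OF k_algebra_quadratic k_algebra_quadratic quad_delta_hom[OF F E, of t]]
    by (simp add: algebra_homD(5)[OF f_hom])
next
  case (gen j y)
  have "g (f (xF j \<otimes>\<^bsub>AF\<^esub> y)) = g ((\<Oplus>\<^bsub>T\<^esub>i\<in>UNIV. pure_tensor AE BEF (xE i) (bilin_gen E F i j)) \<otimes>\<^bsub>T\<^esub> f y)"
    using gen by (simp add: algebra_homD(4)[OF f_hom] quad_delta_gen[OF E F])
  also have "\<dots> = xF j \<otimes>\<^bsub>AF\<^esub> g (f y)"
    by (rule pairing_mult[OF k_algebra_quadratic k_algebra_quadratic quad_delta_hom[OF F E, of t]])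
      (simp_all add: quad_delta_gen[OF F E] algebra_homD(3)[OF f_hom] gen)
  finally show ?case using gen by simp
next
  case (add x y)
  then show ?case
    by (simp add: linear_hom_add[OF algebra_homD(1)[OF f_hom]] algebra_homD(3)[OF f_hom] linear_hom_add[OF g_linear])
next
  case (smult c y)
  then show ?case
    by (simp add: linear_hom_smult[OF algebra_homD(1)[OF f_hom]] algebra_homD(3)[OF f_hom] linear_hom_smult[OF g_linear])
qed

abbreviation "ell \<equiv> pairing_map BEF (bilin_delta E F E)"

lemmas ell_linear = pairing_linear[OF k_algebra_bilin k_algebra_bilin bilin_delta_hom[OF E F E]]
lemmas ell_pure = pairing_pure[OF k_algebra_bilin k_algebra_bilin bilin_delta_hom[OF E F E]]

lemma ell_left_coaction: "b \<in> carrier BEF \<Longrightarrow> ell (bilin_delta E E F b) = b"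
proof (induction b rule: bilin_induct)
  note d = bilin_delta_hom[OF E E F]
  { case one
    show ?case using pairing_one[OF k_algebra_bilin k_algebra_bilin bilin_delta_hom[OF E F E]]
      by (simp add: algebra_homD(5)[OF d]) }
  { case (gen p j b)
    have "ell (bilin_delta E E F (bilin_gen E F p j \<otimes>\<^bsub>BEF\<^esub> b))
        = ell ((\<Oplus>\<^bsub>tensor BEE BEF\<^esub>i\<in>UNIV. pure_tensor BEE BEF (bilin_gen E E p i) (bilin_gen E F i j)) \<otimes>\<^bsub>tensor BEE BEF\<^esub> bilin_delta E E F b)"
      using gen by (simp add: algebra_homD(4)[OF d] bilin_delta_gen[OF E E F])
    also have "\<dots> = bilin_gen E F p j \<otimes>\<^bsub>BEF\<^esub> ell (bilin_delta E E F b)"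
      by (rule pairing_mult[OF k_algebra_bilin k_algebra_bilin bilin_delta_hom[OF E F E]])
        (simp_all add: bilin_delta_gen[OF E F E] algebra_homD(3)[OF d] gen)
    finally show ?case using gen by simp }
  { case (add x y)
    then show ?case
      by (simp add: linear_hom_add[OF algebra_homD(1)[OF d]] algebra_homD(3)[OF d] linear_hom_add[OF ell_linear]) }
  { case (smult c y)
    then show ?case
      by (simp add: linear_hom_smult[OF algebra_homD(1)[OF d]] algebra_homD(3)[OF d] linear_hom_smult[OF ell_linear]) }
qed

end

lemma k_algebra_equalizer:
  assumes A: "k_algebra A" "k_algebra B" and p: "p \<in> algebra_hom A B" and q: "q \<in> algebra_hom A B"
  shows "k_algebra (A\<lparr>carrier := {x \<in> carrier A. p x = q x}\<rparr>)"
proof -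
  interpret A: k_algebra A by fact
  interpret B: k_algebra B by fact
  let ?S = "{x \<in> carrier A. p x = q x}"
  have "submodule ?S scalar_algebra A"
    by (rule A.subspaceI)
      (simp_all add: linear_hom_add[OF algebra_homD(1)[OF p]] linear_hom_add[OF algebra_homD(1)[OF q]]
        linear_hom_smult[OF algebra_homD(1)[OF p]] linear_hom_smult[OF algebra_homD(1)[OF q]]
        linear_hom_zero[OF algebra_homD(1)[OF p] A.k_vector_space_axioms B.k_vector_space_axioms]
        linear_hom_zero[OF algebra_homD(1)[OF q] A.k_vector_space_axioms B.k_vector_space_axioms])
  then have "k_vector_space (A\<lparr>carrier := ?S\<rparr>)"
    by (rule k_vector_space_subspace[OF A.k_vector_space_axioms])
  then show ?thesis
    by (rule k_algebraI)
      (simp_all add: algebra_homD(4,5)[OF p] algebra_homD(4,5)[OF q] A.A.m_assoc A.A.l_distr A.A.r_distr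
        A.smult_mult_left A.smult_mult_right)
qed

context bilin_pair
begin

interpretation AF: k_algebra AF by (rule k_algebra_quadratic)
interpretation AE: k_algebra AE by (rule k_algebra_quadratic)
interpretation B: k_algebra BEF by (rule k_algebra_bilin)
interpretation B': k_algebra BFE by (rule k_algebra_bilin)
interpretation T: k_tensor_algebra AE BEF
  by (intro k_tensor_algebra.intro k_algebra_quadratic k_algebra_bilin)
interpretation TA: k_algebra T by (rule T.k_algebra_tensor)

lemma contr_natural:
  assumes Y: "k_vector_space Y" "k_vector_space Y'" and h: "h \<in> linear_hom Y Y'" and b: "b \<in> carrier BEF"
    and z: "z \<in> carrier (tensor Y BFE)"
  shows "h (contr Y b z) = contr Y' b (tensor_map Y' BFE h id z)"
proof -
  note m = Y(1) B'.k_vector_space_axioms Y(2) B'.k_vector_space_axioms h linear_hom_id[of BFE]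
  show ?thesis
    by (rule k_tensor.linear_hom_tensor_eqI[OF k_tensor.intro[OF Y(1) B'.k_vector_space_axioms]
          linear_hom_compose[OF contr_linear[OF Y(1) b] h]
          linear_hom_compose[OF tensor_map_linear[OF m] contr_linear[OF Y(2) b]] _ z])
      (simp add: tensor_map_pure[OF m] contr_pure[OF Y(1) b] contr_pure[OF Y(2) b] linear_hom_closed[OF h]
        linear_hom_smult[OF h])
qed

text \<open>
  Both sides map \<open>v \<otimes> y \<otimes> c\<close> to \<open>l (S(c) b) (v \<otimes> y)\<close>.
\<close>

lemma contr_assoc:
  assumes V: "k_vector_space V" and b: "b \<in> carrier BEF" and w: "w \<in> carrier (tensor (tensor V BEF) BFE)"
  shows "contr (tensor V BEF) b w = tensor_map V BEF id (contr BEF b) (tensor_assoc V BEF BFE w)"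
proof -
  interpret VB: k_tensor V BEF by (intro k_tensor.intro V B.k_vector_space_axioms)
  interpret BB: k_tensor BEF BFE by (intro k_tensor.intro B.k_vector_space_axioms B'.k_vector_space_axioms)
  note v = VB.k_vector_space_tensor
  note a3 = V B.k_vector_space_axioms B'.k_vector_space_axioms
  note m = V BB.k_vector_space_tensor V B.k_vector_space_axioms linear_hom_id[of V] contr_linear[OF B.k_vector_space_axioms b]
  show ?thesis
    by (rule linear_hom_tensor3_eqI[OF a3 contr_linear[OF v b]
          linear_hom_compose[OF tensor_assoc_linear[OF a3] tensor_map_linear[OF m]] _ w])
      (simp add: contr_pure[OF v b] tensor_assoc_pure[OF a3] tensor_map_pure[OF m]
        contr_pure[OF B.k_vector_space_axioms b] linear_hom_smult[OF bilinear_homD(1)[OF VB.pure_bilinear]])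
qed

abbreviation "rho \<equiv> quad_delta E E t"

text \<open>
  On \<open>x \<otimes> b\<close>: move \<open>f\<close> inside the contraction, use coassociativity of the chain \<open>E\<close>, \<open>F\<close>, \<open>E\<close> to
  replace \<open>(f \<otimes> id)\<close> after the map into \<open>\<A>\<^bsub>F\<^sup>-\<^sup>1,t\<^esub> \<otimes> \<B>(F,E)\<close> by \<open>(id \<otimes> \<Delta>) \<circ> \<rho>\<close>, and read the result
  as \<open>ell\<close>.
\<close>

lemma f_g_eq:
  assumes "u \<in> carrier T"
  shows "f (g u) = tensor_map AE BEF id ell (tensor_assoc AE BEE BEF (tensor_map (tensor AE BEE) BEF rho id u))"
proof -
  interpret AB: k_tensor_algebra AE BEE by (intro k_tensor_algebra.intro k_algebra_quadratic k_algebra_bilin)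
  interpret BB: k_tensor_algebra BEE BEF by (intro k_tensor_algebra.intro k_algebra_bilin)
  interpret BF: k_tensor_algebra BEF BFE by (intro k_tensor_algebra.intro k_algebra_bilin)
  interpret AFB: k_tensor_algebra AF BFE by (intro k_tensor_algebra.intro k_algebra_quadratic k_algebra_bilin)
  note fl = algebra_homD(1)[OF f_hom]
  note rho = quad_delta_hom[OF E E, of t] and G = quad_delta_hom[OF F E, of t]
  note del = algebra_homD(1)[OF bilin_delta_hom[OF E F E]]
  note va = AE.k_vector_space_axioms AB.B.k_vector_space_axioms B.k_vector_space_axioms
  note m1 = va(1,3) AB.k_vector_space_tensor va(3) algebra_homD(1)[OF rho] linear_hom_id[of BEF]
  note m2 = va(1) BB.k_vector_space_tensor va(1,3) linear_hom_id[of AE] ell_linear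
  have rhs: "(\<lambda>u. tensor_map AE BEF id ell (tensor_assoc AE BEE BEF (tensor_map (tensor AE BEE) BEF rho id u))) \<in> linear_hom T T"
    by (rule linear_hom_compose[OF linear_hom_compose[OF tensor_map_linear[OF m1] tensor_assoc_linear[OF va]] tensor_map_linear[OF m2]])
  show ?thesis
  proof (rule T.linear_hom_tensor_eqI[OF linear_hom_compose[OF g_linear fl] rhs _ assms])
    fix x b assume x: "x \<in> carrier AE" and b: "b \<in> carrier BEF"
    have r: "rho x \<in> carrier (tensor AE BEE)" using algebra_homD(3)[OF rho x] .
    have Gx: "quad_delta F E t x \<in> carrier (tensor AF BFE)" using algebra_homD(3)[OF G x] .
    note cl = contr_linear[OF B.k_vector_space_axioms b]
    note dc = linear_hom_compose[OF del cl]
    note m3 = va(1,2) va(1,3) linear_hom_id[of AE] dc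
    have "f (g (pure_tensor AE BEF x b)) = contr T b (tensor_map T BFE f id (quad_delta F E t x))"
      using contr_natural[OF AF.k_vector_space_axioms TA.k_vector_space_axioms fl b Gx] by (simp add: g_pure x b)
    also have "\<dots> = tensor_map AE BEF id (contr BEF b) (tensor_assoc AE BEF BFE (tensor_map T BFE f id (quad_delta F E t x)))"
      by (rule contr_assoc[OF va(1) b])
        (rule linear_hom_closed[OF tensor_map_linear[OF AF.k_vector_space_axioms B'.k_vector_space_axioms TA.k_vector_space_axioms
              B'.k_vector_space_axioms fl linear_hom_id] Gx])
    also have "\<dots> = tensor_map AE BEF id (contr BEF b) (tensor_map AE (tensor BEF BFE) id (bilin_delta E F E) (rho x))"
      using quad_delta_coassoc[OF E F E E x] by simp
    also have "\<dots> = tensor_map AE BEF (\<lambda>x. id (id x)) (\<lambda>c. contr BEF b (bilin_delta E F E c)) (rho x)"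
      by (rule tensor_map_compose[OF va(1,2) va(1) BF.k_vector_space_tensor va(1,3) linear_hom_id linear_hom_id del cl r])
    also have "\<dots> = tensor_map AE BEF id (\<lambda>c. contr BEF b (bilin_delta E F E c)) (rho x)"
      by (rule tensor_map_cong[OF va(1,2,1,3) linear_hom_compose[OF linear_hom_id linear_hom_id] _ dc _ r]) simp_all
    also have "\<dots> = tensor_map AE BEF id ell (tensor_assoc AE BEE BEF (pure_tensor (tensor AE BEE) BEF (rho x) b))"
    proof (rule AB.linear_hom_tensor_eqI[OF tensor_map_linear[OF m3] _ _ r])
      show "(\<lambda>z. tensor_map AE BEF id ell (tensor_assoc AE BEE BEF (pure_tensor (tensor AE BEE) BEF z b))) \<in> linear_hom (tensor AE BEE) T"
        by (rule linear_hom_compose[OF linear_hom_compose[OF linear_hom_pureI(1)[OF AB.k_vector_space_tensor va(3) linear_hom_id b, unfolded id_apply]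
                tensor_assoc_linear[OF va]] tensor_map_linear[OF m2]])
      show "tensor_map AE BEF id (\<lambda>c. contr BEF b (bilin_delta E F E c)) (pure_tensor AE BEE y c)
          = tensor_map AE BEF id ell (tensor_assoc AE BEE BEF (pure_tensor (tensor AE BEE) BEF (pure_tensor AE BEE y c) b))"
        if "y \<in> carrier AE" "c \<in> carrier BEE" for y c
        using that b by (simp add: tensor_map_pure[OF m3] tensor_assoc_pure[OF va] tensor_map_pure[OF m2] ell_pure)
    qed
    finally show "f (g (pure_tensor AE BEF x b))
        = tensor_map AE BEF id ell (tensor_assoc AE BEE BEF (tensor_map (tensor AE BEE) BEF rho id (pure_tensor AE BEF x b)))"
      using x b by (simp add: tensor_map_pure[OF m1])
  qed
qed

section \<open>The cotensor product\<close>

text \<open>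
  The cotensor product, freed from the comodule records; it is the equalizer of two algebra maps.
\<close>

definition cot where
  "cot = T\<lparr>carrier := {u \<in> carrier T. tensor_assoc AE BEE BEF (tensor_map (tensor AE BEE) BEF rho id u)
     = tensor_map AE (tensor BEE BEF) id (bilin_delta E E F) u}\<rparr>"

lemma cot_simps [simp]:
  "mult cot = mult T" "one cot = one T" "zero cot = zero T" "add cot = add T" "smult cot = smult T"
  by (simp_all add: cot_def)

lemma cot_carrier: "u \<in> carrier cot \<longleftrightarrow> u \<in> carrier T \<and>
    tensor_assoc AE BEE BEF (tensor_map (tensor AE BEE) BEF rho id u)
     = tensor_map AE (tensor BEE BEF) id (bilin_delta E E F) u"
  by (simp add: cot_def)

lemma k_algebra_cot: "k_algebra cot"
proof -
  interpret AB: k_tensor_algebra AE BEE by (intro k_tensor_algebra.intro k_algebra_quadratic k_algebra_bilin)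
  interpret BB: k_tensor_algebra BEE BEF by (intro k_tensor_algebra.intro k_algebra_bilin)
  interpret R: k_tensor_algebra AE "tensor BEE BEF" by (intro k_tensor_algebra.intro k_algebra_quadratic BB.k_algebra_tensor)
  note alg = k_algebra_quadratic k_algebra_bilin AB.k_algebra_tensor BB.k_algebra_tensor
  show ?thesis unfolding cot_def
    by (rule k_algebra_equalizer[OF T.k_algebra_tensor R.k_algebra_tensor
          algebra_hom_compose[OF tensor_map_algebra_hom[OF _ _ _ _ quad_delta_hom[OF E E] algebra_hom_id] tensor_assoc_algebra_hom]
          tensor_map_algebra_hom[OF _ _ _ _ algebra_hom_id bilin_delta_hom[OF E E F]]])
      (intro alg)+
qed

lemma f_g: "u \<in> carrier cot \<Longrightarrow> f (g u) = u"
proof -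
  assume u: "u \<in> carrier cot"
  interpret BB: k_tensor_algebra BEE BEF by (intro k_tensor_algebra.intro k_algebra_bilin)
  note va = AE.k_vector_space_axioms B.k_vector_space_axioms BB.k_vector_space_tensor
  have "f (g u) = tensor_map AE BEF id ell (tensor_map AE (tensor BEE BEF) id (bilin_delta E E F) u)"
    using u by (simp add: cot_carrier f_g_eq)
  also have "\<dots> = tensor_map AE BEF (\<lambda>x. id (id x)) (\<lambda>b. ell (bilin_delta E E F b)) u"
    using u by (intro tensor_map_compose[OF va(1,2) va(1,3) va(1,2) linear_hom_id linear_hom_id
          algebra_homD(1)[OF bilin_delta_hom[OF E E F]] ell_linear]) (simp add: cot_carrier)
  also have "\<dots> = u"
    using u by (intro tensor_map_id[OF va(1,2)]) (simp_all add: cot_carrier ell_left_coaction)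
  finally show ?thesis .
qed

lemma f_in_cot: "y \<in> carrier AF \<Longrightarrow> f y \<in> carrier cot"
  using quad_delta_coassoc[OF E E F F] algebra_homD(3)[OF f_hom] by (simp add: cot_carrier)

lemma f_hom_cot: "f \<in> algebra_hom AF cot"
proof (rule algebra_homI)
  show "f \<in> linear_hom AF cot"
    by (rule linear_homI)
      (simp_all add: f_in_cot linear_hom_add[OF algebra_homD(1)[OF f_hom]] linear_hom_smult[OF algebra_homD(1)[OF f_hom]])
qed (simp_all add: algebra_homD(4,5)[OF f_hom])

lemma f_bij: "bij_betw f (carrier AF) (carrier cot)"
proof (rule bij_betw_byWitness[of _ g])
  show "g ` carrier cot \<subseteq> carrier AF" using linear_hom_closed[OF g_linear] by (auto simp: cot_carrier)
qed (auto simp: g_f f_g f_in_cot)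

lemma cot_inclusion: "id \<in> linear_hom cot T"
  by (rule linear_homI) (simp_all add: cot_carrier)

lemma cot_retraction: "(\<lambda>u. f (g u)) \<in> linear_hom T cot"
  by (rule linear_hom_compose[OF g_linear algebra_homD(1)[OF f_hom_cot]])

abbreviation "theta_embed \<equiv> \<lambda>w. tensor_assoc AE BEF BFF (tensor_map T BFF id id w)"

text \<open>
  \<open>f \<circ> g\<close> is the identity on the cotensor product and defined on the whole tensor product, so
  \<open>(f \<circ> g) \<otimes> id\<close> is a left inverse.
\<close>

lemma theta_embed_inj: "inj_on theta_embed (carrier (tensor cot BFF))"
proof (rule inj_on_inverseI)
  interpret BF: k_algebra BFF by (rule k_algebra_bilin)
  interpret C: k_algebra cot by (rule k_algebra_cot)
  fix w assume w: "w \<in> carrier (tensor cot BFF)"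
  note va = AE.k_vector_space_axioms B.k_vector_space_axioms BF.k_vector_space_axioms
  note m = C.k_vector_space_axioms BF.k_vector_space_axioms TA.k_vector_space_axioms BF.k_vector_space_axioms
  have "tensor_map cot BFF (\<lambda>u. f (g u)) id (tensor_assoc_inv AE BEF BFF (theta_embed w))
      = tensor_map cot BFF (\<lambda>u. f (g u)) id (tensor_map T BFF id id w)"
    by (subst tensor_assoc_inv_assoc[OF va])
      (simp_all add: linear_hom_closed[OF tensor_map_linear[OF m cot_inclusion linear_hom_id] w])
  also have "\<dots> = tensor_map cot BFF (\<lambda>u. f (g (id u))) (\<lambda>d. id (id d)) w"
    by (rule tensor_map_compose[OF m m(1,2) cot_inclusion cot_retraction linear_hom_id linear_hom_id w])
  also have "\<dots> = w"
    by (rule tensor_map_id[OF m(1,2) w]) (simp_all add: f_g)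
  finally show "tensor_map cot BFF (\<lambda>u. f (g u)) id (tensor_assoc_inv AE BEF BFF (theta_embed w)) = w" .
qed

text \<open>
  The element \<open>(f \<otimes> id) (\<rho> y)\<close> is the corestriction of \<open>(id \<otimes> \<Delta>) (f y)\<close>, by coassociativity of the chain
  \<open>E\<close>, \<open>F\<close>, \<open>F\<close>.
\<close>

lemma theta_coaction:
  assumes y: "y \<in> carrier AF"
  shows "the_inv_into (carrier (tensor cot BFF)) theta_embed (tensor_map AE (tensor BEF BFF) id (bilin_delta E F F) (f y))
    = tensor_map cot BFF f id (quad_delta F F t y)"
proof (rule the_inv_into_f_eq[OF theta_embed_inj])
  interpret BF: k_algebra BFF by (rule k_algebra_bilin)
  interpret C: k_algebra cot by (rule k_algebra_cot)
  note fl = algebra_homD(1)[OF f_hom_cot]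
  have q: "quad_delta F F t y \<in> carrier (tensor AF BFF)" using algebra_homD(3)[OF quad_delta_hom[OF F F] y] .
  note m = AF.k_vector_space_axioms BF.k_vector_space_axioms C.k_vector_space_axioms BF.k_vector_space_axioms
  show "tensor_map cot BFF f id (quad_delta F F t y) \<in> carrier (tensor cot BFF)"
    by (rule linear_hom_closed[OF tensor_map_linear[OF m fl linear_hom_id] q])
  have "tensor_map T BFF id id (tensor_map cot BFF f id (quad_delta F F t y))
      = tensor_map T BFF (\<lambda>x. id (f x)) (\<lambda>d. id (id d)) (quad_delta F F t y)"
    by (rule tensor_map_compose[OF m TA.k_vector_space_axioms m(2) fl cot_inclusion linear_hom_id linear_hom_id q])
  also have "\<dots> = tensor_map T BFF f id (quad_delta F F t y)" by (simp add: id_def)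
  finally show "theta_embed (tensor_map cot BFF f id (quad_delta F F t y))
      = tensor_map AE (tensor BEF BFF) id (bilin_delta E F F) (f y)"
    using quad_delta_coassoc[OF E F F F y] by simp
qed

lemma cotensor_eq: "cotensor (bilin_bialgebra E) (quadratic_comodule E t) (bilin_bicomodule E F) = cot"
proof -
  note s = same_quadratic[of E t] same_bicomodule[of E F] same_bialgebra[of E]
  show ?thesis
    unfolding cotensor_def cot_def structure_maps
    by (simp only: same_algebra_tensor(1)[OF s(1) s(2)] same_algebra_tensor_assoc[OF s(1) s(3) s(2)]
        same_algebra_tensor(1)[OF s(1) s(3)] same_algebra_tensor(1)[OF s(3) s(2)]
        same_algebra_tensor_map[OF same_algebra_refl s(2)] same_algebra_tensor_map[OF s(1) same_algebra_refl])
qed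

abbreviation "Th \<equiv> Theta E F (quadratic_comodule E t)"

lemma same_Theta: "same_algebra Th cot"
  by (simp add: same_algebra_def Theta_def cotensor_comodule_def cotensor_eq module.defs)

lemma Theta_coact: "coact Th = (\<lambda>u. the_inv_into (carrier (tensor cot BFF)) theta_embed
    (tensor_map AE (tensor BEF BFF) id (bilin_delta E F F) u))"
proof -
  note s = same_quadratic[of E t] same_bicomodule[of E F] same_bialgebra[of F]
  have "coact Th = (\<lambda>u. the_inv_into (carrier (tensor cot (bilin_bialgebra F)))
       (\<lambda>y. tensor_assoc (quadratic_comodule E t) (bilin_bicomodule E F) (bilin_bialgebra F)
          (tensor_map (tensor (quadratic_comodule E t) (bilin_bicomodule E F)) (bilin_bialgebra F) id id y))
       (tensor_map (quadratic_comodule E t) (tensor (bilin_bicomodule E F) (bilin_bialgebra F)) id (bilin_delta E F F) u))"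
    by (simp add: Theta_def cotensor_comodule_def cotensor_eq module.defs comodule.defs)
  then show ?thesis
    by (simp only: same_algebra_tensor(1)[OF s(1) s(2)] same_algebra_tensor(1)[OF s(2) same_algebra_refl]
        same_algebra_tensor(1)[OF same_algebra_refl s(3)]
        same_algebra_tensor_assoc[OF s] same_algebra_tensor_map[OF same_algebra_refl s(3)]
        same_algebra_tensor_map[OF s(1) same_algebra_refl])
qed

theorem Theta_iso: "comodule_algebra_isomorphic (bilin_bialgebra F) Th (quadratic_comodule F t)"
proof -
  let ?A = "quadratic_comodule F t" and ?H = "bilin_bialgebra F"
  note sA = same_quadratic[of F t] and sH = same_bialgebra[of F] and sT = same_Theta
  have cA: "carrier ?A = carrier AF" and cT: "carrier Th = carrier cot"
    using sA sT by (auto simp: same_algebra_def)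
  have A: "right_comodule_algebra ?H ?A" by (rule quadratic_comodule_algebra[OF F])
  have Th: "k_algebra Th" by (rule same_algebra_k_algebra[OF same_algebra_sym[OF sT] k_algebra_cot])
  have hom: "f \<in> algebra_hom ?A Th"
    using f_hom_cot by (simp add: same_algebra_algebra_hom[OF sA sT])
  have bij: "bij_betw f (carrier ?A) (carrier Th)" using f_bij by (simp add: cA cT)
  have co: "coact Th (f x) = tensor_map Th ?H f id (coact ?A x)" if "x \<in> carrier ?A" for x
    using theta_coaction[of x] that
    by (simp add: Theta_coact cA same_algebra_tensor_map[OF sT sH])
  note tr = comodule_algebra_transport[OF A Th hom bij co]
  show ?thesis
    unfolding comodule_algebra_isomorphic_def using A tr by blast
qed

end

theorem proposition5p4:
  fixes E :: "('k::field_char_0)^'m^'m" and F :: "'k^'n^'n" and t :: 'k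
  assumes E: "invertible E"
  shows "right_comodule_algebra (bilin_bialgebra E) (quadratic_comodule E t) \<and>
    (\<forall>i. coact (quadratic_comodule E t) (quadratic_gen (matrix_inv E) t i) =
      (\<Oplus>\<^bsub>tensor (quadratic_comodule E t) (bilin_bialgebra E)\<^esub>k\<in>UNIV.
        pure_tensor (quadratic_comodule E t) (bilin_bialgebra E)
          (quadratic_gen (matrix_inv E) t k) (bilin_gen E E k i))) \<and>
    (invertible F \<longrightarrow>
     trace (matrix_inv E ** transpose E) = trace (matrix_inv F ** transpose F) \<longrightarrow>
     CARD('m) \<ge> 2 \<longrightarrow> CARD('n) \<ge> 2 \<longrightarrow>
      comodule_algebra_isomorphic (bilin_bialgebra F)
        (Theta E F (quadratic_comodule E t)) (quadratic_comodule F t))"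
proof (intro conjI allI impI)
  show "right_comodule_algebra (bilin_bialgebra E) (quadratic_comodule E t)"
    by (rule quadratic_comodule_algebra[OF E])
next
  fix i
  note t = same_algebra_tensor[OF same_quadratic[of E t] same_bialgebra[of E]]
  show "coact (quadratic_comodule E t) (quadratic_gen (matrix_inv E) t i) =
      (\<Oplus>\<^bsub>tensor (quadratic_comodule E t) (bilin_bialgebra E)\<^esub>k\<in>UNIV.
        pure_tensor (quadratic_comodule E t) (bilin_bialgebra E)
          (quadratic_gen (matrix_inv E) t k) (bilin_gen E E k i))"
    unfolding t structure_maps by (rule quad_delta_gen[OF E E])
next
  assume F: "invertible F"
    and tr: "trace (matrix_inv E ** transpose E) = trace (matrix_inv F ** transpose F)"
    and card: "CARD('m) \<ge> 2" "CARD('n) \<ge> 2"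
  obtain l where "l \<in> linear_hom (bilin_algebra E F) scalar_algebra" "l \<one>\<^bsub>bilin_algebra E F\<^esub> = 1"
    using bilin_nontrivial[OF E F card tr] by (rule functional_one_bilin)
  then interpret bilin_pair E F t l
    by (unfold_locales) (use E F in auto)
  show "comodule_algebra_isomorphic (bilin_bialgebra F) (Theta E F (quadratic_comodule E t)) (quadratic_comodule F t)"
    by (rule Theta_iso)
qed

end
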